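(* Let $\mathfrak{u}$ be a generating set of a finitely generated discrete group $G$. (i) If $\mathfrak{u}$ is finite and $\mathcal{S}(\mathfrak{u})$ is $(\min,\max)$-nuclear, then $G$ is finite. (ii) If $\mathfrak{u}$ is a minimal generating set, then $\mathcal{S}(\mathfrak{u})$ is $(\min,\max)$-nuclear if and only if $G$ is of order less than or equal to $3$.
   Context: For a generating set $\mathfrak{u}$ of a discrete group $G$, $\mathcal{S}(\mathfrak{u}):=\mathrm{span}\{1,u,u^*:u\in\mathfrak{u}\}\subset C^*(G)$, where group elements are identified with the corresponding unitaries in the full group $C^*$-algebra $C^*(G)$. A generating set is minimal if no proper subset of it generates $G$. An operator system is a unital self-adjoint subspace of $B(\mathcal{H})$ for a complex Hilbert space $\mathcal{H}$. Tensor products of operator systems $\mathcal{S},\mathcal{T}$ (operator system structures on the algebraic tensor product $\mathcal{S}\otimes\mathcal{T}$ with unit $1\otimes1$): $\mathcal{S}\otimes_{\min}\mathcal{T}$ is the structure inherited from $B(\mathcal{H}\otimes\mathcal{K})$ when $\mathcal{S}\subseteq B(\mathcal{H})$, $\mathcal{T}\subseteq B(\mathcal{K})$. $\mathcal{S}\otimes_{\max}\mathcal{T}$ has as positive cone in $M_n(\mathcal{S}\otimes\mathcal{T})$ the set of $x$ such that $r(1\otimes1)_n+x\in D_n$ for all $r>0$, where $(1\otimes1)_n$ is the diagonal matrix with diagonal entries $1\otimes1$ and $D_n=\{\alpha(P\otimes Q)\alpha^*: P\in M_k(\mathcal{S})^+, Q\in M_m(\mathcal{T})^+, \alpha\in M_{n,km}(\mathbb{C}),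 k,m\in\mathbb{N}\}$. $\mathcal{S}$ is $(\min,\max)$-nuclear if for every operator system $\mathcal{T}$ the identity map $\mathcal{S}\otimes_{\min}\mathcal{T}\to\mathcal{S}\otimes_{\max}\mathcal{T}$ is a complete order isomorphism. *)

theory Defs
  imports
    "HOL-Analysis.Analysis"
    "HOL-Algebra.Generated_Groups"
    "HOL-Library.Function_Algebras"
    "HOL-Library.Infinite_Typeclass"
begin

section \<open>Hilbert spaces and bounded operators\<close>

text \<open>
  Every complex Hilbert space is unitarily equivalent to \<open>\<ell>\<^sup>2(I)\<close> for some index set \<open>I\<close>
  (an orthonormal basis), and Hilbert spaces are taken in this form.  Then
  \<open>\<ell>\<^sup>2(I) \<otimes> \<ell>\<^sup>2(J)\<close> is \<open>\<ell>\<^sup>2(I \<times> J)\<close>, and the direct sum of the \<open>\<ell>\<^sup>2(I\<^sub>r)\<close> over \<open>r \<in> R\<close> is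
  \<open>\<ell>\<^sup>2\<close> of the disjoint union of the \<open>I\<^sub>r\<close>.
  Vectors are functions on the whole index type, vanishing off \<open>I\<close>; operators are functions on
  all vectors, with value \<open>0\<close> off \<open>\<ell>\<^sup>2(I)\<close>, so that HOL equality is equality of operators.
\<close>

type_synonym 'i vec = "'i \<Rightarrow> complex"
type_synonym 'i oper = "'i vec \<Rightarrow> 'i vec"

definition ell2 :: "'i set \<Rightarrow> 'i vec set" where
  "ell2 I = {f. (\<forall>i. i \<notin> I \<longrightarrow> f i = 0) \<and> (\<lambda>i. (cmod (f i))\<^sup>2) summable_on I}"

definition ell2_inner :: "'i vec \<Rightarrow> 'i vec \<Rightarrow> complex" where
  "ell2_inner f g = (\<Sum>\<^sub>\<infinity>i. cnj (f i) * g i)"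

definition ell2_norm :: "'i vec \<Rightarrow> real" where
  "ell2_norm f = sqrt (\<Sum>\<^sub>\<infinity>i. (cmod (f i))\<^sup>2)"

definition vec_scale :: "complex \<Rightarrow> 'i vec \<Rightarrow> 'i vec" where
  "vec_scale c f = (\<lambda>i. c * f i)"

definition oper_scale :: "complex \<Rightarrow> 'i oper \<Rightarrow> 'i oper" where
  "oper_scale c A = (\<lambda>f. vec_scale c (A f))"

global_interpretation oper: vector_space "oper_scale :: complex \<Rightarrow> 'i oper \<Rightarrow> 'i oper"
  by standard (auto simp: oper_scale_def vec_scale_def fun_eq_iff algebra_simps)

definition bounded_ops :: "'i set \<Rightarrow> 'i oper set" where
  "bounded_ops I = {A.
     (\<forall>f. f \<notin> ell2 I \<longrightarrow> A f = 0) \<and>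
     (\<forall>f\<in>ell2 I. A f \<in> ell2 I) \<and>
     (\<forall>f\<in>ell2 I. \<forall>g\<in>ell2 I. A (f + g) = A f + A g) \<and>
     (\<forall>c. \<forall>f\<in>ell2 I. A (vec_scale c f) = vec_scale c (A f)) \<and>
     (\<exists>C. \<forall>f\<in>ell2 I. ell2_norm (A f) \<le> C * ell2_norm f)}"

definition id_op :: "'i set \<Rightarrow> 'i oper" where
  "id_op I = (\<lambda>f. if f \<in> ell2 I then f else 0)"

definition adjoint_op :: "'i set \<Rightarrow> 'i oper \<Rightarrow> 'i oper" where
  "adjoint_op I A = (THE B. B \<in> bounded_ops I \<and>
     (\<forall>f\<in>ell2 I. \<forall>g\<in>ell2 I. ell2_inner (A f) g = ell2_inner f (B g)))"

definition unitary_ops :: "'i set \<Rightarrow> 'i oper set" where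
  "unitary_ops I = {U \<in> bounded_ops I. U ` ell2 I = ell2 I \<and>
     (\<forall>f\<in>ell2 I. \<forall>g\<in>ell2 I. ell2_inner (U f) (U g) = ell2_inner f g)}"

text \<open>
  The operator \<open>A \<otimes> B\<close> on \<open>\<ell>\<^sup>2(I \<times> J)\<close>, as \<open>(A \<otimes> 1)(1 \<otimes> B)\<close>: apply \<open>B\<close> in the second variable,
  then \<open>A\<close> in the first.  It sends \<open>f \<otimes> g\<close> to \<open>A f \<otimes> B g\<close>.
\<close>

definition tensor_op :: "'i set \<Rightarrow> 'j set \<Rightarrow> 'i oper \<Rightarrow> 'j oper \<Rightarrow> ('i \<times> 'j) oper" where
  "tensor_op I J A B = (\<lambda>h. if h \<in> ell2 (I \<times> J)
     then (\<lambda>(i, j). A (\<lambda>i'. B (\<lambda>j'. h (i', j')) j) i) else 0)"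


section \<open>Operator systems and their tensor products\<close>

definition operator_system :: "'i set \<Rightarrow> 'i oper set \<Rightarrow> bool" where
  "operator_system I S \<longleftrightarrow> S \<subseteq> bounded_ops I \<and> oper.subspace S \<and>
     id_op I \<in> S \<and> (\<forall>A\<in>S. adjoint_op I A \<in> S)"

text \<open>
  An \<open>n \<times> n\<close> matrix is a function of two indices of which only the values at indices below \<open>n\<close>
  matter.
\<close>

definition matrices_over :: "nat \<Rightarrow> 'v set \<Rightarrow> (nat \<Rightarrow> nat \<Rightarrow> 'v) set" where
  "matrices_over n V = {x. \<forall>i<n. \<forall>j<n. x i j \<in> V}"

text \<open>
  \<open>M\<^sub>n(S)\<^sup>+\<close>: the matrices over \<open>S\<close> that are positive as operators on the \<open>n\<close>-fold direct sum of
  \<open>\<ell>\<^sup>2(I)\<close>.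
\<close>

definition matrix_cone :: "'i set \<Rightarrow> 'i oper set \<Rightarrow> nat \<Rightarrow> (nat \<Rightarrow> nat \<Rightarrow> 'i oper) set" where
  "matrix_cone I S n = {x \<in> matrices_over n S.
     \<forall>\<xi>. (\<forall>i<n. \<xi> i \<in> ell2 I) \<longrightarrow>
       (\<Sum>i<n. \<Sum>j<n. ell2_inner (\<xi> i) (x i j (\<xi> j))) \<in> \<real>\<^sub>\<ge>\<^sub>0}"

text \<open>
  The algebraic tensor product, realized inside the bounded operators on \<open>\<ell>\<^sup>2(I \<times> J)\<close>.
\<close>

definition alg_tensor ::
    "'i set \<Rightarrow> 'j set \<Rightarrow> 'i oper set \<Rightarrow> 'j oper set \<Rightarrow> ('i \<times> 'j) oper set" where
  "alg_tensor I J S T = oper.span {tensor_op I J A B | A B. A \<in> S \<and> B \<in> T}"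

definition min_cone :: "'i set \<Rightarrow> 'j set \<Rightarrow> 'i oper set \<Rightarrow> 'j oper set \<Rightarrow>
    nat \<Rightarrow> (nat \<Rightarrow> nat \<Rightarrow> ('i \<times> 'j) oper) set" where
  "min_cone I J S T n = matrix_cone (I \<times> J) (alg_tensor I J S T) n"

text \<open>
  The cone \<open>D\<^sub>n\<close> of all \<open>\<alpha>(P \<otimes> Q)\<alpha>\<^sup>*\<close>.  The \<open>km\<close> columns of \<open>\<alpha>\<close>, and the rows and columns of
  \<open>P \<otimes> Q\<close>, are indexed by the pairs \<open>(a, b)\<close> with \<open>a < k\<close> and \<open>b < m\<close>; the entry of \<open>P \<otimes> Q\<close> at
  \<open>(a, b), (a', b')\<close> is \<open>P\<^sub>a\<^sub>a\<^sub>' \<otimes> Q\<^sub>b\<^sub>b\<^sub>'\<close>.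
\<close>

definition max_cone_pre :: "'i set \<Rightarrow> 'j set \<Rightarrow> 'i oper set \<Rightarrow> 'j oper set \<Rightarrow>
    nat \<Rightarrow> (nat \<Rightarrow> nat \<Rightarrow> ('i \<times> 'j) oper) set" where
  "max_cone_pre I J S T n = {x. \<exists>k m. \<exists>P\<in>matrix_cone I S k. \<exists>Q\<in>matrix_cone J T m.
     \<exists>\<alpha> :: nat \<Rightarrow> nat \<times> nat \<Rightarrow> complex. \<forall>i<n. \<forall>j<n.
       x i j = (\<Sum>(a, b)\<in>{..<k} \<times> {..<m}. \<Sum>(a', b')\<in>{..<k} \<times> {..<m}.
         oper_scale (\<alpha> i (a, b) * cnj (\<alpha> j (a', b'))) (tensor_op I J (P a a') (Q b b')))}"

definition max_cone :: "'i set \<Rightarrow> 'j set \<Rightarrow> 'i oper set \<Rightarrow> 'j oper set \<Rightarrow>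
    nat \<Rightarrow> (nat \<Rightarrow> nat \<Rightarrow> ('i \<times> 'j) oper) set" where
  "max_cone I J S T n = {x \<in> matrices_over n (alg_tensor I J S T). \<forall>r::real. r > 0 \<longrightarrow>
     (\<lambda>i j. (if i = j then oper_scale (complex_of_real r) (tensor_op I J (id_op I) (id_op J))
             else 0) + x i j) \<in> max_cone_pre I J S T n}"

text \<open>
  In the next two definitions, \<open>C\<close> and \<open>D\<close> assign to each \<open>n\<close> the positive cone in \<open>M\<^sub>n(V)\<close> and
  in \<open>M\<^sub>n(W)\<close>.
\<close>

definition completely_positive ::
    "(nat \<Rightarrow> (nat \<Rightarrow> nat \<Rightarrow> 'v) set) \<Rightarrow> (nat \<Rightarrow> (nat \<Rightarrow> nat \<Rightarrow> 'w) set) \<Rightarrow> ('v \<Rightarrow> 'w) \<Rightarrow> bool" where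
  "completely_positive C D \<phi> \<longleftrightarrow> (\<forall>n. \<forall>x\<in>C n. (\<lambda>i j. \<phi> (x i j)) \<in> D n)"

definition complete_order_isomorphism ::
    "'i oper set \<Rightarrow> (nat \<Rightarrow> (nat \<Rightarrow> nat \<Rightarrow> 'i oper) set) \<Rightarrow>
     'j oper set \<Rightarrow> (nat \<Rightarrow> (nat \<Rightarrow> nat \<Rightarrow> 'j oper) set) \<Rightarrow> ('i oper \<Rightarrow> 'j oper) \<Rightarrow> bool" where
  "complete_order_isomorphism V C W D \<phi> \<longleftrightarrow>
     bij_betw \<phi> V W \<and>
     (\<forall>A\<in>V. \<forall>B\<in>V. \<phi> (A + B) = \<phi> A + \<phi> B) \<and>
     (\<forall>c. \<forall>A\<in>V. \<phi> (oper_scale c A) = oper_scale c (\<phi> A)) \<and>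
     completely_positive C D \<phi> \<and> completely_positive D C (inv_into V \<phi>)"

text \<open>
  HOL cannot quantify over Hilbert spaces of all cardinalities at once: \<open>T\<close> ranges over the
  operator systems on Hilbert spaces of dimension at most the cardinality of \<open>'b\<close>, where
  \<open>'b\<close> is an arbitrary infinite type.
\<close>

definition min_max_nuclear :: "'b::infinite itself \<Rightarrow> 'i set \<Rightarrow> 'i oper set \<Rightarrow> bool" where
  "min_max_nuclear (_ :: 'b itself) I S \<longleftrightarrow> (\<forall>(J :: 'b set) T. operator_system J T \<longrightarrow>
     complete_order_isomorphism (alg_tensor I J S T) (min_cone I J S T)
       (alg_tensor I J S T) (max_cone I J S T) id)"


section \<open>The full group C*-algebra\<close>

definition unitary_rep ::
    "('g, 'm) monoid_scheme \<Rightarrow> 'i set \<Rightarrow> ('g \<Rightarrow> 'i oper) \<Rightarrow> bool" where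
  "unitary_rep G I \<rho> \<longleftrightarrow> (\<forall>g\<in>carrier G. \<rho> g \<in> unitary_ops I) \<and>
     (\<forall>g\<in>carrier G. \<forall>h\<in>carrier G. \<rho> (g \<otimes>\<^bsub>G\<^esub> h) = \<rho> g \<circ> \<rho> h)"

text \<open>
  The universal representation of \<open>G\<close> is the direct sum of all its unitary representations on
  the spaces \<open>\<ell>\<^sup>2(I)\<close> with \<open>I \<subseteq> G\<close>.  Since a cyclic representation has dimension at most \<open>|G|\<close>,
  this family contains every cyclic representation up to unitary equivalence, and every unitary
  representation is a direct sum of cyclic ones; so the direct sum induces the universal norm
  on the group algebra, and \<open>C\<^sup>*(G)\<close> is the norm closure of the span of its range.
\<close>

type_synonym 'g rep = "'g set \<times> ('g \<Rightarrow> 'g oper)"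

definition unitary_reps :: "('g, 'm) monoid_scheme \<Rightarrow> 'g rep set" where
  "unitary_reps G = {(I, \<rho>). I \<subseteq> carrier G \<and> unitary_rep G I \<rho>}"

definition univ_index :: "('g, 'm) monoid_scheme \<Rightarrow> ('g rep \<times> 'g) set" where
  "univ_index G = (SIGMA r:unitary_reps G. fst r)"

definition univ_rep :: "('g, 'm) monoid_scheme \<Rightarrow> 'g \<Rightarrow> ('g rep \<times> 'g) oper" where
  "univ_rep G g = (\<lambda>h. if h \<in> ell2 (univ_index G)
     then (\<lambda>(r, i). if r \<in> unitary_reps G then snd r g (\<lambda>i'. h (r, i')) i else 0) else 0)"

definition group_cstar :: "('g, 'm) monoid_scheme \<Rightarrow> ('g rep \<times> 'g) oper set" where
  "group_cstar G = {A \<in> bounded_ops (univ_index G).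
     \<forall>\<epsilon>>0. \<exists>B\<in>oper.span (univ_rep G ` carrier G).
       \<forall>f\<in>ell2 (univ_index G). ell2_norm (A f - B f) \<le> \<epsilon> * ell2_norm f}"

text \<open>
  The operator system \<open>S(\<uu>) \<subseteq> C\<^sup>*(G)\<close>, with \<open>g \<in> G\<close> identified with the unitary \<open>univ_rep G g\<close>.
\<close>

definition group_opsys :: "('g, 'm) monoid_scheme \<Rightarrow> 'g set \<Rightarrow> ('g rep \<times> 'g) oper set" where
  "group_opsys G \<uu> = oper.span ({id_op (univ_index G)} \<union> univ_rep G ` \<uu>
     \<union> (\<lambda>g. adjoint_op (univ_index G) (univ_rep G g)) ` \<uu>)"


section \<open>Generating sets\<close>

definition generating_set :: "('g, 'm) monoid_scheme \<Rightarrow> 'g set \<Rightarrow> bool" where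
  "generating_set G \<uu> \<longleftrightarrow> \<uu> \<subseteq> carrier G \<and> generate G \<uu> = carrier G"

definition minimal_generating_set :: "('g, 'm) monoid_scheme \<Rightarrow> 'g set \<Rightarrow> bool" where
  "minimal_generating_set G \<uu> \<longleftrightarrow> generating_set G \<uu> \<and> (\<forall>\<vv>. \<vv> \<subset> \<uu> \<longrightarrow> \<not> generating_set G \<vv>)"

definition finitely_generated :: "('g, 'm) monoid_scheme \<Rightarrow> bool" where
  "finitely_generated G \<longleftrightarrow> (\<exists>F. finite F \<and> generating_set G F)"

end

theory Submission
  imports Defs "HOL-Algebra.Multiplicative_Group"
begin

text \<open>
  Let \<open>W = {1} \<union> \<uu> \<union> \<uu>\<^sup>-\<^sup>1\<close>, so that \<open>S(\<uu>)\<close> is the span of \<open>W\<close>.  If \<open>S(\<uu>)\<close> is nuclear, then \<open>W\<close> is closed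
  under products, hence \<open>W = G\<close>.  For \<open>k, g \<in> W\<close> put \<open>b = g + k\<^sup>-\<^sup>1\<close> and \<open>d = g - k\<^sup>-\<^sup>1\<close>, so that
  \<open>b\<^sup>*b + d\<^sup>*d = 4\<close> although \<open>b\<^sup>*b = 2 + k g + (k g)\<^sup>*\<close>.  Tensoring with the tridiagonal \<open>3 \<times> 3\<close>
  matrices, nuclearity splits \<open>4\<close> inside \<open>S(\<uu>)\<close> into two parts which approximately dominate
  \<open>b\<^sup>*b\<close> and \<open>d\<^sup>*d\<close>; so \<open>b\<^sup>*b\<close> is a limit of elements of \<open>S(\<uu>)\<close>, and reading off its coefficient at
  \<open>k g\<close> in the regular representation gives \<open>k g \<in> W\<close>.

  If \<open>\<uu>\<close> is minimal, then a product of two distinct generators cannot lie in \<open>W\<close>, so \<open>\<uu>\<close> has at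
  most one element and \<open>W\<close> at most three.  Conversely, a group of order at most three is cyclic
  and equal to \<open>W\<close>, so that \<open>S(\<uu>)\<close> is spanned by the spectral projections of a generator.
\<close>

section \<open>Square-summable functions\<close>

text \<open>The tridiagonal pattern is chosen for its zero corner. A positive semidefinite scalar
  matrix with that corner zero is a sum of rank-one terms, each avoiding the first or the third
  coordinate; so a maximally positive element over this pattern splits into two positive pieces that
  overlap only in the middle entry. Minimal positivity gives no such splitting, and this gap is what
  the test exploits. Being 3 by 3, the test fits on any three points of \<open>'b\<close>, which is
  why one arbitrary infinite type suffices for the forward direction. The splitting is approximate,
  but the coefficient to be detected is at least 1, so a single fixed error replaces the passage to
  the limit. Conversely, the span of n orthogonal projections is a copy of C^n: an element of its
  tensor product with \<open>T\<close> is an n-tuple from \<open>T\<close>, and both cones ask that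
  every component be positive. The laborious inclusion is that of the maximal cone in the minimal
  one, because \<open>P \<otimes> Q\<close> must be shown positive on all of
  \<open>ell2 (I \<times> J)\<close>. Expanding \<open>P\<close> in the projections leaves scalar
  coefficient matrices, and a projection with finite rows commutes with operators on the other
  factor by linearity.\<close>

lemma sum_fun_apply: "(\<Sum>a\<in>A. f a) x = (\<Sum>a\<in>A. f a x)"
  for f :: "'a \<Rightarrow> 'b \<Rightarrow> 'c::comm_monoid_add"
  by (induction A rule: infinite_finite_induct) auto

lemma vec_scale_apply [simp]: "vec_scale c f i = c * f i"
  by (simp add: vec_scale_def)

lemma oper_scale_apply: "oper_scale c A f i = c * A f i"
  by (simp add: oper_scale_def)

lemma ell2_iff:
  "f \<in> ell2 I \<longleftrightarrow> (\<forall>i. i \<notin> I \<longrightarrow> f i = 0) \<and> (\<lambda>i. (cmod (f i))\<^sup>2) summable_on UNIV"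
proof -
  have "(\<lambda>i. (cmod (f i))\<^sup>2) summable_on I \<longleftrightarrow> (\<lambda>i. (cmod (f i))\<^sup>2) summable_on UNIV"
    if "\<forall>i. i \<notin> I \<longrightarrow> f i = 0"
    by (rule summable_on_cong_neutral) (use that in auto)
  then show ?thesis
    unfolding ell2_def by auto
qed

lemma ell2_outside: "f \<in> ell2 I \<Longrightarrow> i \<notin> I \<Longrightarrow> f i = 0"
  by (simp add: ell2_def)

lemma ell2_summable: "f \<in> ell2 I \<Longrightarrow> (\<lambda>i. (cmod (f i))\<^sup>2) summable_on UNIV"
  by (simp add: ell2_iff)

lemma zero_in_ell2 [simp]: "0 \<in> ell2 I" "(\<lambda>i. 0) \<in> ell2 I"
  by (simp_all add: ell2_iff)

lemma ell2_finite: "finite I \<Longrightarrow> f \<in> ell2 I \<longleftrightarrow> (\<forall>i. i \<notin> I \<longrightarrow> f i = 0)"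
  by (auto simp: ell2_def)

lemma cmod_add_square_le: "(cmod (a + b))\<^sup>2 \<le> 2 * (cmod a)\<^sup>2 + 2 * (cmod b)\<^sup>2"
proof -
  have "(cmod (a + b))\<^sup>2 \<le> (cmod a + cmod b)\<^sup>2"
    by (intro power_mono norm_triangle_ineq) auto
  also have "\<dots> \<le> 2 * (cmod a)\<^sup>2 + 2 * (cmod b)\<^sup>2"
    using sum_squares_bound[of "cmod a" "cmod b"] by (simp add: power2_sum)
  finally show ?thesis .
qed

lemma ell2_add:
  assumes "f \<in> ell2 I" "g \<in> ell2 I"
  shows "f + g \<in> ell2 I"
proof -
  have "(\<lambda>i. 2 * (cmod (f i))\<^sup>2 + 2 * (cmod (g i))\<^sup>2) summable_on UNIV"
    using assms by (intro summable_on_add summable_on_cmult_right ell2_summable)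
  then have "(\<lambda>i. (cmod (f i + g i))\<^sup>2) summable_on UNIV"
    by (rule summable_on_comparison_test) (auto intro: cmod_add_square_le)
  then show ?thesis
    using assms by (auto simp: ell2_iff)
qed

lemma ell2_scale: "f \<in> ell2 I \<Longrightarrow> vec_scale c f \<in> ell2 I"
  by (auto simp: ell2_iff norm_mult power_mult_distrib intro!: summable_on_cmult_right)

lemma ell2_uminus: "f \<in> ell2 I \<Longrightarrow> - f \<in> ell2 I"
  by (simp add: ell2_iff)

lemma ell2_diff: "f \<in> ell2 I \<Longrightarrow> g \<in> ell2 I \<Longrightarrow> f - g \<in> ell2 I"
  using ell2_add[OF _ ell2_uminus, of f I g] by simp

lemma ell2_sum: "(\<And>a. a \<in> A \<Longrightarrow> f a \<in> ell2 I) \<Longrightarrow> (\<Sum>a\<in>A. f a) \<in> ell2 I"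
  by (induction A rule: infinite_finite_induct) (auto intro: ell2_add simp del: zero_fun_apply)

section \<open>Inner product and norm\<close>

lemma ell2_inner_summable:
  assumes "f \<in> ell2 I" "g \<in> ell2 J"
  shows "(\<lambda>i. cnj (f i) * g i) summable_on UNIV"
proof -
  have "norm (cnj (f i) * cnj (f i)) = (cmod (f i))\<^sup>2" "norm (g i * g i) = (cmod (g i))\<^sup>2" for i
    by (simp_all add: norm_mult power2_eq_square)
  then have "(\<lambda>i. norm (cnj (f i) * cnj (f i))) summable_on UNIV" "(\<lambda>i. norm (g i * g i)) summable_on UNIV"
    using ell2_summable[OF assms(1)] ell2_summable[OF assms(2)] by presburger+
  then have "(\<lambda>i. norm (cnj (f i) * g i)) summable_on UNIV"
    by (rule Infinite_Sum.abs_summable_product)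
  then show ?thesis
    by (rule Infinite_Sum.abs_summable_summable)
qed

lemma ell2_inner_add_right:
  "f \<in> ell2 I \<Longrightarrow> g \<in> ell2 I \<Longrightarrow> h \<in> ell2 I \<Longrightarrow> ell2_inner f (g + h) = ell2_inner f g + ell2_inner f h"
  unfolding ell2_inner_def
  by (subst infsum_add[symmetric]) (auto simp: distrib_left intro!: ell2_inner_summable)

lemma ell2_inner_scale_right: "ell2_inner f (vec_scale c g) = c * ell2_inner f g"
  unfolding ell2_inner_def
  by (subst infsum_cmult_right'[symmetric]) (simp add: mult.left_commute)

lemma ell2_inner_cnj: "ell2_inner g f = cnj (ell2_inner f g)"
  unfolding ell2_inner_def infsum_cnj[symmetric] by (simp add: mult.commute)

lemma ell2_inner_add_left:
  "f \<in> ell2 I \<Longrightarrow> g \<in> ell2 I \<Longrightarrow> h \<in> ell2 I \<Longrightarrow> ell2_inner (f + g) h = ell2_inner f h + ell2_inner g h"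
  using ell2_inner_add_right[of h I f g]
  by (simp add: ell2_inner_cnj[of _ h])

lemma ell2_inner_scale_left: "ell2_inner (vec_scale c f) g = cnj c * ell2_inner f g"
  using ell2_inner_scale_right[of g c f] by (simp add: ell2_inner_cnj[of _ g])

lemma ell2_inner_zero [simp]: "ell2_inner f 0 = 0" "ell2_inner 0 f = 0"
  unfolding ell2_inner_def by simp_all

lemma ell2_inner_uminus [simp]:
  "ell2_inner f (- g) = - ell2_inner f g" "ell2_inner (- f) g = - ell2_inner f g"
  unfolding ell2_inner_def by (simp_all add: infsum_uminus)

lemma ell2_inner_diff_right:
  "f \<in> ell2 I \<Longrightarrow> g \<in> ell2 I \<Longrightarrow> h \<in> ell2 I \<Longrightarrow> ell2_inner f (g - h) = ell2_inner f g - ell2_inner f h"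
  using ell2_inner_add_right[of f I g "- h"] by (simp add: ell2_uminus)

lemma ell2_inner_diff_left:
  "f \<in> ell2 I \<Longrightarrow> g \<in> ell2 I \<Longrightarrow> h \<in> ell2 I \<Longrightarrow> ell2_inner (f - g) h = ell2_inner f h - ell2_inner g h"
  using ell2_inner_add_left[of f I "- g" h] by (simp add: ell2_uminus)

lemma ell2_inner_sum_right:
  assumes "f \<in> ell2 I" "\<And>a. a \<in> A \<Longrightarrow> g a \<in> ell2 I"
  shows "ell2_inner f (\<Sum>a\<in>A. g a) = (\<Sum>a\<in>A. ell2_inner f (g a))"
  using assms(2)
  by (induction A rule: infinite_finite_induct)
    (auto simp: ell2_inner_add_right[OF assms(1)] ell2_sum)

lemma ell2_inner_sum_left:
  assumes "f \<in> ell2 I" "\<And>a. a \<in> A \<Longrightarrow> g a \<in> ell2 I"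
  shows "ell2_inner (\<Sum>a\<in>A. g a) f = (\<Sum>a\<in>A. ell2_inner (g a) f)"
  using ell2_inner_sum_right[of f I A g] assms by (simp add: ell2_inner_cnj[of _ f])

lemma ell2_norm_nonneg [simp]: "ell2_norm f \<ge> 0"
  unfolding ell2_norm_def by (simp add: infsum_nonneg)

lemma ell2_norm_square: "(ell2_norm f)\<^sup>2 = (\<Sum>\<^sub>\<infinity>i. (cmod (f i))\<^sup>2)"
  unfolding ell2_norm_def by (simp add: infsum_nonneg)

lemma ell2_norm_has_sum: "f \<in> ell2 I \<Longrightarrow> ((\<lambda>i. (cmod (f i))\<^sup>2) has_sum (ell2_norm f)\<^sup>2) UNIV"
  by (simp add: ell2_norm_square ell2_summable)

lemma infsum_complex_of_real: "(\<Sum>\<^sub>\<infinity>i\<in>A. complex_of_real (f i)) = complex_of_real (\<Sum>\<^sub>\<infinity>i\<in>A. f i)"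
proof (cases "f summable_on A")
  case True
  then show ?thesis
    by (intro infsumI has_sum_of_real) simp
next
  \<comment> \<open>If the real family is not summable, neither is its complex image, whose real
    part it is; both infinite sums then have the default value 0.\<close>
  case False
  then have "\<not> (\<lambda>i. complex_of_real (f i)) summable_on A"
    using summable_on_Re[of "\<lambda>i. complex_of_real (f i)" A] by auto
  with False show ?thesis
    by (simp add: infsum_not_exists)
qed

lemma ell2_inner_self: "ell2_inner f f = complex_of_real ((ell2_norm f)\<^sup>2)"
proof -
  have "ell2_inner f f = (\<Sum>\<^sub>\<infinity>i. complex_of_real ((cmod (f i))\<^sup>2))"
    unfolding ell2_inner_def by (simp add: complex_norm_square mult.commute flip: of_real_power)
  then show ?thesis
    by (simp only: ell2_norm_square infsum_complex_of_real)
qed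

lemma cmod_le_ell2_norm:
  assumes "f \<in> ell2 I"
  shows "cmod (f i) \<le> ell2_norm f"
proof -
  have "(\<Sum>i\<in>{i}. (cmod (f i))\<^sup>2) \<le> (\<Sum>\<^sub>\<infinity>i. (cmod (f i))\<^sup>2)"
    by (rule finite_sum_le_infsum) (use assms in \<open>auto simp: ell2_summable\<close>)
  then have "(cmod (f i))\<^sup>2 \<le> (ell2_norm f)\<^sup>2"
    by (simp add: ell2_norm_square)
  then show ?thesis
    by (rule power2_le_imp_le) simp
qed

lemma ell2_norm_eq_0_iff:
  assumes "f \<in> ell2 I"
  shows "ell2_norm f = 0 \<longleftrightarrow> f = 0"
proof
  assume "ell2_norm f = 0"
  then show "f = 0"
    using cmod_le_ell2_norm[OF assms] by (auto simp: fun_eq_iff)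
qed (simp add: ell2_norm_def)

lemma ell2_norm_scale: "ell2_norm (vec_scale c f) = cmod c * ell2_norm f"
  unfolding ell2_norm_def
  by (simp only: vec_scale_apply norm_mult power_mult_distrib infsum_cmult_right' real_sqrt_mult
    real_sqrt_abs abs_norm_cancel)

text \<open>The factor \<open>2\<close> makes the triangle inequality follow from the one for numbers, without
  the Cauchy-Schwarz inequality.\<close>

lemma ell2_norm_add_le:
  assumes "f \<in> ell2 I" "g \<in> ell2 I"
  shows "ell2_norm (f + g) \<le> 2 * (ell2_norm f + ell2_norm g)"
proof (rule power2_le_imp_le)
  have "(ell2_norm (f + g))\<^sup>2 \<le> 2 * (ell2_norm f)\<^sup>2 + 2 * (ell2_norm g)\<^sup>2"
  proof (rule has_sum_mono)
    show "((\<lambda>i. (cmod ((f + g) i))\<^sup>2) has_sum (ell2_norm (f + g))\<^sup>2) UNIV"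
      using assms by (intro ell2_norm_has_sum ell2_add)
    show "((\<lambda>i. 2 * (cmod (f i))\<^sup>2 + 2 * (cmod (g i))\<^sup>2) has_sum
        2 * (ell2_norm f)\<^sup>2 + 2 * (ell2_norm g)\<^sup>2) UNIV"
      using assms by (intro has_sum_add has_sum_cmult_right ell2_norm_has_sum)
  qed (auto intro: cmod_add_square_le)
  also have "\<dots> \<le> (2 * (ell2_norm f + ell2_norm g))\<^sup>2"
    by (simp add: power2_sum power_mult_distrib)
  finally show "(ell2_norm (f + g))\<^sup>2 \<le> (2 * (ell2_norm f + ell2_norm g))\<^sup>2" .
qed simp

definition unit_vec :: "'i \<Rightarrow> 'i vec" where
  "unit_vec x = (\<lambda>i. if i = x then 1 else 0)"

lemma unit_vec_in_ell2: "x \<in> I \<Longrightarrow> unit_vec x \<in> ell2 I"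
proof -
  have "(\<lambda>i. (cmod (unit_vec x i))\<^sup>2) summable_on UNIV"
    by (rule finite_nonzero_values_imp_summable_on, rule finite_subset[of _ "{x}"])
      (auto simp: unit_vec_def)
  then show "x \<in> I \<Longrightarrow> unit_vec x \<in> ell2 I"
    by (auto simp: ell2_iff unit_vec_def)
qed

lemma ell2_inner_unit_vec: "ell2_inner (unit_vec x) f = f x"
proof -
  have "ell2_inner (unit_vec x) f = (\<Sum>\<^sub>\<infinity>i\<in>{x}. f i)"
    unfolding ell2_inner_def by (rule infsum_cong_neutral) (auto simp: unit_vec_def)
  then show ?thesis
    by simp
qed

subsection \<open>Functions of two variables\<close>

lemma ell2_slice:
  assumes "h \<in> ell2 K"
  shows "(\<lambda>b. h (a, b)) \<in> ell2 {b. (a, b) \<in> K}"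
proof -
  have "(\<lambda>(a, b). (cmod (h (a, b)))\<^sup>2) summable_on (SIGMA a:UNIV. UNIV)"
    using ell2_summable[OF assms] by (simp add: case_prod_unfold)
  then have "(\<lambda>b. (cmod (h (a, b)))\<^sup>2) summable_on UNIV"
    by (rule summable_on_SigmaD1) auto
  then show ?thesis
    using assms by (auto simp: ell2_iff)
qed

lemma ell2_slice_times:
  assumes "h \<in> ell2 (I \<times> J)"
  shows "(\<lambda>b. h (a, b)) \<in> ell2 J"
  using ell2_slice[OF assms, of a] by (auto simp: ell2_iff)

lemma ell2_norm_slices:
  assumes "h \<in> ell2 K"
  shows "((\<lambda>a. (ell2_norm (\<lambda>b. h (a, b)))\<^sup>2) has_sum (ell2_norm h)\<^sup>2) UNIV"
  by (rule has_sum_Sigma'[where f = "\<lambda>i. (cmod (h i))\<^sup>2" and B = "\<lambda>_. UNIV"])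
    (use assms in \<open>auto intro!: ell2_norm_has_sum ell2_slice\<close>)

text \<open>Tonelli: the terms are nonnegative, so summability of the row sums gives joint
  summability. It serves for functions that are built row by row, such as the values of the
  universal representation.\<close>

lemma ell2_of_slices:
  assumes "\<And>a b. (a, b) \<notin> K \<Longrightarrow> h (a, b) = 0"
    and "\<And>a. (\<lambda>b. h (a, b)) \<in> ell2 UNIV"
    and "(\<lambda>a. (ell2_norm (\<lambda>b. h (a, b)))\<^sup>2) summable_on UNIV"
  shows "h \<in> ell2 K"
proof -
  have "(\<lambda>i. (cmod (h i))\<^sup>2) summable_on (SIGMA a:UNIV. UNIV)"
    by (rule summable_on_SigmaI[where g = "\<lambda>a. (ell2_norm (\<lambda>b. h (a, b)))\<^sup>2"])
      (use assms in \<open>auto intro!: ell2_norm_has_sum\<close>)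
  then show ?thesis
    using assms(1) by (auto simp: ell2_iff)
qed

text \<open>The form with \<open>has_sum\<close> also carries convergence of the outer sum, so that
  equality or positivity of the row contributions passes directly to the total.\<close>

lemma ell2_inner_slices:
  assumes "h \<in> ell2 K" "k \<in> ell2 L"
  shows "((\<lambda>a. ell2_inner (\<lambda>b. h (a, b)) (\<lambda>b. k (a, b))) has_sum ell2_inner h k) UNIV"
proof (rule has_sum_Sigma'[where f = "\<lambda>i. cnj (h i) * k i" and B = "\<lambda>_. UNIV"])
  show "((\<lambda>i. cnj (h i) * k i) has_sum ell2_inner h k) (UNIV \<times> UNIV)"
    unfolding ell2_inner_def using ell2_inner_summable[OF assms] by simp
  show "((\<lambda>b. cnj (h (a, b)) * k (a, b)) has_sum ell2_inner (\<lambda>b. h (a, b)) (\<lambda>b. k (a, b))) UNIV" for a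
    unfolding ell2_inner_def
    using ell2_inner_summable[OF ell2_slice[OF assms(1)] ell2_slice[OF assms(2)]] by simp
qed

lemma ell2_swap:
  assumes "h \<in> ell2 (I \<times> J)"
  shows "(\<lambda>(b, a). h (a, b)) \<in> ell2 (J \<times> I)"
proof -
  have "(\<lambda>(a, b). (cmod (h (a, b)))\<^sup>2) summable_on UNIV \<times> UNIV"
    using ell2_summable[OF assms] by (simp add: case_prod_unfold)
  then have "(\<lambda>(b, a). (cmod (h (a, b)))\<^sup>2) summable_on UNIV \<times> UNIV"
    by (subst summable_on_swap) (simp add: case_prod_unfold prod.swap_def)
  then show ?thesis
    using assms by (auto simp: ell2_iff case_prod_unfold)
qed

lemma ell2_inner_swap:
  "ell2_inner (\<lambda>(b, a). h (a, b)) (\<lambda>(b, a). k (a, b)) = ell2_inner h k"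
proof -
  have "bij_betw prod.swap UNIV UNIV"
    by (rule bij_betw_byWitness[of _ prod.swap]) auto
  from infsum_reindex_bij_betw[OF this, of "\<lambda>i. cnj (h i) * k i"] show ?thesis
    unfolding ell2_inner_def by (simp add: case_prod_unfold prod.swap_def)
qed

lemma ell2_column:
  assumes "h \<in> ell2 (I \<times> J)"
  shows "(\<lambda>a. h (a, b)) \<in> ell2 I"
  using ell2_slice_times[OF ell2_swap[OF assms]] by simp

text \<open>Made for \<open>1 \<otimes> B\<close>, which acts on every row by the same operator: a
  bound uniform in the row is squared and summed.\<close>

lemma ell2_of_rowwise_bound:
  assumes "h \<in> ell2 (I \<times> J)"
    and "\<And>a. (\<lambda>b. k (a, b)) \<in> ell2 J" "\<And>a b. a \<notin> I \<Longrightarrow> k (a, b) = 0"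
    and "\<And>a. ell2_norm (\<lambda>b. k (a, b)) \<le> C * ell2_norm (\<lambda>b. h (a, b))"
  shows "k \<in> ell2 (I \<times> J)"
proof (rule ell2_of_slices)
  have "(\<lambda>a. C\<^sup>2 * (ell2_norm (\<lambda>b. h (a, b)))\<^sup>2) summable_on UNIV"
    using ell2_norm_slices[OF assms(1)]
    by (intro summable_on_cmult_right) (auto simp: has_sum_imp_summable)
  then show "(\<lambda>a. (ell2_norm (\<lambda>b. k (a, b)))\<^sup>2) summable_on UNIV"
    by (rule summable_on_comparison_test)
      (auto simp: assms(4) simp flip: power_mult_distrib intro!: power_mono)
  show "k (a, b) = 0" if "(a, b) \<notin> I \<times> J" for a b
    using that assms(3) ell2_outside[OF assms(2)] by auto
  show "(\<lambda>b. k (a, b)) \<in> ell2 UNIV" for a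
    using ell2_summable[OF assms(2)] by (auto simp: ell2_iff)
qed

lemma ell2_product:
  assumes "f \<in> ell2 I" "g \<in> ell2 J"
  shows "(\<lambda>(a, b). f a * g b) \<in> ell2 (I \<times> J)"
proof (rule ell2_of_slices)
  have eq: "(\<lambda>b. (case (a, b) of (a, b) \<Rightarrow> f a * g b)) = vec_scale (f a) g" for a
    by auto
  show "(\<lambda>b. (case (a, b) of (a, b) \<Rightarrow> f a * g b)) \<in> ell2 UNIV" for a
    unfolding eq using assms(2) by (intro ell2_scale) (auto simp: ell2_iff)
  show "(\<lambda>a. (ell2_norm (\<lambda>b. (case (a, b) of (a, b) \<Rightarrow> f a * g b)))\<^sup>2) summable_on UNIV"
    unfolding eq ell2_norm_scale power_mult_distrib
    by (intro summable_on_cmult_left ell2_summable[OF assms(1)])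
qed (use assms in \<open>auto simp: ell2_outside\<close>)

lemma ell2_inner_product:
  assumes "f \<in> ell2 I" "g \<in> ell2 J" "f' \<in> ell2 I" "g' \<in> ell2 J"
  shows "ell2_inner (\<lambda>(a, b). f a * g b) (\<lambda>(a, b). f' a * g' b)
    = ell2_inner f f' * ell2_inner g g'"
proof -
  have "((\<lambda>a. (cnj (f a) * f' a) * ell2_inner g g') has_sum
      ell2_inner (\<lambda>(a, b). f a * g b) (\<lambda>(a, b). f' a * g' b)) UNIV"
    using ell2_inner_slices[OF ell2_product[OF assms(1,2)] ell2_product[OF assms(3,4)]]
      ell2_inner_scale_left[of "f _" g] ell2_inner_scale_right[of _ "f' _" g']
    by (simp add: vec_scale_def mult.assoc)
  moreover have "((\<lambda>a. (cnj (f a) * f' a) * ell2_inner g g') has_sum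
      ell2_inner f f' * ell2_inner g g') UNIV"
    using ell2_inner_summable[OF assms(1,3)] by (intro has_sum_cmult_left) (simp add: ell2_inner_def)
  ultimately show ?thesis
    using has_sum_unique by blast
qed

section \<open>Bounded operators\<close>

lemma bounded_ops_outside: "A \<in> bounded_ops I \<Longrightarrow> f \<notin> ell2 I \<Longrightarrow> A f = 0"
  and bounded_ops_in: "A \<in> bounded_ops I \<Longrightarrow> f \<in> ell2 I \<Longrightarrow> A f \<in> ell2 I"
  and bounded_ops_add:
    "A \<in> bounded_ops I \<Longrightarrow> f \<in> ell2 I \<Longrightarrow> g \<in> ell2 I \<Longrightarrow> A (f + g) = A f + A g"
  and bounded_ops_scale: "A \<in> bounded_ops I \<Longrightarrow> f \<in> ell2 I \<Longrightarrow> A (vec_scale c f) = vec_scale c (A f)"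
  by (auto simp: bounded_ops_def)

lemma bounded_ops_bound:
  assumes "A \<in> bounded_ops I"
  obtains C where "C \<ge> 0" "\<And>f. f \<in> ell2 I \<Longrightarrow> ell2_norm (A f) \<le> C * ell2_norm f"
proof -
  obtain C where C: "\<And>f. f \<in> ell2 I \<Longrightarrow> ell2_norm (A f) \<le> C * ell2_norm f"
    using assms unfolding bounded_ops_def by blast
  have "ell2_norm (A f) \<le> \<bar>C\<bar> * ell2_norm f" if "f \<in> ell2 I" for f
    using C[OF that] by (rule order_trans) (simp add: mult_right_mono)
  then show ?thesis
    using that[of "\<bar>C\<bar>"] by simp
qed

lemma bounded_ops_zero [simp]: "A \<in> bounded_ops I \<Longrightarrow> A 0 = 0"
  using bounded_ops_scale[of A I 0 0] by (simp add: vec_scale_def zero_fun_def)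

lemma bounded_ops_zero' [simp]: "A \<in> bounded_ops I \<Longrightarrow> A (\<lambda>i. 0) = 0"
  using bounded_ops_zero by (simp add: zero_fun_def)

lemma bounded_ops_sum:
  assumes "A \<in> bounded_ops I" "\<And>x. x \<in> X \<Longrightarrow> f x \<in> ell2 I"
  shows "A (\<Sum>x\<in>X. f x) = (\<Sum>x\<in>X. A (f x))"
  using assms(2)
  by (induction X rule: infinite_finite_induct)
    (use assms(1) in \<open>auto simp: bounded_ops_add ell2_sum simp del: zero_fun_apply\<close>)

lemma bounded_opsI:
  assumes "\<And>f. f \<notin> ell2 I \<Longrightarrow> A f = 0" "\<And>f. f \<in> ell2 I \<Longrightarrow> A f \<in> ell2 I"
    "\<And>f g. f \<in> ell2 I \<Longrightarrow> g \<in> ell2 I \<Longrightarrow> A (f + g) = A f + A g"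
    "\<And>c f. f \<in> ell2 I \<Longrightarrow> A (vec_scale c f) = vec_scale c (A f)"
    "\<And>f. f \<in> ell2 I \<Longrightarrow> ell2_norm (A f) \<le> C * ell2_norm f"
  shows "A \<in> bounded_ops I"
  using assms unfolding bounded_ops_def by blast

lemma id_op_in_bounded_ops: "id_op I \<in> bounded_ops I"
  by (rule bounded_opsI[of _ _ 1]) (auto simp: id_op_def ell2_add ell2_scale)

lemma subspace_bounded_ops: "oper.subspace (bounded_ops I)"
proof (rule oper.subspaceI)
  show "0 \<in> bounded_ops I"
    by (rule bounded_opsI[of _ _ 0])
      (auto simp: vec_scale_def fun_eq_iff ell2_norm_def)
next
  fix A B :: "'a oper" assume AB: "A \<in> bounded_ops I" "B \<in> bounded_ops I"
  obtain C where C: "C \<ge> 0" "\<And>f. f \<in> ell2 I \<Longrightarrow> ell2_norm (A f) \<le> C * ell2_norm f"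
    using bounded_ops_bound[OF AB(1)] by blast
  obtain D where D: "D \<ge> 0" "\<And>f. f \<in> ell2 I \<Longrightarrow> ell2_norm (B f) \<le> D * ell2_norm f"
    using bounded_ops_bound[OF AB(2)] by blast
  show "A + B \<in> bounded_ops I"
  proof (rule bounded_opsI[of _ _ "2 * (C + D)"])
    fix f assume f: "f \<in> ell2 I"
    have "ell2_norm ((A + B) f) \<le> 2 * (ell2_norm (A f) + ell2_norm (B f))"
      using ell2_norm_add_le[of "A f" I "B f"] AB f by (simp add: bounded_ops_in)
    also have "\<dots> \<le> 2 * (C + D) * ell2_norm f"
      using C(2)[OF f] D(2)[OF f] by (simp add: algebra_simps)
    finally show "ell2_norm ((A + B) f) \<le> 2 * (C + D) * ell2_norm f" .
  qed (use AB in \<open>auto simp: bounded_ops_outside bounded_ops_in bounded_ops_add bounded_ops_scale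
      ell2_add fun_eq_iff algebra_simps\<close>)
next
  fix c and A :: "'a oper" assume A: "A \<in> bounded_ops I"
  obtain C where C: "C \<ge> 0" "\<And>f. f \<in> ell2 I \<Longrightarrow> ell2_norm (A f) \<le> C * ell2_norm f"
    using bounded_ops_bound[OF A] by blast
  show "oper_scale c A \<in> bounded_ops I"
  proof (rule bounded_opsI[of _ _ "cmod c * C"])
    show "ell2_norm (oper_scale c A f) \<le> cmod c * C * ell2_norm f" if "f \<in> ell2 I" for f
      using mult_left_mono[OF C(2)[OF that], of "cmod c"]
      by (simp add: oper_scale_def ell2_norm_scale mult.assoc)
  qed (use A in \<open>auto simp: oper_scale_def bounded_ops_outside bounded_ops_in bounded_ops_add
      bounded_ops_scale ell2_scale fun_eq_iff algebra_simps\<close>)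
qed

lemma ell2_inner_eqI:
  assumes "f \<in> ell2 I" "g \<in> ell2 I" "\<And>h. h \<in> ell2 I \<Longrightarrow> ell2_inner h f = ell2_inner h g"
  shows "f = g"
proof
  fix i
  show "f i = g i"
    using assms(3)[OF unit_vec_in_ell2, of i] ell2_outside[OF assms(1)] ell2_outside[OF assms(2)]
    by (cases "i \<in> I") (auto simp: ell2_inner_unit_vec)
qed

text \<open>\<open>adjoint_op\<close> is a definite description, so an adjoint is computed by
  exhibiting it. Uniqueness on \<open>ell2 I\<close> comes from the inner product; off
  \<open>ell2 I\<close> all bounded operators have the value 0.\<close>

lemma adjoint_op_eqI:
  assumes "B \<in> bounded_ops I"
    and "\<And>f g. f \<in> ell2 I \<Longrightarrow> g \<in> ell2 I \<Longrightarrow> ell2_inner (A f) g = ell2_inner f (B g)"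
  shows "adjoint_op I A = B"
  unfolding adjoint_op_def
proof (rule the_equality)
  fix B' assume B': "B' \<in> bounded_ops I \<and>
    (\<forall>f\<in>ell2 I. \<forall>g\<in>ell2 I. ell2_inner (A f) g = ell2_inner f (B' g))"
  show "B' = B"
  proof
    fix g
    show "B' g = B g"
    proof (cases "g \<in> ell2 I")
      case True
      show ?thesis
        by (rule ell2_inner_eqI[of _ I]) (use True assms B' in \<open>auto simp: bounded_ops_in\<close>)
    qed (use assms B' in \<open>auto simp: bounded_ops_outside\<close>)
  qed
qed (use assms in auto)

section \<open>The universal representation of a group\<close>

lemma unitary_ops_bounded: "U \<in> unitary_ops I \<Longrightarrow> U \<in> bounded_ops I"
  by (simp add: unitary_ops_def)

lemma unitary_ops_inner:
  "U \<in> unitary_ops I \<Longrightarrow> f \<in> ell2 I \<Longrightarrow> g \<in> ell2 I \<Longrightarrow> ell2_inner (U f) (U g) = ell2_inner f g"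
  by (simp add: unitary_ops_def)

lemma unitary_ops_norm:
  assumes "U \<in> unitary_ops I" "f \<in> ell2 I"
  shows "ell2_norm (U f) = ell2_norm f"
proof -
  have "complex_of_real ((ell2_norm (U f))\<^sup>2) = complex_of_real ((ell2_norm f)\<^sup>2)"
    using unitary_ops_inner[OF assms assms(2)] by (simp only: ell2_inner_self)
  then have "(ell2_norm (U f))\<^sup>2 = (ell2_norm f)\<^sup>2"
    by (simp only: of_real_eq_iff)
  then show ?thesis
    by (rule power2_eq_imp_eq) simp_all
qed

text \<open>The permutation acts on the whole index type because inner products and norms are sums
  over the whole type.\<close>

lemma ell2_comp_bij:
  assumes "bij \<pi>" "\<And>x. \<pi> x \<in> I \<longleftrightarrow> x \<in> I"
  shows "f \<in> ell2 I \<Longrightarrow> f \<circ> \<pi> \<in> ell2 I"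
    and "ell2_inner (f \<circ> \<pi>) (g \<circ> \<pi>) = ell2_inner f g"
    and "ell2_norm (f \<circ> \<pi>) = ell2_norm f"
proof -
  show "f \<circ> \<pi> \<in> ell2 I" if "f \<in> ell2 I"
    using that assms(2) summable_on_reindex_bij_betw[OF assms(1), of "\<lambda>i. (cmod (f i))\<^sup>2"]
    by (simp add: ell2_iff)
  show "ell2_inner (f \<circ> \<pi>) (g \<circ> \<pi>) = ell2_inner f g"
    using infsum_reindex_bij_betw[OF assms(1), of "\<lambda>i. cnj (f i) * g i"]
    by (simp add: ell2_inner_def)
  show "ell2_norm (f \<circ> \<pi>) = ell2_norm f"
    using infsum_reindex_bij_betw[OF assms(1), of "\<lambda>i. (cmod (f i))\<^sup>2"]
    by (simp add: ell2_norm_def)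
qed

definition regular_rep :: "('g, 'm) monoid_scheme \<Rightarrow> 'g \<Rightarrow> 'g oper" where
  "regular_rep G g = (\<lambda>f. if f \<in> ell2 (carrier G)
     then (\<lambda>x. if x \<in> carrier G then f (inv\<^bsub>G\<^esub> g \<otimes>\<^bsub>G\<^esub> x) else 0) else 0)"

context group
begin

text \<open>\<open>unitary_rep\<close> asks only for multiplicativity, but this makes the image of
  the identity idempotent, and an idempotent surjection is the identity map.\<close>

lemma unitary_rep_one:
  assumes "unitary_rep G I \<rho>"
  shows "\<rho> \<one> = id_op I"
proof
  fix f
  have U: "\<rho> \<one> \<in> unitary_ops I" and mult: "\<rho> \<one> = \<rho> \<one> \<circ> \<rho> \<one>"
    using assms unfolding unitary_rep_def by (blast, metis l_one one_closed)
  show "\<rho> \<one> f = id_op I f"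
  proof (cases "f \<in> ell2 I")
    case True
    then obtain f' where f': "f = \<rho> \<one> f'"
      using U unfolding unitary_ops_def by blast
    have "\<rho> \<one> f = (\<rho> \<one> \<circ> \<rho> \<one>) f'"
      unfolding f' by simp
    also have "\<dots> = f"
      unfolding mult[symmetric] f' ..
    finally show ?thesis
      using True by (simp add: id_op_def)
  next
    case False
    then show ?thesis
      using bounded_ops_outside[OF unitary_ops_bounded[OF U]] by (simp add: id_op_def)
  qed
qed

section \<open>The universal representation, summand by summand\<close>

lemma unitary_reps_unitary: "r \<in> unitary_reps G \<Longrightarrow> g \<in> carrier G \<Longrightarrow> snd r g \<in> unitary_ops (fst r)"
  by (auto simp: unitary_reps_def unitary_rep_def)

lemma univ_slice: "h \<in> ell2 (univ_index G) \<Longrightarrow> r \<in> unitary_reps G \<Longrightarrow> (\<lambda>i. h (r, i)) \<in> ell2 (fst r)"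
  using ell2_slice[of h "univ_index G" r] by (simp add: univ_index_def)

lemma univ_slice_outside: "h \<in> ell2 (univ_index G) \<Longrightarrow> r \<notin> unitary_reps G \<Longrightarrow> (\<lambda>i. h (r, i)) = 0"
  by (auto simp: univ_index_def ell2_outside fun_eq_iff)

lemma univ_rep_slice:
  assumes "h \<in> ell2 (univ_index G)"
  shows "(\<lambda>i. univ_rep G g h (r, i)) = (if r \<in> unitary_reps G then snd r g (\<lambda>i. h (r, i)) else 0)"
  using assms by (auto simp: univ_rep_def)

lemma univ_rep_slice_norm:
  assumes "g \<in> carrier G" "h \<in> ell2 (univ_index G)"
  shows "ell2_norm (\<lambda>i. univ_rep G g h (r, i)) = ell2_norm (\<lambda>i. h (r, i))"
  using assms univ_slice_outside[OF assms(2), of r]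
  by (simp add: univ_rep_slice unitary_ops_norm[OF unitary_reps_unitary] univ_slice)

lemma univ_rep_in_ell2:
  assumes "g \<in> carrier G" "h \<in> ell2 (univ_index G)"
  shows "univ_rep G g h \<in> ell2 (univ_index G)"
proof -
  have slice: "(\<lambda>i. univ_rep G g h (r, i)) \<in> ell2 {i. (r, i) \<in> univ_index G}" for r
  proof (cases "r \<in> unitary_reps G")
    case True
    then have "{i. (r, i) \<in> univ_index G} = fst r"
      by (auto simp: univ_index_def)
    with True show ?thesis
      using assms by (simp add: univ_rep_slice univ_slice bounded_ops_in unitary_ops_bounded
        unitary_reps_unitary)
  qed (use assms in \<open>simp add: univ_rep_slice\<close>)
  show ?thesis
  proof (rule ell2_of_slices)
    show "univ_rep G g h (r, i) = 0" if "(r, i) \<notin> univ_index G" for r i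
      using ell2_outside[OF slice, of i r] that by simp
    show "(\<lambda>i. univ_rep G g h (r, i)) \<in> ell2 UNIV" for r
      using slice[of r] by (simp add: ell2_iff)
    show "(\<lambda>r. (ell2_norm (\<lambda>i. univ_rep G g h (r, i)))\<^sup>2) summable_on UNIV"
      using ell2_norm_slices[OF assms(2)] assms by (auto simp: univ_rep_slice_norm has_sum_imp_summable)
  qed
qed

lemma univ_rep_norm:
  assumes "g \<in> carrier G" "h \<in> ell2 (univ_index G)"
  shows "ell2_norm (univ_rep G g h) = ell2_norm h"
proof -
  have "(ell2_norm (univ_rep G g h))\<^sup>2 = (ell2_norm h)\<^sup>2"
    using ell2_norm_slices[OF assms(2)] ell2_norm_slices[OF univ_rep_in_ell2[OF assms]]
    by (simp add: univ_rep_slice_norm[OF assms] has_sum_unique)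
  then show ?thesis
    by (rule power2_eq_imp_eq) simp_all
qed

lemma univ_rep_bounded:
  assumes "g \<in> carrier G"
  shows "univ_rep G g \<in> bounded_ops (univ_index G)"
proof (rule bounded_opsI[of _ _ 1])
  fix f f' c assume f: "f \<in> ell2 (univ_index G)" and f': "f' \<in> ell2 (univ_index G)"
  have bdd: "r \<in> unitary_reps G \<Longrightarrow> snd r g \<in> bounded_ops (fst r)" for r
    by (simp add: assms unitary_ops_bounded unitary_reps_unitary)
  have "univ_rep G g (f + f') (r, i) = (univ_rep G g f + univ_rep G g f') (r, i)" for r i
    using bounded_ops_add[OF bdd univ_slice[OF f] univ_slice[OF f'], of r] f f' ell2_add[OF f f']
    by (simp add: univ_rep_def plus_fun_def)
  then show "univ_rep G g (f + f') = univ_rep G g f + univ_rep G g f'"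
    by (simp add: fun_eq_iff)
  have "univ_rep G g (vec_scale c f) (r, i) = vec_scale c (univ_rep G g f) (r, i)" for r i
    using bounded_ops_scale[OF bdd univ_slice[OF f], of r c] f ell2_scale[OF f, of c]
    by (simp add: univ_rep_def vec_scale_def)
  then show "univ_rep G g (vec_scale c f) = vec_scale c (univ_rep G g f)"
    by (simp add: fun_eq_iff)
qed (simp_all add: assms univ_rep_in_ell2 univ_rep_norm, simp add: univ_rep_def)

lemma univ_rep_inner:
  assumes g: "g \<in> carrier G" and f: "f \<in> ell2 (univ_index G)" "f' \<in> ell2 (univ_index G)"
  shows "ell2_inner (univ_rep G g f) (univ_rep G g f') = ell2_inner f f'"
proof -
  have "ell2_inner (\<lambda>i. univ_rep G g f (r, i)) (\<lambda>i. univ_rep G g f' (r, i))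
      = ell2_inner (\<lambda>i. f (r, i)) (\<lambda>i. f' (r, i))" for r
    using univ_slice_outside[OF f(1), of r] f g
    by (simp add: univ_rep_slice unitary_ops_inner[OF unitary_reps_unitary] univ_slice)
  then show ?thesis
    using ell2_inner_slices[OF f] ell2_inner_slices[OF f[THEN univ_rep_in_ell2[OF g]]]
    by (simp add: has_sum_unique)
qed

lemma univ_rep_one: "univ_rep G \<one> = id_op (univ_index G)"
proof
  fix h
  show "univ_rep G \<one> h = id_op (univ_index G) h"
  proof (cases "h \<in> ell2 (univ_index G)")
    case True
    have "univ_rep G \<one> h (r, i) = h (r, i)" for r i
    proof (cases "r \<in> unitary_reps G")
      case r: True
      then have "snd r \<one> = id_op (fst r)"
        by (intro unitary_rep_one) (auto simp: unitary_reps_def)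
      with r show ?thesis
        using True univ_slice[OF True r] by (simp add: univ_rep_def id_op_def)
    next
      case False
      then show ?thesis
        using True ell2_outside[OF True, of "(r, i)"] by (simp add: univ_rep_def univ_index_def)
    qed
    with True show ?thesis
      by (auto simp: id_op_def)
  qed (simp add: univ_rep_def id_op_def)
qed

lemma univ_rep_mult:
  assumes "g \<in> carrier G" "h \<in> carrier G"
  shows "univ_rep G (g \<otimes> h) f = univ_rep G g (univ_rep G h f)"
proof (cases "f \<in> ell2 (univ_index G)")
  case True
  have "univ_rep G (g \<otimes> h) f (r, i) = univ_rep G g (univ_rep G h f) (r, i)" for r i
  proof (cases "r \<in> unitary_reps G")
    case r: True
    then have "snd r (g \<otimes> h) = snd r g \<circ> snd r h"
      using assms by (auto simp: unitary_reps_def unitary_rep_def)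
    moreover have "univ_rep G g (univ_rep G h f) (r, i) = snd r g (snd r h (\<lambda>i. f (r, i))) i"
      using univ_rep_in_ell2[OF assms(2) True] r True
      by (subst univ_rep_def) (simp add: univ_rep_slice)
    ultimately show ?thesis
      using True r by (simp add: univ_rep_def)
  qed (use True univ_rep_in_ell2[OF assms(2) True] in \<open>simp add: univ_rep_def\<close>)
  then show ?thesis
    by auto
next
  case False
  then show ?thesis
    using bounded_ops_zero[OF univ_rep_bounded[OF assms(1)]] by (simp add: univ_rep_def)
qed

lemma univ_rep_inv:
  assumes "g \<in> carrier G" "f \<in> ell2 (univ_index G)"
  shows "univ_rep G g (univ_rep G (inv g) f) = f"
  using assms univ_rep_mult[of g "inv g" f] by (simp add: univ_rep_one id_op_def)

lemma univ_rep_adjoint: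
  assumes "g \<in> carrier G" "f \<in> ell2 (univ_index G)" "f' \<in> ell2 (univ_index G)"
  shows "ell2_inner (univ_rep G g f) f' = ell2_inner f (univ_rep G (inv g) f')"
  using assms univ_rep_inner[of g f "univ_rep G (inv g) f'"]
  by (simp add: univ_rep_inv univ_rep_in_ell2)

lemma adjoint_op_univ_rep:
  "g \<in> carrier G \<Longrightarrow> adjoint_op (univ_index G) (univ_rep G g) = univ_rep G (inv g)"
  by (intro adjoint_op_eqI) (auto simp: univ_rep_bounded univ_rep_adjoint)

text \<open>The adjoint of the unitary of \<open>g\<close> is the unitary of its inverse, so the
  spanning family consists of group elements only.\<close>

lemma group_opsys_eq_span:
  assumes "\<uu> \<subseteq> carrier G"
  shows "group_opsys G \<uu> = oper.span (univ_rep G ` ({\<one>} \<union> \<uu> \<union> (\<lambda>g. inv g) ` \<uu>))"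
proof -
  have "(\<lambda>g. adjoint_op (univ_index G) (univ_rep G g)) ` \<uu> = univ_rep G ` (\<lambda>g. inv g) ` \<uu>"
    unfolding image_image using assms by (intro image_cong) (auto simp: adjoint_op_univ_rep)
  then show ?thesis
    unfolding group_opsys_def image_Un by (simp add: univ_rep_one)
qed

lemma span_univ_rep_bounded:
  assumes "W \<subseteq> carrier G"
  shows "oper.span (univ_rep G ` W) \<subseteq> bounded_ops (univ_index G)"
  by (rule oper.span_minimal) (use assms in \<open>auto simp: univ_rep_bounded subspace_bounded_ops\<close>)

subsection \<open>The regular representation as a summand\<close>

text \<open>Left translation is extended by the identity off the group to a permutation of the whole
  type, as \<open>ell2_comp_bij\<close> requires; off the group \<open>f\<close> vanishes, so the
  extension does no harm.\<close>

lemma regular_rep_eq: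
  assumes "g \<in> carrier G" "f \<in> ell2 (carrier G)"
  shows "regular_rep G g f = f \<circ> (\<lambda>x. if x \<in> carrier G then inv g \<otimes> x else x)"
  using assms by (auto simp: regular_rep_def ell2_outside fun_eq_iff)

lemma bij_translation:
  assumes "g \<in> carrier G"
  shows "bij (\<lambda>x. if x \<in> carrier G then inv g \<otimes> x else x)"
  by (rule bij_betw_byWitness[where f' = "\<lambda>x. if x \<in> carrier G then g \<otimes> x else x"])
    (use assms in \<open>auto simp: m_assoc[symmetric]\<close>)

lemma regular_rep_in_ell2:
  assumes "g \<in> carrier G" "f \<in> ell2 (carrier G)"
  shows "regular_rep G g f \<in> ell2 (carrier G)"
  unfolding regular_rep_eq[OF assms]
  using ell2_comp_bij(1)[OF bij_translation[OF assms(1)] _ assms(2)] assms by simp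

lemma regular_rep_mult:
  assumes "g \<in> carrier G" "h \<in> carrier G"
  shows "regular_rep G (g \<otimes> h) = regular_rep G g \<circ> regular_rep G h"
proof
  fix f
  show "regular_rep G (g \<otimes> h) f = (regular_rep G g \<circ> regular_rep G h) f"
  proof (cases "f \<in> ell2 (carrier G)")
    case True
    show ?thesis
      using assms True regular_rep_in_ell2[OF assms(2) True]
      by (subst o_apply, subst (2) regular_rep_def)
        (auto simp: regular_rep_def inv_mult_group m_assoc fun_eq_iff)
  qed (simp add: regular_rep_def fun_eq_iff)
qed

lemma regular_rep_bounded:
  assumes "g \<in> carrier G"
  shows "regular_rep G g \<in> bounded_ops (carrier G)"
proof (rule bounded_opsI[of _ _ 1])
  show "ell2_norm (regular_rep G g f) \<le> 1 * ell2_norm f" if "f \<in> ell2 (carrier G)" for f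
    unfolding regular_rep_eq[OF assms that]
    using ell2_comp_bij(3)[OF bij_translation[OF assms], of "carrier G" f] assms by simp
next
  show "regular_rep G g f \<in> ell2 (carrier G)" if "f \<in> ell2 (carrier G)" for f
    by (rule regular_rep_in_ell2[OF assms that])
qed (auto simp: assms regular_rep_eq ell2_add ell2_scale fun_eq_iff, simp add: regular_rep_def)

lemma regular_rep_unitary:
  assumes "g \<in> carrier G"
  shows "regular_rep G g \<in> unitary_ops (carrier G)"
proof -
  have "f \<in> regular_rep G g ` ell2 (carrier G)" if "f \<in> ell2 (carrier G)" for f
  proof
    have "regular_rep G \<one> f = f"
      using that by (auto simp: regular_rep_def ell2_outside fun_eq_iff)
    then show "f = regular_rep G g (regular_rep G (inv g) f)"
      using regular_rep_mult[of g "inv g"] assms by (simp add: fun_eq_iff)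
    show "regular_rep G (inv g) f \<in> ell2 (carrier G)"
      using assms that by (simp add: regular_rep_in_ell2)
  qed
  moreover have "ell2_inner (regular_rep G g f) (regular_rep G g f') = ell2_inner f f'"
    if "f \<in> ell2 (carrier G)" "f' \<in> ell2 (carrier G)" for f f'
    unfolding regular_rep_eq[OF assms that(1)] regular_rep_eq[OF assms that(2)]
    using ell2_comp_bij(2)[OF bij_translation[OF assms], of "carrier G" f f'] assms by simp
  ultimately show ?thesis
    using assms by (auto simp: unitary_ops_def regular_rep_bounded regular_rep_in_ell2)
qed

text \<open>The standard basis of the regular summand: orthonormal vectors which the group permutes
  by left translation.\<close>

definition reg_vec :: "'a \<Rightarrow> ('a rep \<times> 'a) vec" where
  "reg_vec x = unit_vec ((carrier G, regular_rep G), x)"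

lemma regular_rep_in_unitary_reps: "(carrier G, regular_rep G) \<in> unitary_reps G"
  by (simp add: unitary_reps_def unitary_rep_def regular_rep_unitary regular_rep_mult)

lemma reg_vec_in_ell2: "x \<in> carrier G \<Longrightarrow> reg_vec x \<in> ell2 (univ_index G)"
  using regular_rep_in_unitary_reps
  by (auto simp: reg_vec_def univ_index_def intro!: unit_vec_in_ell2)

lemma reg_vec_inner: "ell2_inner (reg_vec x) (reg_vec y) = (if x = y then 1 else 0)"
  by (auto simp: reg_vec_def ell2_inner_unit_vec) (auto simp: unit_vec_def)

lemma univ_rep_reg_vec:
  assumes "g \<in> carrier G" "x \<in> carrier G"
  shows "univ_rep G g (reg_vec x) = reg_vec (g \<otimes> x)"
proof -
  have "univ_rep G g (reg_vec x) (r, i) = reg_vec (g \<otimes> x) (r, i)" for r i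
  proof (cases "r = (carrier G, regular_rep G)")
    case True
    have slice: "(\<lambda>i. reg_vec x ((carrier G, regular_rep G), i)) = unit_vec x"
      by (auto simp: reg_vec_def unit_vec_def)
    have "univ_rep G g (reg_vec x) (r, i) = regular_rep G g (unit_vec x) i"
      using True reg_vec_in_ell2[OF assms(2)] regular_rep_in_unitary_reps
      by (simp add: univ_rep_def slice)
    also have "\<dots> = unit_vec (g \<otimes> x) i"
      using assms unit_vec_in_ell2[OF assms(2)] inv_solve_left[of x g i]
      by (auto simp: regular_rep_def unit_vec_def)
    finally show ?thesis
      using True by (simp add: reg_vec_def unit_vec_def)
  next
    case False
    then have "(\<lambda>i. reg_vec x (r, i)) = 0"
      by (auto simp: reg_vec_def unit_vec_def)
    then have "univ_rep G g (reg_vec x) (r, i) = 0"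
      using reg_vec_in_ell2[OF assms(2)]
        bounded_ops_zero[OF unitary_ops_bounded[OF unitary_reps_unitary[OF _ assms(1)]]]
      by (simp add: univ_rep_def)
    with False show ?thesis
      by (simp add: reg_vec_def unit_vec_def)
  qed
  then show ?thesis
    by auto
qed

text \<open>The matrix entry reads off the coefficient of \<open>h\<close> in an element of the group algebra.\<close>

lemma reg_vec_coefficient_eq_0:
  assumes "W \<subseteq> carrier G" "c \<in> oper.span (univ_rep G ` W)" "h \<notin> W"
  shows "ell2_inner (reg_vec h) (c (reg_vec \<one>)) = 0"
  using assms(2)
proof (induction rule: oper.span_induct_alt)
  case base
  then show ?case
    by (simp add: reg_vec_def ell2_inner_unit_vec)
next
  case (step a x y)
  then obtain g where "g \<in> W" "x = univ_rep G g"
    by auto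
  moreover from this have "ell2_inner (reg_vec h) (univ_rep G g (reg_vec \<one>)) = 0"
    using assms by (auto simp: univ_rep_reg_vec reg_vec_inner subsetD)
  ultimately show ?case
    using step by (simp add: reg_vec_def ell2_inner_unit_vec oper_scale_apply)
qed

end

section \<open>Positive semidefinite matrices\<close>

text \<open>Membership in the nonnegative reals includes being real, which is the source of
  Hermitian symmetry. The index set is arbitrary so that pairs (block, coordinate) can serve as
  indices.\<close>

definition psd :: "'k set \<Rightarrow> ('k \<Rightarrow> 'k \<Rightarrow> complex) \<Rightarrow> bool" where
  "psd K Q \<longleftrightarrow> (\<forall>z. (\<Sum>i\<in>K. \<Sum>j\<in>K. cnj (z i) * Q i j * z j) \<in> \<real>\<^sub>\<ge>\<^sub>0)"

lemma sum_nonneg_Reals: "(\<And>x. x \<in> A \<Longrightarrow> f x \<in> \<real>\<^sub>\<ge>\<^sub>0) \<Longrightarrow> (\<Sum>x\<in>A. f x) \<in> (\<real>\<^sub>\<ge>\<^sub>0 :: complex set)"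
  by (induction A rule: infinite_finite_induct) auto

lemma psd_two_coordinates:
  assumes "finite K" "psd K Q" "i \<in> K" "j \<in> K" "i \<noteq> j"
  shows "cnj a * Q i i * a + cnj a * Q i j * b + (cnj b * Q j i * a + cnj b * Q j j * b) \<in> \<real>\<^sub>\<ge>\<^sub>0"
proof -
  define z where "z = (\<lambda>k. if k = i then a else if k = j then b else 0)"
  have "(\<Sum>k\<in>K. \<Sum>l\<in>K. cnj (z k) * Q k l * z l) = (\<Sum>k\<in>{i, j}. \<Sum>l\<in>{i, j}. cnj (z k) * Q k l * z l)"
    using assms by (intro sum.mono_neutral_cong_right) (auto simp: z_def intro!: sum.mono_neutral_right sum.neutral)
  also have "\<dots> = cnj a * Q i i * a + cnj a * Q i j * b + (cnj b * Q j i * a + cnj b * Q j j * b)"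
    using assms(5) by (simp add: z_def)
  finally show ?thesis
    using spec[OF assms(2)[unfolded psd_def], of z] by (simp only:)
qed

lemma psd_diagonal:
  assumes "finite K" "psd K Q" "e \<in> K"
  shows "Q e e \<in> \<real>\<^sub>\<ge>\<^sub>0"
proof -
  define z where "z = (\<lambda>k. if k = e then 1 else 0 :: complex)"
  have "(\<Sum>k\<in>K. \<Sum>l\<in>K. cnj (z k) * Q k l * z l) = (\<Sum>k\<in>{e}. \<Sum>l\<in>{e}. cnj (z k) * Q k l * z l)"
    using assms by (intro sum.mono_neutral_cong_right) (auto simp: z_def intro!: sum.mono_neutral_right sum.neutral)
  also have "\<dots> = Q e e"
    by (simp add: z_def)
  finally show ?thesis
    using spec[OF assms(2)[unfolded psd_def], of z] by (simp only:)
qed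

text \<open>Reality of the form at the vectors (1, 1) and (1, i) on two coordinates: the first gives
  opposite imaginary parts, the second equal real parts.\<close>

lemma psd_hermitian:
  assumes "finite K" "psd K Q" "i \<in> K" "j \<in> K"
  shows "Q j i = cnj (Q i j)"
proof (cases "i = j")
  case True
  then show ?thesis
    using psd_diagonal[OF assms(1,2,3)] by (auto simp: complex_nonneg_Reals_iff complex_eq_iff)
next
  case False
  have "Q i i \<in> \<real>\<^sub>\<ge>\<^sub>0" "Q j j \<in> \<real>\<^sub>\<ge>\<^sub>0"
    using psd_diagonal[OF assms(1,2)] assms by auto
  then show ?thesis
    using psd_two_coordinates[OF assms False, of 1 1] psd_two_coordinates[OF assms False, of 1 \<i>]
    by (auto simp: complex_nonneg_Reals_iff complex_eq_iff)
qed

lemma psd_zero_diagonal: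
  assumes "finite K" "psd K Q" "e \<in> K" "j \<in> K" "Q e e = 0"
  shows "Q e j = 0"
proof (rule ccontr)
  assume nz: "Q e j \<noteq> 0"
  then have ne: "e \<noteq> j"
    using assms(5) by auto
  define q where "q = (cmod (Q e j))\<^sup>2"
  have q: "q > 0"
    using nz by (simp add: q_def)
  \<comment> \<open>The vector with entries \<open>- t * Q e j\<close> at \<open>e\<close> and 1 at
    \<open>j\<close> gives the form the value \<open>Q j j - 2 * t * q\<close>, which is affine in
    \<open>t\<close>; this \<open>t\<close> makes its real part -1.\<close>
  define t where "t = (Re (Q j j) + 1) / (2 * q)"
  have tq: "2 * t * q = Re (Q j j) + 1"
    using q by (simp add: t_def)
  have "Q j j - complex_of_real (2 * t * q) \<in> \<real>\<^sub>\<ge>\<^sub>0"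
  proof -
    have "cnj (- complex_of_real t * Q e j) * Q e j * 1 + (cnj 1 * Q j e * (- complex_of_real t * Q e j)
        + cnj 1 * Q j j * 1) \<in> \<real>\<^sub>\<ge>\<^sub>0"
      using psd_two_coordinates[OF assms(1-4) ne, of "- complex_of_real t * Q e j" 1] assms(5) by simp
    also have "cnj (- complex_of_real t * Q e j) * Q e j * 1 + (cnj 1 * Q j e * (- complex_of_real t * Q e j)
        + cnj 1 * Q j j * 1) = Q j j - 2 * complex_of_real t * (Q e j * cnj (Q e j))"
      unfolding psd_hermitian[OF assms(1-4)] by (simp add: algebra_simps)
    also have "Q e j * cnj (Q e j) = complex_of_real q"
      unfolding q_def by (rule complex_norm_square[symmetric])
    finally show ?thesis
      by simp
  qed
  then show False
    unfolding tq by (simp add: complex_nonneg_Reals_iff)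
qed

text \<open>One step of Gaussian elimination: subtract the rank-one matrix that clears row and
  column \<open>e\<close>.  Positivity of the Schur complement is the minimum of the form over the
  coordinate \<open>e\<close>.\<close>

lemma psd_eliminate_one:
  assumes "finite K" "psd K Q" "e \<in> K"
  obtains w Q' where "psd K Q'" "\<And>i j. i \<in> K \<Longrightarrow> j \<in> K \<Longrightarrow> Q i j = w i * cnj (w j) + Q' i j"
    "\<And>j. j \<in> K \<Longrightarrow> Q' e j = 0" "\<And>j. j \<in> K \<Longrightarrow> Q e j = 0 \<Longrightarrow> w j = 0"
proof (cases "Q e e = 0")
  case True
  show ?thesis
    by (rule that[of Q "\<lambda>_. 0"]) (simp_all add: assms(2) psd_zero_diagonal[OF assms _ True])
next
  case False
  define p where "p = Re (Q e e)"
  have p: "p > 0" "Q e e = complex_of_real p"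
    using False psd_diagonal[OF assms] by (auto simp: p_def complex_nonneg_Reals_iff complex_eq_iff)
  \<comment> \<open>Column \<open>e\<close> divided by the square root of the pivot, so that the
    rank-one matrix of \<open>w\<close> reproduces row and column \<open>e\<close>.\<close>
  define w where "w i = Q i e / complex_of_real (sqrt p)" for i
  define Q' where "Q' i j = Q i j - w i * cnj (w j)" for i j
  have sqrt: "complex_of_real (sqrt p) * complex_of_real (sqrt p) = complex_of_real p"
    using p(1) by (simp flip: of_real_mult)
  have ww: "w i * cnj (w j) = Q i e * Q e j / p" if "i \<in> K" "j \<in> K" for i j
    using psd_hermitian[OF assms(1,2,3) that(2)] sqrt by (simp add: w_def)
  show ?thesis
  proof (rule that[of Q' w])
    show "psd K Q'"
      unfolding psd_def
    proof
      fix z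
      define s where "s = (\<Sum>j\<in>K. Q e j * z j)"
      define t where "t = - s / p"
      define y where "y k = z k + (if k = e then t else 0)" for k
      have s': "(\<Sum>i\<in>K. cnj (z i) * Q i e) = cnj s"
        using psd_hermitian[OF assms] by (simp add: s_def mult.commute)
      have "(\<Sum>i\<in>K. \<Sum>j\<in>K. cnj (y i) * Q i j * y j) =
        (\<Sum>i\<in>K. \<Sum>j\<in>K. cnj (z i) * Q i j * z j) + (\<Sum>i\<in>K. \<Sum>j\<in>K. (if j = e then cnj (z i) * Q i j * t else 0))
        + (\<Sum>i\<in>K. (if i = e then (\<Sum>j\<in>K. cnj t * Q i j * z j) else 0))
        + (\<Sum>i\<in>K. (if i = e then (\<Sum>j\<in>K. if j = e then cnj t * Q i j * t else 0) else 0))"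
        unfolding sum.distrib[symmetric]
        by (intro sum.cong refl) (auto simp: y_def algebra_simps sum.distrib[symmetric] intro!: sum.cong)
      also have "\<dots> = (\<Sum>i\<in>K. \<Sum>j\<in>K. cnj (z i) * Q i j * z j) + cnj s * t + cnj t * s + cnj t * p * t"
        unfolding s'[symmetric] using assms(1,3) p(2)
        by (simp add: sum_distrib_right s_def sum_distrib_left mult.assoc)
      also have "\<dots> = (\<Sum>i\<in>K. \<Sum>j\<in>K. cnj (z i) * Q i j * z j) - cnj s * s / p"
        using p(1) by (simp add: t_def field_simps)
      also have "cnj s * s / p = (\<Sum>i\<in>K. \<Sum>j\<in>K. cnj (z i) * (Q i e * Q e j / p) * z j)"
      proof -
        have "cnj s * s / p = (\<Sum>i\<in>K. cnj (z i) * Q i e) * (\<Sum>j\<in>K. Q e j * z j) / p"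
          by (simp only: s' s_def[symmetric])
        also have "\<dots> = (\<Sum>i\<in>K. \<Sum>j\<in>K. cnj (z i) * (Q i e * Q e j / p) * z j)"
          unfolding sum_product sum_divide_distrib by (intro sum.cong refl) simp
        finally show ?thesis .
      qed
      also have "\<dots> = (\<Sum>i\<in>K. \<Sum>j\<in>K. cnj (z i) * (w i * cnj (w j)) * z j)"
        by (intro sum.cong refl) (simp add: ww)
      also have "(\<Sum>i\<in>K. \<Sum>j\<in>K. cnj (z i) * Q i j * z j) - \<dots> = (\<Sum>i\<in>K. \<Sum>j\<in>K. cnj (z i) * Q' i j * z j)"
        unfolding sum_subtractf[symmetric] by (intro sum.cong refl) (simp add: Q'_def algebra_simps)
      finally have "(\<Sum>i\<in>K. \<Sum>j\<in>K. cnj (y i) * Q i j * y j) = (\<Sum>i\<in>K. \<Sum>j\<in>K. cnj (z i) * Q' i j * z j)" .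
      then show "(\<Sum>i\<in>K. \<Sum>j\<in>K. cnj (z i) * Q' i j * z j) \<in> \<real>\<^sub>\<ge>\<^sub>0"
        using spec[OF assms(2)[unfolded psd_def], of y] by (simp only:)
    qed
    show "Q' e j = 0" if "j \<in> K" for j
      using p ww[OF assms(3) that] by (simp add: Q'_def)
    show "w j = 0" if "j \<in> K" "Q e j = 0" for j
      using psd_hermitian[OF assms that(1)] that by (simp add: w_def)
  qed (simp add: Q'_def)
qed

text \<open>The last conjunct records sparsity: if column \<open>j\<close> is zero in all rows of
  \<open>E\<close>, then none of the subtracted terms touches \<open>j\<close>. Elimination causes
  no fill-in there, since fill-in at \<open>j\<close> would need a pivot row with a nonzero entry at
  \<open>j\<close>.\<close>

lemma psd_eliminate:
  assumes "finite K" "psd K Q" "E \<subseteq> K"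
  shows "\<exists>w Q'. psd K Q' \<and> (\<forall>i\<in>K. \<forall>j\<in>K. Q i j = (\<Sum>k\<in>E. w k i * cnj (w k j)) + Q' i j) \<and>
    (\<forall>i\<in>E. \<forall>j\<in>K. Q' i j = 0) \<and>
    (\<forall>j\<in>K. (\<forall>i\<in>E. Q i j = 0) \<longrightarrow> (\<forall>k\<in>E. w k j = 0))"
proof -
  have "finite E"
    using assms(1,3) finite_subset by blast
  then show ?thesis
    using assms(3)
  proof (induction E)
    case empty
    then show ?case
      using assms(2) by auto
  next
    case (insert e E)
    then obtain w Q1 where Q1: "psd K Q1"
      and eq: "\<forall>i\<in>K. \<forall>j\<in>K. Q i j = (\<Sum>k\<in>E. w k i * cnj (w k j)) + Q1 i j"
      and zero: "\<forall>i\<in>E. \<forall>j\<in>K. Q1 i j = 0"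
      and supp: "\<forall>j\<in>K. (\<forall>i\<in>E. Q i j = 0) \<longrightarrow> (\<forall>k\<in>E. w k j = 0)"
      by auto
    have e: "e \<in> K" and EK: "E \<subseteq> K"
      using insert.prems by auto
    obtain v Q2 where Q2: "psd K Q2"
      and eq2: "\<And>i j. i \<in> K \<Longrightarrow> j \<in> K \<Longrightarrow> Q1 i j = v i * cnj (v j) + Q2 i j"
      and zero2: "\<And>j. j \<in> K \<Longrightarrow> Q2 e j = 0" and supp2: "\<And>j. j \<in> K \<Longrightarrow> Q1 e j = 0 \<Longrightarrow> v j = 0"
    proof -
      show thesis
        by (rule psd_eliminate_one[OF assms(1) Q1 e], rule that) blast+
    qed
    show ?case
    proof (intro exI conjI ballI impI)
      show "psd K Q2" by (fact Q2)
      fix i j assume "i \<in> K" "j \<in> K"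
      then show "Q i j = (\<Sum>k\<in>insert e E. (w(e := v)) k i * cnj ((w(e := v)) k j)) + Q2 i j"
        using eq eq2 insert.hyps by (auto intro!: sum.cong)
    next
      fix i j assume i: "i \<in> insert e E" and j: "j \<in> K"
      show "Q2 i j = 0"
      proof (cases "i = e")
        case False
        then have "i \<in> E" "i \<in> K"
          using i EK by auto
        \<comment> \<open>Rows cleared earlier stay cleared: the entry at \<open>i\<close> of the
          pivot row is zero by Hermitian symmetry, so the new term does not touch row
          \<open>i\<close>.\<close>
        moreover from this have "Q1 e i = 0"
          using psd_hermitian[OF assms(1) Q1, of i e] zero e by auto
        ultimately show ?thesis
          using eq2[of i j] supp2[of i] zero j by simp
      qed (use zero2 j in auto)
    next
      fix j k assume j: "j \<in> K" and col: "\<forall>i\<in>insert e E. Q i j = 0" and k: "k \<in> insert e E"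
      then have "\<forall>k\<in>E. w k j = 0"
        using supp by auto
      moreover from this have "Q1 e j = 0"
        using eq[rule_format, OF e j] col by simp
      ultimately show "(w(e := v)) k j = 0"
        using supp2[OF j] k by auto
    qed
  qed
qed

text \<open>Eliminating the coordinates in \<open>X\<close> first keeps each rank-one term from touching both \<open>X\<close>
  and \<open>Z\<close>.\<close>

lemma psd_decomposition:
  assumes "finite K" "psd K Q" "X \<subseteq> K" "Z \<subseteq> K" "\<And>i j. i \<in> X \<Longrightarrow> j \<in> Z \<Longrightarrow> Q i j = 0"
  shows "\<exists>w. (\<forall>i\<in>K. \<forall>j\<in>K. Q i j = (\<Sum>k\<in>K. w k i * cnj (w k j))) \<and>
    (\<forall>k\<in>X. \<forall>j\<in>Z. w k j = 0) \<and> (\<forall>k\<in>K-X. \<forall>j\<in>X. w k j = 0)"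
proof -
  obtain w1 Q1 where Q1: "psd K Q1"
    and eq1: "\<forall>i\<in>K. \<forall>j\<in>K. Q i j = (\<Sum>k\<in>X. w1 k i * cnj (w1 k j)) + Q1 i j"
    and zero1: "\<forall>i\<in>X. \<forall>j\<in>K. Q1 i j = 0"
    and supp1: "\<forall>j\<in>K. (\<forall>i\<in>X. Q i j = 0) \<longrightarrow> (\<forall>k\<in>X. w1 k j = 0)"
    using psd_eliminate[OF assms(1-3)] by blast
  obtain w2 Q2 where eq2: "\<forall>i\<in>K. \<forall>j\<in>K. Q1 i j = (\<Sum>k\<in>K-X. w2 k i * cnj (w2 k j)) + Q2 i j"
    and zero2: "\<forall>i\<in>K-X. \<forall>j\<in>K. Q2 i j = 0"
    and supp2: "\<forall>j\<in>K. (\<forall>i\<in>K-X. Q1 i j = 0) \<longrightarrow> (\<forall>k\<in>K-X. w2 k j = 0)"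
    using psd_eliminate[OF assms(1) Q1 Diff_subset[of K X]] by blast
  \<comment> \<open>The rows of \<open>Q1\<close> in \<open>X\<close> vanish, hence so do its
    columns there, and the second round of elimination never touches \<open>X\<close>.\<close>
  have w2: "w2 k j = 0" if "k \<in> K - X" "j \<in> X" for k j
  proof -
    have "Q1 i j = 0" if "i \<in> K - X" for i
      using psd_hermitian[OF assms(1) Q1, of j i] zero1 that \<open>j \<in> X\<close> assms(3) by auto
    then show ?thesis
      using supp2 that assms(3) by blast
  qed
  have Q2: "Q2 i j = 0" if "i \<in> K" "j \<in> K" for i j
  proof (cases "i \<in> X")
    case True
    then show ?thesis
      using eq2[rule_format, OF that] w2 zero1 that by simp
  qed (use zero2 that in auto)
  define w where "w k = (if k \<in> X then w1 k else w2 k)" for k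
  show ?thesis
  proof (intro exI conjI ballI)
    fix i j assume ij: "i \<in> K" "j \<in> K"
    have "(\<Sum>k\<in>K. w k i * cnj (w k j)) = (\<Sum>k\<in>K-X. w k i * cnj (w k j)) + (\<Sum>k\<in>X. w k i * cnj (w k j))"
      by (rule sum.subset_diff[OF assms(3,1)])
    then show "Q i j = (\<Sum>k\<in>K. w k i * cnj (w k j))"
      using eq1 eq2 Q2 ij by (simp add: w_def)
  next
    show "w k j = 0" if "k \<in> X" "j \<in> Z" for k j
      using supp1 that assms(4,5) unfolding w_def by auto
    show "w k j = 0" if "k \<in> K - X" "j \<in> X" for k j
      using w2 that by (simp add: w_def)
  qed
qed

corollary psd_gram:
  assumes "finite K" "psd K Q"
  shows "\<exists>w. \<forall>i\<in>K. \<forall>j\<in>K. Q i j = (\<Sum>k\<in>K. w k i * cnj (w k j))"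
  using psd_decomposition[OF assms, of "{}" "{}"] by auto

section \<open>Elementary tensors\<close>

lemma apply_rowwise_in_ell2:
  assumes B: "B \<in> bounded_ops J" and h: "h \<in> ell2 (I \<times> J)"
  shows "(\<lambda>(i, j). B (\<lambda>j'. h (i, j')) j) \<in> ell2 (I \<times> J)"
proof -
  obtain D where D: "\<And>f. f \<in> ell2 J \<Longrightarrow> ell2_norm (B f) \<le> D * ell2_norm f"
    using bounded_ops_bound[OF B] by blast
  have "B (\<lambda>j'. h (i, j')) j = 0" if "i \<notin> I" for i j
  proof -
    have "(\<lambda>j'. h (i, j')) = (\<lambda>j. 0)"
      using that ell2_outside[OF h] by auto
    then show ?thesis
      by (simp add: bounded_ops_zero'[OF B])
  qed
  then show ?thesis
    by (intro ell2_of_rowwise_bound[OF h]) (use B D ell2_slice_times[OF h] in \<open>auto simp: bounded_ops_in\<close>)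
qed

lemma apply_rowwise_column_in_ell2:
  assumes "B \<in> bounded_ops J" "h \<in> ell2 (I \<times> J)"
  shows "(\<lambda>i. B (\<lambda>j'. h (i, j')) j) \<in> ell2 I"
  using ell2_column[OF apply_rowwise_in_ell2[OF assms], of j] by simp

text \<open>\<open>A\<close> acts on columns, so the rowwise estimate is used a second time between
  two swaps of the variables.\<close>

lemma tensor_op_in_ell2:
  assumes A: "A \<in> bounded_ops I" and B: "B \<in> bounded_ops J" and h: "h \<in> ell2 (I \<times> J)"
  shows "tensor_op I J A B h \<in> ell2 (I \<times> J)"
  using ell2_swap[OF apply_rowwise_in_ell2[OF A ell2_swap[OF apply_rowwise_in_ell2[OF B h]]]] h
  by (simp add: tensor_op_def case_prod_unfold)

lemma tensor_op_add:
  assumes A: "A \<in> bounded_ops I" and B: "B \<in> bounded_ops J" and h: "h \<in> ell2 (I \<times> J)" "h' \<in> ell2 (I \<times> J)"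
  shows "tensor_op I J A B (h + h') = tensor_op I J A B h + tensor_op I J A B h'"
proof -
  have "A (\<lambda>i'. B (\<lambda>j'. (h + h') (i', j')) j) i
      = A (\<lambda>i'. B (\<lambda>j'. h (i', j')) j) i + A (\<lambda>i'. B (\<lambda>j'. h' (i', j')) j) i" for i j
    using bounded_ops_add[OF B ell2_slice_times[OF h(1)] ell2_slice_times[OF h(2)]]
      bounded_ops_add[OF A apply_rowwise_column_in_ell2[OF B h(1)] apply_rowwise_column_in_ell2[OF B h(2)]]
    by (simp add: plus_fun_def)
  then show ?thesis
    using h by (auto simp: tensor_op_def ell2_add fun_eq_iff simp del: plus_fun_apply) (simp add: plus_fun_def)
qed

lemma tensor_op_scale:
  assumes A: "A \<in> bounded_ops I" and B: "B \<in> bounded_ops J" and h: "h \<in> ell2 (I \<times> J)"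
  shows "tensor_op I J A B (vec_scale c h) = vec_scale c (tensor_op I J A B h)"
proof -
  have "A (\<lambda>i'. B (\<lambda>j'. c * h (i', j')) j) i = c * A (\<lambda>i'. B (\<lambda>j'. h (i', j')) j) i" for i j
    using bounded_ops_scale[OF B ell2_slice_times[OF h]]
      bounded_ops_scale[OF A apply_rowwise_column_in_ell2[OF B h]]
    by (simp add: vec_scale_def)
  then show ?thesis
    using h by (auto simp: tensor_op_def ell2_scale fun_eq_iff)
qed

lemma tensor_op_of_zero:
  assumes "A \<in> bounded_ops I" "B \<in> bounded_ops J"
  shows "tensor_op I J A B 0 = 0"
  using tensor_op_scale[OF assms zero_in_ell2(1), of 0] by (simp add: vec_scale_def zero_fun_def)

lemma tensor_op_sum:
  assumes "A \<in> bounded_ops I" "B \<in> bounded_ops J" "\<And>x. x \<in> X \<Longrightarrow> h x \<in> ell2 (I \<times> J)"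
  shows "tensor_op I J A B (\<Sum>x\<in>X. vec_scale (c x) (h x)) = (\<Sum>x\<in>X. vec_scale (c x) (tensor_op I J A B (h x)))"
  using assms(3)
proof (induction X rule: infinite_finite_induct)
  case (insert x X)
  have "tensor_op I J A B (vec_scale (c x) (h x) + (\<Sum>x\<in>X. vec_scale (c x) (h x))) =
      tensor_op I J A B (vec_scale (c x) (h x)) + tensor_op I J A B (\<Sum>x\<in>X. vec_scale (c x) (h x))"
    using insert.prems by (intro tensor_op_add[OF assms(1,2)] ell2_scale ell2_sum) auto
  also have "tensor_op I J A B (vec_scale (c x) (h x)) = vec_scale (c x) (tensor_op I J A B (h x))"
    using insert.prems by (intro tensor_op_scale[OF assms(1,2)]) auto
  also have "tensor_op I J A B (\<Sum>x\<in>X. vec_scale (c x) (h x)) = (\<Sum>x\<in>X. vec_scale (c x) (tensor_op I J A B (h x)))"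
    by (rule insert.IH) (simp add: insert.prems)
  finally show ?case
    by (simp only: sum.insert[OF insert.hyps])
qed (simp_all only: sum.infinite sum.empty, simp_all add: tensor_op_of_zero[OF assms(1,2)])

lemma tensor_op_add_left: "tensor_op I J (A + A') B = tensor_op I J A B + tensor_op I J A' B"
  by (auto simp: tensor_op_def fun_eq_iff)

lemma tensor_op_scale_left: "tensor_op I J (oper_scale c A) B = oper_scale c (tensor_op I J A B)"
  by (auto simp: tensor_op_def fun_eq_iff oper_scale_apply)

text \<open>Additivity on the left is pointwise; here \<open>A\<close> is applied to a sum, so the
  columns of the intermediate functions must be known to lie in \<open>ell2 I\<close>.\<close>

lemma tensor_op_add_right:
  assumes "A \<in> bounded_ops I" "B \<in> bounded_ops J" "B' \<in> bounded_ops J"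
  shows "tensor_op I J A (B + B') = tensor_op I J A B + tensor_op I J A B'"
proof
  fix h
  show "tensor_op I J A (B + B') h = (tensor_op I J A B + tensor_op I J A B') h"
    using bounded_ops_add[OF assms(1) apply_rowwise_column_in_ell2[OF assms(2)] apply_rowwise_column_in_ell2[OF assms(3)], of h h]
    by (cases "h \<in> ell2 (I \<times> J)") (auto simp: tensor_op_def fun_eq_iff plus_fun_def)
qed

lemma tensor_op_scale_right:
  assumes "A \<in> bounded_ops I" "B \<in> bounded_ops J"
  shows "tensor_op I J A (oper_scale c B) = oper_scale c (tensor_op I J A B)"
proof
  fix h
  show "tensor_op I J A (oper_scale c B) h = oper_scale c (tensor_op I J A B) h"
    using bounded_ops_scale[OF assms(1) apply_rowwise_column_in_ell2[OF assms(2)], of h c]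
    by (cases "h \<in> ell2 (I \<times> J)") (auto simp: tensor_op_def fun_eq_iff vec_scale_def oper_scale_apply)
qed

lemma tensor_op_zero_right:
  assumes "A \<in> bounded_ops I"
  shows "tensor_op I J A 0 = 0"
  by (auto simp: tensor_op_def fun_eq_iff bounded_ops_zero'[OF assms])

lemma tensor_op_zero_left [simp]: "tensor_op I J 0 B = 0"
  by (auto simp: tensor_op_def fun_eq_iff)

lemma tensor_op_id:
  assumes "h \<in> ell2 (I \<times> J)"
  shows "tensor_op I J (id_op I) (id_op J) h = h"
  using ell2_column[OF assms] ell2_slice_times[OF assms] assms
  by (auto simp: tensor_op_def id_op_def)

lemma tensor_op_product:
  assumes "A \<in> bounded_ops I" "B \<in> bounded_ops J" "f \<in> ell2 I" "g \<in> ell2 J"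
  shows "tensor_op I J A B (\<lambda>(i, j). f i * g j) = (\<lambda>(i, j). A f i * B g j)"
proof -
  have "A (\<lambda>i'. B (\<lambda>j'. f i' * g j') j) i = A f i * B g j" for i j
    using bounded_ops_scale[OF assms(2,4), of "f _"] bounded_ops_scale[OF assms(1,3), of "B g j"]
    by (simp add: vec_scale_def mult.commute)
  then show ?thesis
    using ell2_product[OF assms(3,4)] by (simp add: tensor_op_def)
qed

lemma tensor_op_in_alg_tensor: "A \<in> S \<Longrightarrow> B \<in> T \<Longrightarrow> tensor_op I J A B \<in> alg_tensor I J S T"
  unfolding alg_tensor_def by (rule oper.span_base) auto

lemma ell2_inner_columns:
  assumes "finite J" "h \<in> ell2 (I \<times> J)" "k \<in> ell2 (I \<times> J)"
  shows "ell2_inner h k = (\<Sum>j\<in>J. ell2_inner (\<lambda>i. h (i, j)) (\<lambda>i. k (i, j)))"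
proof -
  have "((\<lambda>j. ell2_inner (\<lambda>i. h (i, j)) (\<lambda>i. k (i, j))) has_sum ell2_inner h k) UNIV"
    using ell2_inner_slices[OF ell2_swap[OF assms(2)] ell2_swap[OF assms(3)]]
    by (simp add: ell2_inner_swap)
  moreover have "(\<lambda>i. k (i, j)) = 0" if "j \<notin> J" for j
    using that ell2_outside[OF assms(3)] by auto
  ultimately have "((\<lambda>j. ell2_inner (\<lambda>i. h (i, j)) (\<lambda>i. k (i, j))) has_sum ell2_inner h k) J"
    by (subst has_sum_cong_neutral[of UNIV J]) auto
  then show ?thesis
    using assms(1) has_sum_finite has_sum_unique by blast
qed

section \<open>Matrices with a prescribed pattern\<close>

definition mat_op :: "'j set \<Rightarrow> ('j \<Rightarrow> 'j \<Rightarrow> complex) \<Rightarrow> 'j oper" where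
  "mat_op J M = (\<lambda>f. if f \<in> ell2 J then (\<lambda>i. if i \<in> J then (\<Sum>j\<in>J. M i j * f j) else 0) else 0)"

text \<open>For \<open>R\<close> reflexive and symmetric this is the operator system of the graph
  \<open>R\<close>.\<close>

definition pattern_opsys :: "'j set \<Rightarrow> ('j \<Rightarrow> 'j \<Rightarrow> bool) \<Rightarrow> 'j oper set" where
  "pattern_opsys J R = {mat_op J M | M. \<forall>i j. \<not> R i j \<longrightarrow> M i j = 0}"

lemma mat_op_bounded:
  assumes "finite J"
  shows "mat_op J M \<in> bounded_ops J"
proof (rule bounded_opsI)
  fix f assume f: "f \<in> ell2 J"
  have in_ell2: "mat_op J M f \<in> ell2 J"
    using assms f by (simp add: ell2_finite mat_op_def)
  then show "mat_op J M f \<in> ell2 J" .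
  have "ell2_norm (mat_op J M f) = sqrt (\<Sum>i\<in>J. (cmod (mat_op J M f i))\<^sup>2)"
    unfolding ell2_norm_def using assms in_ell2
    by (subst infsum_cong_neutral[where T = J]) (auto simp: ell2_outside)
  also have "\<dots> \<le> (\<Sum>i\<in>J. cmod (mat_op J M f i))"
    using L2_set_le_sum[of J "\<lambda>i. cmod (mat_op J M f i)"] by (simp add: L2_set_def)
  also have "\<dots> \<le> (\<Sum>i\<in>J. \<Sum>j\<in>J. cmod (M i j) * ell2_norm f)"
  proof (rule sum_mono)
    fix i assume "i \<in> J"
    then have "cmod (mat_op J M f i) \<le> (\<Sum>j\<in>J. cmod (M i j * f j))"
      using f by (simp add: mat_op_def norm_sum)
    also have "\<dots> \<le> (\<Sum>j\<in>J. cmod (M i j) * ell2_norm f)"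
      by (intro sum_mono) (simp add: norm_mult mult_left_mono cmod_le_ell2_norm[OF f])
    finally show "cmod (mat_op J M f i) \<le> (\<Sum>j\<in>J. cmod (M i j) * ell2_norm f)" .
  qed
  also have "\<dots> = (\<Sum>i\<in>J. \<Sum>j\<in>J. cmod (M i j)) * ell2_norm f"
    by (simp add: sum_distrib_right)
  finally show "ell2_norm (mat_op J M f) \<le> (\<Sum>i\<in>J. \<Sum>j\<in>J. cmod (M i j)) * ell2_norm f" .
qed (auto simp: mat_op_def ell2_add ell2_scale fun_eq_iff sum.distrib sum_distrib_left algebra_simps)

lemma mat_op_unit_vec:
  assumes "finite J" "p \<in> J" "q \<in> J"
  shows "mat_op J M (unit_vec q) p = M p q"
  using assms unit_vec_in_ell2[of q J]
  by (simp add: mat_op_def unit_vec_def if_distrib[of "\<lambda>x. _ * x"] cong: if_cong)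

lemma ell2_inner_finite:
  assumes "finite J" "f \<in> ell2 J"
  shows "ell2_inner f g = (\<Sum>j\<in>J. cnj (f j) * g j)"
  unfolding ell2_inner_def using assms
  by (subst infsum_cong_neutral[where T = J]) (auto simp: ell2_outside)

lemma ell2_inner_mat_op:
  assumes "finite J" "f \<in> ell2 J" "g \<in> ell2 J"
  shows "ell2_inner f (mat_op J M g) = (\<Sum>i\<in>J. \<Sum>j\<in>J. cnj (f i) * M i j * g j)"
  using assms by (simp add: ell2_inner_finite mat_op_def sum_distrib_left mult.assoc)

lemma adjoint_op_mat_op:
  assumes "finite J"
  shows "adjoint_op J (mat_op J M) = mat_op J (\<lambda>i j. cnj (M j i))"
proof (rule adjoint_op_eqI)
  fix f g assume fg: "f \<in> ell2 J" "g \<in> ell2 J"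
  have "ell2_inner (mat_op J M f) g = cnj (ell2_inner g (mat_op J M f))"
    by (rule ell2_inner_cnj)
  also have "\<dots> = (\<Sum>i\<in>J. \<Sum>j\<in>J. cnj (f j) * cnj (M i j) * g i)"
    using assms fg by (simp add: ell2_inner_mat_op mult_ac)
  also have "\<dots> = ell2_inner f (mat_op J (\<lambda>i j. cnj (M j i)) g)"
    using assms fg by (subst sum.swap) (simp add: ell2_inner_mat_op)
  finally show "ell2_inner (mat_op J M f) g = ell2_inner f (mat_op J (\<lambda>i j. cnj (M j i)) g)" .
qed (rule mat_op_bounded[OF assms])

lemma operator_system_pattern:
  assumes "finite J" "\<And>i. R i i" "\<And>i j. R i j \<Longrightarrow> R j i"
  shows "operator_system J (pattern_opsys J R)"
  unfolding operator_system_def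
proof (intro conjI ballI)
  show "pattern_opsys J R \<subseteq> bounded_ops J"
    by (auto simp: pattern_opsys_def mat_op_bounded[OF assms(1)])
  show "oper.subspace (pattern_opsys J R)"
  proof (rule oper.subspaceI)
    have "0 = mat_op J (\<lambda>_ _. 0)"
      by (auto simp: mat_op_def fun_eq_iff)
    then show "0 \<in> pattern_opsys J R"
      unfolding pattern_opsys_def by blast
  next
    fix A B assume "A \<in> pattern_opsys J R" "B \<in> pattern_opsys J R"
    then obtain M N where M: "A = mat_op J M" "B = mat_op J N"
      "\<forall>i j. \<not> R i j \<longrightarrow> M i j = 0" "\<forall>i j. \<not> R i j \<longrightarrow> N i j = 0"
      unfolding pattern_opsys_def by blast
    have "A + B = mat_op J (\<lambda>i j. M i j + N i j)"
      by (auto simp: M mat_op_def fun_eq_iff sum.distrib algebra_simps)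
    then show "A + B \<in> pattern_opsys J R"
      using M(3,4) unfolding pattern_opsys_def by auto
  next
    fix c A assume "A \<in> pattern_opsys J R"
    then obtain M where M: "A = mat_op J M" "\<forall>i j. \<not> R i j \<longrightarrow> M i j = 0"
      unfolding pattern_opsys_def by blast
    have "oper_scale c A = mat_op J (\<lambda>i j. c * M i j)"
      by (auto simp: M mat_op_def fun_eq_iff oper_scale_apply sum_distrib_left algebra_simps)
    then show "oper_scale c A \<in> pattern_opsys J R"
      using M(2) unfolding pattern_opsys_def by auto
  qed
  have "mat_op J (\<lambda>i j. if i = j then 1 else 0) = id_op J"
    using assms(1)
    by (auto simp: mat_op_def id_op_def fun_eq_iff ell2_outside if_distrib[of "\<lambda>x. x * _"] cong: if_cong)
  then show "id_op J \<in> pattern_opsys J R"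
    using assms(2) unfolding pattern_opsys_def by (auto intro!: exI[of _ "\<lambda>i j. if i = j then 1 else 0"])
  fix A assume "A \<in> pattern_opsys J R"
  then obtain M where M: "A = mat_op J M" "\<forall>i j. \<not> R i j \<longrightarrow> M i j = 0"
    unfolding pattern_opsys_def by blast
  then show "adjoint_op J A \<in> pattern_opsys J R"
    using assms(3) unfolding pattern_opsys_def
    by (auto simp: adjoint_op_mat_op[OF assms(1)] intro!: exI[of _ "\<lambda>i j. cnj (M j i)"])
qed

text \<open>Here \<open>u\<close> is a row of \<open>\<alpha>\<close> and the sum over
  \<open>k\<close> is a Gram form of the scalar matrix \<open>Q\<close>. Contracting the index
  \<open>b\<close> first leaves, for each \<open>k\<close>, a congruence transform of
  \<open>P\<close> alone.\<close>

lemma bilinear_gram_rearrange: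
  fixes u :: "'a \<Rightarrow> 'b \<Rightarrow> complex"
  shows "(\<Sum>(a, b)\<in>A \<times> B. \<Sum>(a', b')\<in>A \<times> B.
      u a b * cnj (u a' b') * ((\<Sum>k\<in>K. v k b * cnj (v' k b')) * P a a')) =
    (\<Sum>k\<in>K. \<Sum>a\<in>A. \<Sum>a'\<in>A. (\<Sum>b\<in>B. u a b * v k b) * cnj (\<Sum>b\<in>B. u a' b * v' k b) * P a a')"
proof -
  have "(\<Sum>(a, b)\<in>A \<times> B. \<Sum>(a', b')\<in>A \<times> B.
      u a b * cnj (u a' b') * ((\<Sum>k\<in>K. v k b * cnj (v' k b')) * P a a')) =
    (\<Sum>a\<in>A. \<Sum>b\<in>B. \<Sum>a'\<in>A. \<Sum>b'\<in>B. \<Sum>k\<in>K. (u a b * v k b) * cnj (u a' b' * v' k b') * P a a')"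
    by (simp add: sum.cartesian_product[symmetric] sum_distrib_left sum_distrib_right mult_ac)
  also have "\<dots> = (\<Sum>k\<in>K. \<Sum>a\<in>A. \<Sum>a'\<in>A. \<Sum>b\<in>B. \<Sum>b'\<in>B. (u a b * v k b) * cnj (u a' b' * v' k b') * P a a')"
    by (simp only: sum.swap[of _ K B] sum.swap[of _ K A] sum.swap[of _ A B])
  also have "\<dots> = (\<Sum>k\<in>K. \<Sum>a\<in>A. \<Sum>a'\<in>A. (\<Sum>b\<in>B. u a b * v k b) * cnj (\<Sum>b\<in>B. u a' b * v' k b) * P a a')"
    unfolding cnj_sum sum_product unfolding sum_distrib_right ..
  finally show ?thesis .
qed


text \<open>The sum over \<open>k\<close> in \<open>E\<close> of the congruences B P B^*, where B
  has the entry \<open>\<beta> k a p\<close> in row \<open>p\<close> and column \<open>a\<close>.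
  The result is an operator matrix indexed by \<open>J\<close>.\<close>

definition compression :: "'k set \<Rightarrow> nat \<Rightarrow> ('k \<Rightarrow> nat \<Rightarrow> 'j \<Rightarrow> complex) \<Rightarrow>
    (nat \<Rightarrow> nat \<Rightarrow> 'i oper) \<Rightarrow> 'j \<Rightarrow> 'j \<Rightarrow> 'i oper" where
  "compression E l \<beta> P p q =
    (\<Sum>k\<in>E. \<Sum>a<l. \<Sum>a'<l. oper_scale (\<beta> k a p * cnj (\<beta> k a' q)) (P a a'))"

lemma compression_apply:
  "compression E l \<beta> P p q f = (\<Sum>k\<in>E. \<Sum>a<l. \<Sum>a'<l. vec_scale (\<beta> k a p * cnj (\<beta> k a' q)) (P a a' f))"
  by (simp add: compression_def sum_fun_apply oper_scale_def)

lemma compression_in: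
  assumes "oper.subspace S" "P \<in> matrices_over l S"
  shows "compression E l \<beta> P p q \<in> S"
  unfolding compression_def using assms
  by (intro oper.subspace_sum oper.subspace_scale) (auto simp: matrices_over_def)

lemma compression_positive:
  assumes "S \<subseteq> bounded_ops I" "P \<in> matrix_cone I S l" "finite J" "\<And>p. p \<in> J \<Longrightarrow> \<xi> p \<in> ell2 I"
  shows "(\<Sum>p\<in>J. \<Sum>q\<in>J. ell2_inner (\<xi> p) (compression E l \<beta> P p q (\<xi> q))) \<in> \<real>\<^sub>\<ge>\<^sub>0"
proof -
  have P: "P a a' \<in> bounded_ops I" if "a < l" "a' < l" for a a'
    using assms(1,2) that by (auto simp: matrix_cone_def matrices_over_def)
  \<comment> \<open>The adjoint of the k-th coefficient matrix applied to \<open>\<xi>\<close>; the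
    form of the compression at \<open>\<xi>\<close> is the sum of the forms of \<open>P\<close> at
    these vectors.\<close>
  define \<zeta> where "\<zeta> k a = (\<Sum>p\<in>J. vec_scale (cnj (\<beta> k a p)) (\<xi> p))" for k a
  have \<zeta>: "\<zeta> k a \<in> ell2 I" for k a
    unfolding \<zeta>_def using assms(4) by (intro ell2_sum ell2_scale)
  have "ell2_inner (\<zeta> k a) (P a a' (\<zeta> k a')) =
    (\<Sum>p\<in>J. \<Sum>q\<in>J. \<beta> k a p * cnj (\<beta> k a' q) * ell2_inner (\<xi> p) (P a a' (\<xi> q)))"
    if a: "a < l" "a' < l" for k a a'
  proof -
    have "P a a' (\<zeta> k a') = (\<Sum>q\<in>J. vec_scale (cnj (\<beta> k a' q)) (P a a' (\<xi> q)))"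
      unfolding \<zeta>_def using P[OF a] assms(4)
      by (subst bounded_ops_sum[OF P[OF a]]) (simp_all add: ell2_scale bounded_ops_scale[OF P[OF a]])
    then have "ell2_inner (\<zeta> k a) (P a a' (\<zeta> k a')) =
        (\<Sum>q\<in>J. cnj (\<beta> k a' q) * ell2_inner (\<zeta> k a) (P a a' (\<xi> q)))"
      using P[OF a] assms(4) \<zeta>[of k a]
      by (simp add: ell2_inner_sum_right[OF \<zeta>] ell2_scale bounded_ops_in ell2_inner_scale_right)
    also have "\<dots> = (\<Sum>q\<in>J. cnj (\<beta> k a' q) * (\<Sum>p\<in>J. \<beta> k a p * ell2_inner (\<xi> p) (P a a' (\<xi> q))))"
    proof (intro sum.cong refl arg_cong2[where f = times])
      fix q assume "q \<in> J"
      then have "P a a' (\<xi> q) \<in> ell2 I"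
        using P[OF a] assms(4) by (simp add: bounded_ops_in)
      then show "ell2_inner (\<zeta> k a) (P a a' (\<xi> q)) = (\<Sum>p\<in>J. \<beta> k a p * ell2_inner (\<xi> p) (P a a' (\<xi> q)))"
        unfolding \<zeta>_def using assms(4)
        by (subst ell2_inner_sum_left[of _ I]) (auto intro: ell2_scale simp: ell2_inner_scale_left)
    qed
    also have "\<dots> = (\<Sum>p\<in>J. \<Sum>q\<in>J. \<beta> k a p * cnj (\<beta> k a' q) * ell2_inner (\<xi> p) (P a a' (\<xi> q)))"
      unfolding sum_distrib_left by (subst sum.swap) (simp add: mult_ac)
    finally show ?thesis .
  qed
  then have "(\<Sum>k\<in>E. \<Sum>a<l. \<Sum>a'<l. ell2_inner (\<zeta> k a) (P a a' (\<zeta> k a'))) =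
    (\<Sum>k\<in>E. \<Sum>a<l. \<Sum>a'<l. \<Sum>p\<in>J. \<Sum>q\<in>J. \<beta> k a p * cnj (\<beta> k a' q) * ell2_inner (\<xi> p) (P a a' (\<xi> q)))"
    by simp
  also have "\<dots> = (\<Sum>p\<in>J. \<Sum>q\<in>J. \<Sum>k\<in>E. \<Sum>a<l. \<Sum>a'<l. \<beta> k a p * cnj (\<beta> k a' q) * ell2_inner (\<xi> p) (P a a' (\<xi> q)))"
    by (simp only: sum.swap[of _ J "{..<l}"] sum.swap[of _ J E])
  also have "\<dots> = (\<Sum>p\<in>J. \<Sum>q\<in>J. ell2_inner (\<xi> p) (compression E l \<beta> P p q (\<xi> q)))"
  proof (intro sum.cong refl)
    fix p q assume pq: "p \<in> J" "q \<in> J"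
    have in_ell2: "vec_scale c (P a a' (\<xi> q)) \<in> ell2 I" if "a < l" "a' < l" for c a a'
      using P[OF that] assms(4)[OF pq(2)] by (simp add: ell2_scale bounded_ops_in)
    show "(\<Sum>k\<in>E. \<Sum>a<l. \<Sum>a'<l. \<beta> k a p * cnj (\<beta> k a' q) * ell2_inner (\<xi> p) (P a a' (\<xi> q))) =
        ell2_inner (\<xi> p) (compression E l \<beta> P p q (\<xi> q))"
      unfolding compression_apply
      by (subst ell2_inner_sum_right[OF assms(4)[OF pq(1)]], intro ell2_sum in_ell2, simp, simp,
          intro sum.cong refl,
          subst ell2_inner_sum_right[OF assms(4)[OF pq(1)]], intro ell2_sum in_ell2, simp, simp,
          intro sum.cong refl,
          subst ell2_inner_sum_right[OF assms(4)[OF pq(1)]], intro in_ell2, simp, simp,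
          simp only: ell2_inner_scale_right)
  qed
  finally have "(\<Sum>k\<in>E. \<Sum>a<l. \<Sum>a'<l. ell2_inner (\<zeta> k a) (P a a' (\<zeta> k a'))) =
      (\<Sum>p\<in>J. \<Sum>q\<in>J. ell2_inner (\<xi> p) (compression E l \<beta> P p q (\<xi> q)))" .
  moreover have "(\<Sum>k\<in>E. \<Sum>a<l. \<Sum>a'<l. ell2_inner (\<zeta> k a) (P a a' (\<zeta> k a'))) \<in> \<real>\<^sub>\<ge>\<^sub>0"
    by (rule sum_nonneg_Reals) (use assms(2) \<zeta> in \<open>simp add: matrix_cone_def\<close>)
  ultimately show ?thesis
    by simp
qed

text \<open>A decomposition of the scalar matrix \<open>Q\<close> into rank-one terms induces one of
  \<open>\<alpha>(P \<otimes> Q)\<alpha>\<^sup>*\<close>.\<close>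

lemma max_cone_pre_pattern_split:
  assumes S: "S \<subseteq> bounded_ops I" "oper.subspace S" and J: "finite J"
    and XZ: "X \<subseteq> J" "Z \<subseteq> J" "X \<inter> Z = {}" "\<And>p q. p \<in> X \<Longrightarrow> q \<in> Z \<Longrightarrow> \<not> R p q"
    and x: "x \<in> max_cone_pre I J S (pattern_opsys J R) 1"
  obtains Y1 Y2 where "\<And>p q. Y1 p q \<in> S" "\<And>p q. Y2 p q \<in> S"
    "\<And>p q. p \<in> Z \<or> q \<in> Z \<Longrightarrow> Y1 p q = 0" "\<And>p q. p \<in> X \<or> q \<in> X \<Longrightarrow> Y2 p q = 0"
    "\<And>\<xi>. (\<And>p. p \<in> J \<Longrightarrow> \<xi> p \<in> ell2 I) \<Longrightarrow> (\<Sum>p\<in>J. \<Sum>q\<in>J. ell2_inner (\<xi> p) (Y1 p q (\<xi> q))) \<in> \<real>\<^sub>\<ge>\<^sub>0"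
    "\<And>\<xi>. (\<And>p. p \<in> J \<Longrightarrow> \<xi> p \<in> ell2 I) \<Longrightarrow> (\<Sum>p\<in>J. \<Sum>q\<in>J. ell2_inner (\<xi> p) (Y2 p q (\<xi> q))) \<in> \<real>\<^sub>\<ge>\<^sub>0"
    "\<And>f p q i. f \<in> ell2 I \<Longrightarrow> p \<in> J \<Longrightarrow> q \<in> J \<Longrightarrow>
      x 0 0 (\<lambda>(i, j). f i * unit_vec q j) (i, p) = Y1 p q f i + Y2 p q f i"
proof -
  obtain l m P Q \<alpha> where P: "P \<in> matrix_cone I S l" and Q: "Q \<in> matrix_cone J (pattern_opsys J R) m"
    and x_eq: "x 0 0 = (\<Sum>(a, b)\<in>{..<l} \<times> {..<m}. \<Sum>(a', b')\<in>{..<l} \<times> {..<m}.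
         oper_scale (\<alpha> 0 (a, b) * cnj (\<alpha> 0 (a', b'))) (tensor_op I J (P a a') (Q b b')))"
    using x unfolding max_cone_pre_def by auto
  have "\<forall>b b'. \<exists>M. b < m \<longrightarrow> b' < m \<longrightarrow> Q b b' = mat_op J M \<and> (\<forall>i j. \<not> R i j \<longrightarrow> M i j = 0)"
    using Q unfolding matrix_cone_def matrices_over_def pattern_opsys_def by blast
  then obtain M where M: "\<And>b b'. b < m \<Longrightarrow> b' < m \<Longrightarrow> Q b b' = mat_op J (M b b')"
      "\<And>b b' i j. b < m \<Longrightarrow> b' < m \<Longrightarrow> \<not> R i j \<Longrightarrow> M b b' i j = 0"
    by metis
  \<comment> \<open>The entries of \<open>Q\<close> are themselves scalar matrices; flattened over
    pairs (block, coordinate) they form one scalar matrix \<open>N\<close>, to which elimination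
    applies.\<close>
  define K where "K = {..<m} \<times> J"
  define N where "N = (\<lambda>(b, p) (b', q). M b b' p q)"
  have K: "finite K"
    using J by (simp add: K_def)
  have "psd K N"
    unfolding psd_def
  proof
    fix z :: "nat \<times> 'b \<Rightarrow> complex"
    define \<eta> where "\<eta> b j = (if j \<in> J then z (b, j) else 0)" for b j
    have \<eta>: "\<eta> b \<in> ell2 J" for b
      using J by (simp add: \<eta>_def ell2_finite)
    then have "(\<Sum>b<m. \<Sum>b'<m. ell2_inner (\<eta> b) (Q b b' (\<eta> b'))) \<in> \<real>\<^sub>\<ge>\<^sub>0"
      using Q by (simp add: matrix_cone_def)
    also have "(\<Sum>b<m. \<Sum>b'<m. ell2_inner (\<eta> b) (Q b b' (\<eta> b'))) =
        (\<Sum>b<m. \<Sum>b'<m. \<Sum>p\<in>J. \<Sum>q\<in>J. cnj (z (b, p)) * M b b' p q * z (b', q))"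
      using M(1) by (simp add: ell2_inner_mat_op[OF J \<eta> \<eta>]) (simp add: \<eta>_def)
    also have "\<dots> = (\<Sum>b<m. \<Sum>p\<in>J. \<Sum>b'<m. \<Sum>q\<in>J. cnj (z (b, p)) * M b b' p q * z (b', q))"
      by (intro sum.cong refl sum.swap)
    also have "\<dots> = (\<Sum>i\<in>K. \<Sum>j\<in>K. cnj (z i) * N i j * z j)"
      by (simp add: K_def N_def sum.cartesian_product')
    finally show "(\<Sum>i\<in>K. \<Sum>j\<in>K. cnj (z i) * N i j * z j) \<in> \<real>\<^sub>\<ge>\<^sub>0" .
  qed
  define X' Z' where "X' = {..<m} \<times> X" and "Z' = {..<m} \<times> Z"
  have XK: "X' \<subseteq> K" "Z' \<subseteq> K"
    using XZ by (auto simp: X'_def Z'_def K_def)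
  have N0: "N i j = 0" if "i \<in> X'" "j \<in> Z'" for i j
    using that XZ(4) M(2) by (auto simp: N_def X'_def Z'_def)
  obtain w where "\<forall>i\<in>K. \<forall>j\<in>K. N i j = (\<Sum>k\<in>K. w k i * cnj (w k j))"
    "\<forall>k\<in>X'. \<forall>j\<in>Z'. w k j = 0" "\<forall>k\<in>K-X'. \<forall>j\<in>X'. w k j = 0"
    using psd_decomposition[OF K \<open>psd K N\<close> XK N0] by blast
  then have w: "\<And>i j. i \<in> K \<Longrightarrow> j \<in> K \<Longrightarrow> N i j = (\<Sum>k\<in>K. w k i * cnj (w k j))"
    "\<And>k j. k \<in> X' \<Longrightarrow> j \<in> Z' \<Longrightarrow> w k j = 0" "\<And>k j. k \<in> K - X' \<Longrightarrow> j \<in> X' \<Longrightarrow> w k j = 0"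
    by blast+
  \<comment> \<open>Contracting the second tensor index of \<open>\<alpha>\<close> with
    \<open>w k\<close> turns the k-th rank-one term of \<open>N\<close> into coefficients for
    \<open>P\<close>.\<close>
  define \<beta> where "\<beta> k a p = (\<Sum>b<m. \<alpha> 0 (a, b) * w k (b, p))" for k a p
  have \<beta>Z: "\<beta> k a p = 0" if "k \<in> X'" "p \<in> Z" for k a p
    unfolding \<beta>_def using w(2)[OF that(1)] that(2) by (intro sum.neutral) (auto simp: Z'_def)
  have \<beta>X: "\<beta> k a p = 0" if "k \<in> K - X'" "p \<in> X" for k a p
    unfolding \<beta>_def using w(3)[OF that(1)] that(2) by (intro sum.neutral) (auto simp: X'_def)
  have P': "P \<in> matrices_over l S"
    using P by (simp add: matrix_cone_def)
  show ?thesis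
  \<comment> \<open>Terms whose pivot lies over \<open>X\<close> avoid \<open>Z\<close>, and the
    others avoid \<open>X\<close>; grouping them accordingly gives the two pieces.\<close>
  proof (rule that[of "compression X' l \<beta> P" "compression (K - X') l \<beta> P"])
    show "compression X' l \<beta> P p q \<in> S" "compression (K - X') l \<beta> P p q \<in> S" for p q
      by (rule compression_in[OF S(2) P'])+
    show "compression X' l \<beta> P p q = 0" if "p \<in> Z \<or> q \<in> Z" for p q
      unfolding compression_def using \<beta>Z that by (intro sum.neutral ballI) (auto simp: oper.scale_zero_left)
    show "compression (K - X') l \<beta> P p q = 0" if "p \<in> X \<or> q \<in> X" for p q
      unfolding compression_def using \<beta>X that by (intro sum.neutral ballI) (auto simp: oper.scale_zero_left)
    show "(\<Sum>p\<in>J. \<Sum>q\<in>J. ell2_inner (\<xi> p) (compression X' l \<beta> P p q (\<xi> q))) \<in> \<real>\<^sub>\<ge>\<^sub>0"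
      "(\<Sum>p\<in>J. \<Sum>q\<in>J. ell2_inner (\<xi> p) (compression (K - X') l \<beta> P p q (\<xi> q))) \<in> \<real>\<^sub>\<ge>\<^sub>0"
      if "\<And>p. p \<in> J \<Longrightarrow> \<xi> p \<in> ell2 I" for \<xi>
      by (rule compression_positive[OF S(1) P J that], assumption)+
    \<comment> \<open>Applying an operator to \<open>f\<close> tensored with the basis vector at
      \<open>q\<close> and reading the result at \<open>p\<close> extracts its block (p, q).\<close>
    fix f p q i assume f: "f \<in> ell2 I" and p: "p \<in> J" and q: "q \<in> J"
    have "tensor_op I J (P a a') (Q b b') (\<lambda>(i, j). f i * unit_vec q j) (i, p) =
        (\<Sum>k\<in>K. w k (b, p) * cnj (w k (b', q))) * P a a' f i"
      if a: "a < l" "a' < l" and b: "b < m" "b' < m" for a a' b b'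
    proof -
      have "P a a' \<in> bounded_ops I"
        using S(1) P' a by (auto simp: matrices_over_def)
      then have "tensor_op I J (P a a') (Q b b') (\<lambda>(i, j). f i * unit_vec q j) (i, p) = P a a' f i * M b b' p q"
        using M(1)[OF b] f p q J
        by (simp add: tensor_op_product unit_vec_in_ell2 mat_op_bounded mat_op_unit_vec)
      also have "M b b' p q = (\<Sum>k\<in>K. w k (b, p) * cnj (w k (b', q)))"
        using w(1)[of "(b, p)" "(b', q)"] b p q by (simp add: K_def N_def)
      finally show ?thesis
        by (simp add: mult.commute)
    qed
    then have "x 0 0 (\<lambda>(i, j). f i * unit_vec q j) (i, p) =
      (\<Sum>(a, b)\<in>{..<l} \<times> {..<m}. \<Sum>(a', b')\<in>{..<l} \<times> {..<m}.
         \<alpha> 0 (a, b) * cnj (\<alpha> 0 (a', b')) * ((\<Sum>k\<in>K. w k (b, p) * cnj (w k (b', q))) * P a a' f i))"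
      unfolding x_eq by (auto simp: sum_fun_apply case_prod_unfold oper_scale_apply intro!: sum.cong)
    also have "\<dots> = (\<Sum>k\<in>K. \<Sum>a<l. \<Sum>a'<l. \<beta> k a p * cnj (\<beta> k a' q) * P a a' f i)"
      unfolding \<beta>_def by (rule bilinear_gram_rearrange)
    also have "\<dots> = compression X' l \<beta> P p q f i + compression (K - X') l \<beta> P p q f i"
      unfolding compression_apply sum_fun_apply vec_scale_apply
      by (subst sum.subset_diff[OF XK(1) K]) (rule add.commute)
    finally show "x 0 0 (\<lambda>(i, j). f i * unit_vec q j) (i, p) =
      compression X' l \<beta> P p q f i + compression (K - X') l \<beta> P p q f i" .
  qed
qed


section \<open>A test for nuclearity\<close>

lemma three_distinct_elements:
  obtains p1 p2 p3 :: "'b::infinite" where "p1 \<noteq> p2" "p1 \<noteq> p3" "p2 \<noteq> p3"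
proof -
  obtain p1 :: 'b where "p1 \<notin> {}"
    by simp
  obtain p2 where "p2 \<notin> {p1}"
    using ex_new_if_finite[OF infinite_UNIV] by (metis finite.emptyI finite_insert)
  obtain p3 where "p3 \<notin> {p1, p2}"
    using ex_new_if_finite[OF infinite_UNIV] by (metis finite.emptyI finite_insert)
  show ?thesis
    by (rule that[of p1 p2 p3]) (use \<open>p2 \<notin> {p1}\<close> \<open>p3 \<notin> {p1, p2}\<close> in auto)
qed

text \<open>The tridiagonal matrix with rows \<open>(1, b, 0)\<close>,
  \<open>(b\<^sup>*, c, d\<^sup>*)\<close>, \<open>(0, d, 1)\<close> is positive.  If it lies in the maximal cone, then \<open>c\<close> splits
  approximately as \<open>c\<^sub>1 + c\<^sub>2\<close> in \<open>S\<close> with \<open>c\<^sub>1 \<ge> b\<^sup>*b\<close> and \<open>c\<^sub>2 \<ge> d\<^sup>*d\<close>, which forces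
  \<open>c\<^sub>1 \<approx> b\<^sup>*b\<close>.\<close>

lemma nuclear_imp_square_approx:
  fixes S :: "'i oper set"
  assumes nuc: "min_max_nuclear TYPE('b::infinite) I S"
    and S: "S \<subseteq> bounded_ops I" "oper.subspace S" "id_op I \<in> S"
    and in_S: "b \<in> S" "b' \<in> S" "c \<in> S" "d \<in> S" "d' \<in> S"
    and b': "\<And>f g. f \<in> ell2 I \<Longrightarrow> g \<in> ell2 I \<Longrightarrow> ell2_inner f (b' g) = ell2_inner (b f) g"
    and d': "\<And>f g. f \<in> ell2 I \<Longrightarrow> g \<in> ell2 I \<Longrightarrow> ell2_inner f (d' g) = ell2_inner (d f) g"
    and c: "\<And>f. f \<in> ell2 I \<Longrightarrow>
      ell2_inner f (c f) = ell2_inner (b f) (b f) + ell2_inner (d f) (d f)"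
    and r: "r > 0"
  obtains c1 where "c1 \<in> S" "\<And>f. f \<in> ell2 I \<Longrightarrow>
    cmod (ell2_inner f (c1 f) - ell2_inner (b f) (b f)) \<le>
      r * ((ell2_norm f)\<^sup>2 + (ell2_norm (b f))\<^sup>2 + (ell2_norm (d f))\<^sup>2)"
proof -
  obtain p1 p2 p3 :: 'b where p: "p1 \<noteq> p2" "p1 \<noteq> p3" "p2 \<noteq> p3"
    by (rule three_distinct_elements)
  define J where "J = {p1, p2, p3}"
  define R where "R i j \<longleftrightarrow> \<not> (i = p1 \<and> j = p3) \<and> \<not> (i = p3 \<and> j = p1)" for i j
  define T where "T = pattern_opsys J R"
  have J: "finite J"
    by (simp add: J_def)
  have T: "operator_system J T"
    unfolding T_def using J p by (intro operator_system_pattern) (auto simp: R_def)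
  define s where "s i j = (if i = p1 \<and> j = p1 \<or> i = p3 \<and> j = p3 then id_op I else
    if i = p1 \<and> j = p2 then b else if i = p2 \<and> j = p1 then b' else if i = p2 \<and> j = p2 then c else
    if i = p2 \<and> j = p3 then d' else if i = p3 \<and> j = p2 then d else 0)" for i j
  have s_in: "s i j \<in> S" for i j
    using S in_S oper.subspace_0[OF S(2)] by (simp add: s_def)
  have s_bdd: "s i j \<in> bounded_ops I" for i j
    using s_in S(1) by auto
  define e where "e i j = mat_op J (\<lambda>i' j'. if i' = i \<and> j' = j then 1 else 0)" for i j
  define X where "X = (\<Sum>i\<in>J. \<Sum>j\<in>J. tensor_op I J (s i j) (e i j))"
  have X_in: "X \<in> alg_tensor I J S T"
  proof -
    have "tensor_op I J (s i j) (e i j) \<in> alg_tensor I J S T" if "i \<in> J" "j \<in> J" for i j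
    proof (cases "R i j")
      case True
      then have "e i j \<in> T"
        unfolding T_def pattern_opsys_def e_def by auto
      then show ?thesis
        by (intro tensor_op_in_alg_tensor s_in)
    next
      \<comment> \<open>A corner matrix unit lies outside \<open>T\<close>, but the corner entries
        of \<open>s\<close> are zero.\<close>
      case False
      then have "s i j = 0"
        using p by (auto simp: R_def s_def)
      then show ?thesis
        by (simp add: alg_tensor_def oper.span_zero)
    qed
    then show ?thesis
      unfolding X_def alg_tensor_def by (intro oper.span_sum)
  qed
  have e_bdd: "e i j \<in> bounded_ops J" for i j
    unfolding e_def by (rule mat_op_bounded[OF J])
  have X_apply: "X h (i, p) = (\<Sum>q\<in>J. s p q (\<lambda>i. h (i, q)) i)" if "h \<in> ell2 (I \<times> J)" "p \<in> J" for h i p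
  proof -
    have "e p' q (\<lambda>j'. h (i', j')) p = (if p = p' then h (i', q) else 0)" if "p' \<in> J" "q \<in> J" for p' q i'
      using J \<open>p \<in> J\<close> ell2_slice_times[OF \<open>h \<in> ell2 (I \<times> J)\<close>] that
      by (simp add: e_def mat_op_def if_distrib[of "\<lambda>x. x * _"] cong: if_cong)
    then have "tensor_op I J (s p' q) (e p' q) h (i, p) = (if p' = p then s p q (\<lambda>i. h (i, q)) i else 0)"
      if "p' \<in> J" "q \<in> J" for p' q
      using \<open>h \<in> ell2 (I \<times> J)\<close> that bounded_ops_zero'[OF s_bdd] by (simp add: tensor_op_def)
    then have "X h (i, p) = (\<Sum>p'\<in>J. \<Sum>q\<in>J. if p' = p then s p q (\<lambda>i. h (i, q)) i else 0)"
      by (simp add: X_def sum_fun_apply)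
    also have "\<dots> = (\<Sum>q\<in>J. s p q (\<lambda>i. h (i, q)) i)"
      using J \<open>p \<in> J\<close> by (subst sum.swap) simp
    finally show ?thesis .
  qed
  have "(\<lambda>_ _. X) \<in> min_cone I J S T 1"
  proof -
    have "ell2_inner h (X h) \<in> \<real>\<^sub>\<ge>\<^sub>0" if h: "h \<in> ell2 (I \<times> J)" for h
    proof -
      define f where "f p = (\<lambda>i. h (i, p))" for p
      have f: "f p \<in> ell2 I" for p
        unfolding f_def by (rule ell2_column[OF h])
      have sf: "s p q (f q) \<in> ell2 I" for p q
        by (rule bounded_ops_in[OF s_bdd f])
      have "X h = (\<Sum>i\<in>J. \<Sum>j\<in>J. tensor_op I J (s i j) (e i j) h)"
        by (simp add: X_def sum_fun_apply fun_eq_iff)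
      moreover have "\<dots> \<in> ell2 (I \<times> J)"
        by (intro ell2_sum tensor_op_in_ell2 s_bdd e_bdd h)
      ultimately have "ell2_inner h (X h) = (\<Sum>p\<in>J. ell2_inner (\<lambda>i. h (i, p)) (\<lambda>i. X h (i, p)))"
        by (intro ell2_inner_columns[OF J h]) simp
      also have "\<dots> = (\<Sum>p\<in>J. ell2_inner (f p) (\<Sum>q\<in>J. s p q (f q)))"
      proof (intro sum.cong refl arg_cong2[where f = ell2_inner])
        fix p assume "p \<in> J"
        then show "(\<lambda>i. X h (i, p)) = (\<Sum>q\<in>J. s p q (f q))"
          by (auto simp: fun_eq_iff sum_fun_apply X_apply[OF h] f_def)
      qed (simp add: f_def)
      also have "\<dots> = (\<Sum>p\<in>J. \<Sum>q\<in>J. ell2_inner (f p) (s p q (f q)))"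
        by (simp add: ell2_inner_sum_right[OF f sf])
      \<comment> \<open>Completing squares: the middle entry \<open>c\<close> supplies exactly the
        squared norms of \<open>b (f p2)\<close> and \<open>d (f p2)\<close>.\<close>
      also have "\<dots> = ell2_inner (f p1 + b (f p2)) (f p1 + b (f p2))
          + ell2_inner (f p3 + d (f p2)) (f p3 + d (f p2))"
      proof -
        have bf: "b (f p2) \<in> ell2 I" and df: "d (f p2) \<in> ell2 I"
          using sf[of p1 p2] sf[of p3 p2] p by (auto simp: s_def)
        show ?thesis
          using p f bf df by (simp add: J_def s_def id_op_def b' d' c
            ell2_inner_add_left[of _ I] ell2_inner_add_right[of _ I] ell2_add)
      qed
      finally show ?thesis
        by (simp add: ell2_inner_self del: of_real_power)
    qed
    then show ?thesis
      using X_in by (simp add: min_cone_def matrix_cone_def matrices_over_def)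
  qed
  moreover have "completely_positive (min_cone I J S T) (max_cone I J S T) id"
    using nuc T unfolding min_max_nuclear_def complete_order_isomorphism_def by blast
  ultimately have "(\<lambda>_ _. X) \<in> max_cone I J S T 1"
    unfolding completely_positive_def by auto
  then have "(\<lambda>i j. (if i = j then oper_scale (complex_of_real r) (tensor_op I J (id_op I) (id_op J)) else 0) + X)
      \<in> max_cone_pre I J S T 1" (is "?x \<in> _")
    using r by (simp add: max_cone_def)
  then obtain Y1 Y2 where Y: "\<And>p q. Y1 p q \<in> S" "\<And>p q. Y2 p q \<in> S"
    "\<And>p q. p = p3 \<or> q = p3 \<Longrightarrow> Y1 p q = 0" "\<And>p q. p = p1 \<or> q = p1 \<Longrightarrow> Y2 p q = 0"
    and pos1: "\<And>\<xi>. (\<And>p. p \<in> J \<Longrightarrow> \<xi> p \<in> ell2 I) \<Longrightarrow> (\<Sum>p\<in>J. \<Sum>q\<in>J. ell2_inner (\<xi> p) (Y1 p q (\<xi> q))) \<in> \<real>\<^sub>\<ge>\<^sub>0"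
    and pos2: "\<And>\<xi>. (\<And>p. p \<in> J \<Longrightarrow> \<xi> p \<in> ell2 I) \<Longrightarrow> (\<Sum>p\<in>J. \<Sum>q\<in>J. ell2_inner (\<xi> p) (Y2 p q (\<xi> q))) \<in> \<real>\<^sub>\<ge>\<^sub>0"
    and x_eq: "\<And>f p q i. f \<in> ell2 I \<Longrightarrow> p \<in> J \<Longrightarrow> q \<in> J \<Longrightarrow>
      ?x 0 0 (\<lambda>(i, j). f i * unit_vec q j) (i, p) = Y1 p q f i + Y2 p q f i"
    using max_cone_pre_pattern_split[OF S(1,2) J, of "{p1}" "{p3}" R ?x]
    unfolding T_def by (auto simp: J_def R_def p)
  \<comment> \<open>The blocks of \<open>X\<close> plus \<open>r\<close> times the unit are shared
    between \<open>Y1\<close> and \<open>Y2\<close>. As \<open>Y2\<close> vanishes at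
    \<open>p1\<close> and \<open>Y1\<close> at \<open>p3\<close>, only the middle block is really
    divided.\<close>
  have split: "Y1 p q f + Y2 p q f = s p q f + (if p = q then vec_scale (complex_of_real r) f else 0)"
    if f: "f \<in> ell2 I" and p: "p \<in> J" and q: "q \<in> J" for f p q
  proof
    fix i
    have h: "(\<lambda>(i, j). f i * unit_vec q j) \<in> ell2 (I \<times> J)"
      using f q by (simp add: ell2_product unit_vec_in_ell2)
    have col: "s p q' (\<lambda>i. f i * unit_vec q q') i = (if q' = q then s p q f i else 0)" for q'
      using bounded_ops_zero'[OF s_bdd] by (simp add: unit_vec_def)
    have "?x 0 0 (\<lambda>(i, j). f i * unit_vec q j) (i, p) = r * (f i * unit_vec q p) + s p q f i"
      using X_apply[OF h p, of i] J q by (simp add: oper_scale_apply tensor_op_id[OF h] col)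
    then show "(Y1 p q f + Y2 p q f) i = (s p q f + (if p = q then vec_scale (complex_of_real r) f else 0)) i"
      unfolding x_eq[OF f p q] by (auto simp: unit_vec_def add.commute)
  qed
  define c1 c2 where "c1 = Y1 p2 p2" and "c2 = Y2 p2 p2"
  have Y_bdd: "Y1 p q \<in> bounded_ops I" "Y2 p q \<in> bounded_ops I" for p q
    using Y(1,2) S(1) by auto
  show ?thesis
  proof (rule that)
    show "c1 \<in> S"
      unfolding c1_def by (rule Y(1))
    fix f assume f: "f \<in> ell2 I"
    define x where "x = ell2_inner f (c1 f)"
    define y where "y = ell2_inner f (c2 f)"
    define u where "u = (ell2_norm (b f))\<^sup>2"
    define v where "v = (ell2_norm (d f))\<^sup>2"
    have bf: "b f \<in> ell2 I" and df: "d f \<in> ell2 I"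
      using f in_S S(1) bounded_ops_in by blast+
    have bf': "- b f \<in> ell2 I" and df': "- d f \<in> ell2 I"
      using bf df by (auto simp: ell2_uminus)
    have b'f: "b' (- b f) \<in> ell2 I" and d'f: "d' (- d f) \<in> ell2 I"
      using bf' df' in_S S(1) bounded_ops_in by blast+
    have inner: "ell2_inner (b f) (b f) = complex_of_real u" "ell2_inner (d f) (d f) = complex_of_real v"
      by (simp_all only: ell2_inner_self u_def v_def)
    have "c1 f + c2 f = c f + vec_scale (complex_of_real r) f"
      using split[OF f, of p2 p2] p by (simp add: c1_def c2_def J_def s_def)
    then have "ell2_inner f (c1 f) + ell2_inner f (c2 f) = ell2_inner f (c f) + r * ell2_inner f f"
      using f Y_bdd in_S S(1) ell2_inner_add_right[of f I]
      by (metis bounded_ops_in c1_def c2_def ell2_inner_scale_right ell2_scale subsetD)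
    then have sum: "x + y = complex_of_real (u + v + r * (ell2_norm f)\<^sup>2)"
      by (simp add: x_def y_def c[OF f] ell2_inner_self u_def v_def)
    \<comment> \<open>For corner entry 1 this is the minimising vector of the form, whose minimum
      would be \<open>x - u\<close>; with the corner entry 1 + r it costs \<open>r * u\<close> more.
      Positivity thus gives \<open>x\<close> at least (1 - r) u, and symmetrically
      \<open>\<xi>2\<close> gives \<open>y\<close> at least (1 - r) v.\<close>
    define \<xi>1 where "\<xi>1 = (\<lambda>p. if p = p1 then - b f else if p = p2 then f else 0)"
    have "Y1 p1 p1 (- b f) = - b f + vec_scale (complex_of_real r) (- b f)"
      "Y1 p1 p2 f = b f" "Y1 p2 p1 (- b f) = b' (- b f)"
      using split[OF bf', of p1 p1] split[OF f, of p1 p2] split[OF bf', of p2 p1] p Y(4) bf'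
      by (simp_all add: J_def s_def id_op_def)
    then have "(\<Sum>p\<in>J. \<Sum>q\<in>J. ell2_inner (\<xi>1 p) (Y1 p q (\<xi>1 q))) = x + complex_of_real (r * u - u)"
      using p bf bf' f Y(3)
      by (simp add: J_def \<xi>1_def x_def c1_def b' inner ell2_inner_diff_right[OF bf ell2_scale[OF bf'] bf]
        ell2_inner_scale_right)
    moreover have "(\<Sum>p\<in>J. \<Sum>q\<in>J. ell2_inner (\<xi>1 p) (Y1 p q (\<xi>1 q))) \<in> \<real>\<^sub>\<ge>\<^sub>0"
      by (rule pos1) (simp add: \<xi>1_def bf' f)
    ultimately have pos_x: "x + complex_of_real (r * u - u) \<in> \<real>\<^sub>\<ge>\<^sub>0"
      by simp
    define \<xi>2 where "\<xi>2 = (\<lambda>p. if p = p3 then - d f else if p = p2 then f else 0)"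
    have "Y2 p3 p3 (- d f) = - d f + vec_scale (complex_of_real r) (- d f)"
      "Y2 p3 p2 f = d f" "Y2 p2 p3 (- d f) = d' (- d f)"
      using split[OF df', of p3 p3] split[OF f, of p3 p2] split[OF df', of p2 p3] p Y(3) df'
      by (simp_all add: J_def s_def id_op_def)
    then have "(\<Sum>p\<in>J. \<Sum>q\<in>J. ell2_inner (\<xi>2 p) (Y2 p q (\<xi>2 q))) = y + complex_of_real (r * v - v)"
      using p df df' f Y(4)
      by (simp add: J_def \<xi>2_def y_def c2_def d' inner ell2_inner_diff_right[OF df ell2_scale[OF df'] df]
        ell2_inner_scale_right)
    moreover have "(\<Sum>p\<in>J. \<Sum>q\<in>J. ell2_inner (\<xi>2 p) (Y2 p q (\<xi>2 q))) \<in> \<real>\<^sub>\<ge>\<^sub>0"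
      by (rule pos2) (simp add: \<xi>2_def df' f)
    ultimately have pos_y: "y + complex_of_real (r * v - v) \<in> \<real>\<^sub>\<ge>\<^sub>0"
      by simp
    have "Im x = 0" "Re x \<ge> u - r * u" "Re y \<ge> v - r * v"
      using pos_x pos_y by (auto simp: complex_nonneg_Reals_iff)
    \<comment> \<open>The lower bound for \<open>y\<close> turns the known sum into an upper bound
      for \<open>x\<close> that matches its lower bound up to terms of size
      \<open>r\<close>.\<close>
    moreover have "Re x + Re y = u + v + r * (ell2_norm f)\<^sup>2"
      using arg_cong[OF sum, of Re] by simp
    moreover have "r * u \<ge> 0" "r * v \<ge> 0" "r * (ell2_norm f)\<^sup>2 \<ge> 0"
      using r by (simp_all add: u_def v_def)
    ultimately have "\<bar>Re x - u\<bar> \<le> r * ((ell2_norm f)\<^sup>2 + u + v)" "x - complex_of_real u = complex_of_real (Re x - u)"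
      by (auto simp: abs_le_iff algebra_simps complex_eq_iff)
    then show "cmod (ell2_inner f (c1 f) - ell2_inner (b f) (b f)) \<le>
      r * ((ell2_norm f)\<^sup>2 + (ell2_norm (b f))\<^sup>2 + (ell2_norm (d f))\<^sup>2)"
      unfolding x_def[symmetric] inner u_def[symmetric] v_def[symmetric] by (simp only: norm_of_real)
  qed
qed

section \<open>Spans of finitely many orthogonal projections are nuclear\<close>

lemma has_sum_sum:
  fixes f :: "'a \<Rightarrow> 'b \<Rightarrow> 'c::topological_comm_monoid_add"
  assumes "\<And>x. x \<in> A \<Longrightarrow> (f x has_sum s x) U"
  shows "((\<lambda>i. \<Sum>x\<in>A. f x i) has_sum (\<Sum>x\<in>A. s x)) U"
  using assms by (induction A rule: infinite_finite_induct) (auto intro: has_sum_add)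

lemma has_sum_nonneg_Reals:
  assumes "(f has_sum s) U" "\<And>i. i \<in> U \<Longrightarrow> f i \<in> \<real>\<^sub>\<ge>\<^sub>0"
  shows "s \<in> (\<real>\<^sub>\<ge>\<^sub>0 :: complex set)"
proof -
  have "Re s \<ge> 0"
    by (rule has_sum_nonneg[OF has_sum_Re[OF assms(1)]]) (use assms(2) in \<open>auto simp: complex_nonneg_Reals_iff\<close>)
  moreover have "((\<lambda>i. 0) has_sum Im s) U"
    using has_sum_Im[OF assms(1)] assms(2) by (auto simp: complex_nonneg_Reals_iff cong: has_sum_cong)
  then have "Im s = 0"
    using has_sum_unique has_sum_0_simp by blast
  ultimately show ?thesis
    by (simp add: complex_nonneg_Reals_iff)
qed

lemma span_finite_family:
  assumes "A \<in> oper.span (e ` {..<n::nat})"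
  obtains \<mu> where "A = (\<Sum>k<n. oper_scale (\<mu> k) (e k))"
proof -
  define V where "V = {\<Sum>k<n. oper_scale (\<mu> k) (e k) | \<mu>. True}"
  have "oper.subspace V"
  proof (rule oper.subspaceI)
    show "0 \<in> V"
      unfolding V_def by (auto simp: oper.scale_zero_left intro!: exI[of _ "\<lambda>_. 0"])
  next
    fix A B assume "A \<in> V" "B \<in> V"
    then obtain \<mu> \<nu> where "A = (\<Sum>k<n. oper_scale (\<mu> k) (e k))" "B = (\<Sum>k<n. oper_scale (\<nu> k) (e k))"
      unfolding V_def by auto
    then have "A + B = (\<Sum>k<n. oper_scale (\<mu> k + \<nu> k) (e k))"
      by (simp add: oper.scale_left_distrib sum.distrib)
    then show "A + B \<in> V"
      unfolding V_def by auto
  next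
    fix c A assume "A \<in> V"
    then obtain \<mu> where "A = (\<Sum>k<n. oper_scale (\<mu> k) (e k))"
      unfolding V_def by auto
    then have "oper_scale c A = (\<Sum>k<n. oper_scale (c * \<mu> k) (e k))"
      by (simp add: oper.scale_sum_right)
    then show "oper_scale c A \<in> V"
      unfolding V_def by auto
  qed
  moreover have "e k \<in> V" if "k < n" for k
  proof -
    have "(\<Sum>l<n. oper_scale (if l = k then 1 else 0) (e l)) = (\<Sum>l<n. if l = k then e l else 0)"
      by (intro sum.cong) (auto simp: oper.scale_zero_left)
    also have "\<dots> = e k"
      using that by simp
    finally have "e k = (\<Sum>l<n. oper_scale (if l = k then 1 else 0) (e l))"
      by (rule sym)
    then show ?thesis
      unfolding V_def by (intro CollectI exI[of _ "\<lambda>l. if l = k then 1 else 0"] conjI TrueI)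
  qed
  ultimately have "oper.span (e ` {..<n}) \<subseteq> V"
    by (intro oper.span_minimal) auto
  then show ?thesis
    using assms that unfolding V_def by blast
qed

lemma sum_rearrange:
  fixes f :: "'a \<Rightarrow> 'b \<Rightarrow> 'a \<Rightarrow> 'b \<Rightarrow> 'c \<Rightarrow> 'd \<Rightarrow> complex"
  shows "(\<Sum>a\<in>A. \<Sum>b\<in>B. \<Sum>a'\<in>A. \<Sum>b'\<in>B. \<Sum>c\<in>C. \<Sum>d\<in>D. f a b a' b' c d) =
    (\<Sum>c\<in>C. \<Sum>d\<in>D. \<Sum>b\<in>B. \<Sum>b'\<in>B. \<Sum>a\<in>A. \<Sum>a'\<in>A. f a b a' b' c d)"
  by (simp only: sum.swap[of _ C A] sum.swap[of _ C B] sum.swap[of _ D A] sum.swap[of _ D B]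
    sum.swap[of _ B A])

lemma sum_rearrange':
  fixes f :: "'a \<Rightarrow> 'b \<Rightarrow> 'a \<Rightarrow> 'b \<Rightarrow> 'c \<Rightarrow> 'c \<Rightarrow> complex"
  shows "(\<Sum>a\<in>A. \<Sum>b\<in>B. \<Sum>a'\<in>A. \<Sum>b'\<in>B. \<Sum>c\<in>C. \<Sum>d\<in>C. f a b a' b' c d) =
    (\<Sum>c\<in>C. \<Sum>d\<in>C. \<Sum>a\<in>A. \<Sum>b\<in>B. \<Sum>a'\<in>A. \<Sum>b'\<in>B. f a b a' b' c d)"
  by (simp only: sum.swap[of _ C A] sum.swap[of _ C B])

text \<open>A concrete copy of C^n: applying the expansion of the identity to the range of
  \<open>e k\<close> shows that its k-th coefficient is 1, so the projections sum to 1.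
  \<open>finite_rows\<close> is what makes \<open>e k\<close> commute with operators on a second
  tensor factor; it will hold because all summands of the universal representation of a finite group
  are finite-dimensional.\<close>

locale orthogonal_projections =
  fixes I :: "'i set" and e :: "nat \<Rightarrow> 'i oper" and n :: nat
  assumes bounded: "k < n \<Longrightarrow> e k \<in> bounded_ops I"
    and orthogonal: "k < n \<Longrightarrow> l < n \<Longrightarrow> f \<in> ell2 I \<Longrightarrow> e k (e l f) = (if k = l then e k f else 0)"
    and selfadjoint: "k < n \<Longrightarrow> f \<in> ell2 I \<Longrightarrow> g \<in> ell2 I \<Longrightarrow> ell2_inner f (e k g) = ell2_inner (e k f) (e k g)"
    and nonzero: "k < n \<Longrightarrow> \<exists>f\<in>ell2 I. e k f \<noteq> 0"
    and finite_rows: "k < n \<Longrightarrow> \<exists>F M. finite F \<and> (\<forall>f\<in>ell2 I. e k f i = (\<Sum>i'\<in>F. M i' * f i'))"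
    and id_in_span: "id_op I \<in> oper.span (e ` {..<n})"
begin

abbreviation "S \<equiv> oper.span (e ` {..<n})"

lemma S_bounded: "S \<subseteq> bounded_ops I"
  by (rule oper.span_minimal) (auto simp: bounded subspace_bounded_ops)

text \<open>The vector state at \<open>v\<close> is 1 on \<open>e k\<close> and 0 on the other
  projections. It reads off the k-th coefficient of an element of \<open>S\<close> and, paired with
  vectors of the other factor, the k-th component of a tensor.\<close>

lemma unit_eigenvector:
  assumes "k < n"
  obtains v where "v \<in> ell2 I" "\<And>l. l < n \<Longrightarrow> e l v = (if l = k then v else 0)" "ell2_inner v v = 1"
proof -
  obtain f where f: "f \<in> ell2 I" "e k f \<noteq> 0"
    using nonzero[OF assms] by blast
  have ef: "e k f \<in> ell2 I"
    using bounded[OF assms] f(1) by (rule bounded_ops_in)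
  define c where "c = complex_of_real (inverse (ell2_norm (e k f)))"
  have nz: "ell2_norm (e k f) \<noteq> 0"
    using f(2) ell2_norm_eq_0_iff[OF ef] by simp
  show ?thesis
  proof (rule that[of "vec_scale c (e k f)"])
    show "vec_scale c (e k f) \<in> ell2 I"
      using ef by (rule ell2_scale)
    show "e l (vec_scale c (e k f)) = (if l = k then vec_scale c (e k f) else 0)" if "l < n" for l
      using bounded_ops_scale[OF bounded[OF that] ef, of c] orthogonal[OF that assms f(1)]
      by (auto simp: vec_scale_def fun_eq_iff)
    have "ell2_inner (vec_scale c (e k f)) (vec_scale c (e k f))
        = c * (cnj c * complex_of_real ((ell2_norm (e k f))\<^sup>2))"
      by (simp only: ell2_inner_scale_left ell2_inner_scale_right) (simp only: ell2_inner_self)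
    also have "\<dots> = 1"
      using nz by (simp add: c_def power2_eq_square field_simps)
    finally show "ell2_inner (vec_scale c (e k f)) (vec_scale c (e k f)) = 1" .
  qed
qed

section \<open>From the minimal to the maximal cone\<close>

lemma alg_tensor_expansion:
  assumes "operator_system J T" "x \<in> alg_tensor I J S T"
  obtains y where "\<And>k. y k \<in> T" "x = (\<Sum>k<n. tensor_op I J (e k) (y k))"
proof -
  have T: "T \<subseteq> bounded_ops J" "oper.subspace T"
    using assms(1) by (auto simp: operator_system_def)
  define V where "V = {\<Sum>k<n. tensor_op I J (e k) (y k) | y. \<forall>k. y k \<in> T}"
  have "oper.subspace V"
  proof (rule oper.subspaceI)
    have "(\<Sum>k<n. tensor_op I J (e k) ((\<lambda>_. 0) k)) = 0"
      by (rule sum.neutral) (simp add: tensor_op_zero_right bounded)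
    then show "0 \<in> V"
      unfolding V_def using oper.subspace_0[OF T(2)] by (auto intro!: exI[of _ "\<lambda>_. 0"])
  next
    fix A B assume "A \<in> V" "B \<in> V"
    then obtain y z where y: "A = (\<Sum>k<n. tensor_op I J (e k) (y k))" "\<forall>k. y k \<in> T"
      and z: "B = (\<Sum>k<n. tensor_op I J (e k) (z k))" "\<forall>k. z k \<in> T"
      unfolding V_def by auto
    have "tensor_op I J (e k) (y k + z k) = tensor_op I J (e k) (y k) + tensor_op I J (e k) (z k)"
      if "k < n" for k
      by (rule tensor_op_add_right) (use that y(2) z(2) T(1) bounded in auto)
    then have "A + B = (\<Sum>k<n. tensor_op I J (e k) (y k + z k))"
      by (simp add: y z sum.distrib)
    then show "A + B \<in> V"
      unfolding V_def using y(2) z(2) oper.subspace_add[OF T(2)]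
      by (auto intro!: exI[of _ "\<lambda>k. y k + z k"])
  next
    fix c A assume "A \<in> V"
    then obtain y where y: "A = (\<Sum>k<n. tensor_op I J (e k) (y k))" "\<forall>k. y k \<in> T"
      unfolding V_def by auto
    have "tensor_op I J (e k) (oper_scale c (y k)) = oper_scale c (tensor_op I J (e k) (y k))"
      if "k < n" for k
      by (rule tensor_op_scale_right) (use that y(2) T(1) bounded in auto)
    then have "oper_scale c A = (\<Sum>k<n. tensor_op I J (e k) (oper_scale c (y k)))"
      by (simp add: y(1) oper.scale_sum_right)
    then show "oper_scale c A \<in> V"
      unfolding V_def using y(2) oper.subspace_scale[OF T(2)]
      by (auto intro!: exI[of _ "\<lambda>k. oper_scale c (y k)"])
  qed
  moreover have "tensor_op I J A B \<in> V" if "A \<in> S" "B \<in> T" for A B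
  proof -
    obtain \<mu> where \<mu>: "A = (\<Sum>k<n. oper_scale (\<mu> k) (e k))"
      using span_finite_family[OF \<open>A \<in> S\<close>] by blast
    have "tensor_op I J (\<Sum>k\<in>X. oper_scale (\<mu> k) (e k)) B = (\<Sum>k\<in>X. oper_scale (\<mu> k) (tensor_op I J (e k) B))"
      for X
      by (induction X rule: infinite_finite_induct)
        (simp_all only: sum.infinite sum.empty sum.insert tensor_op_zero_left tensor_op_add_left
          tensor_op_scale_left simp_thms)
    moreover have "tensor_op I J (e k) (oper_scale (\<mu> k) B) = oper_scale (\<mu> k) (tensor_op I J (e k) B)"
      if "k < n" for k
      by (rule tensor_op_scale_right) (use that \<open>B \<in> T\<close> T(1) bounded in auto)
    ultimately have "tensor_op I J A B = (\<Sum>k<n. tensor_op I J (e k) (oper_scale (\<mu> k) B))"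
      by (simp add: \<mu>)
    then show ?thesis
      unfolding V_def using \<open>B \<in> T\<close> oper.subspace_scale[OF T(2)]
      by (auto intro!: exI[of _ "\<lambda>k. oper_scale (\<mu> k) B"])
  qed
  then have "{tensor_op I J A B | A B. A \<in> S \<and> B \<in> T} \<subseteq> V"
    by blast
  ultimately have "alg_tensor I J S T \<subseteq> V"
    unfolding alg_tensor_def by (intro oper.span_minimal)
  then show ?thesis
    using assms(2) that unfolding V_def by blast
qed

text \<open>Testing \<open>x\<close> on vectors \<open>v \<otimes> \<eta>\<close>, with
  \<open>v\<close> a unit vector in the range of \<open>e k\<close>, shows that each component
  matrix \<open>y\<^sub>k\<close> is positive. The diagonal matrix of the \<open>e k\<close> and the
  block diagonal matrix of the \<open>y\<^sub>k\<close> then represent \<open>x\<close> exactly, so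
  no multiple of the unit has to be added.\<close>

lemma min_cone_subset_max_cone_pre:
  fixes J :: "'j set"
  assumes T: "operator_system J T" and x: "x \<in> min_cone I J S T m"
  shows "x \<in> max_cone_pre I J S T m"
proof -
  define y where "y i j = (SOME y. (\<forall>k. y k \<in> T) \<and> x i j = (\<Sum>k<n. tensor_op I J (e k) (y k)))" for i j
  have y_props: "(\<forall>k. y i j k \<in> T) \<and> x i j = (\<Sum>k<n. tensor_op I J (e k) (y i j k))" if "i < m" "j < m" for i j
  proof -
    have "x i j \<in> alg_tensor I J S T"
      using x that by (auto simp: min_cone_def matrix_cone_def matrices_over_def)
    then have "\<exists>y. (\<forall>k. y k \<in> T) \<and> x i j = (\<Sum>k<n. tensor_op I J (e k) (y k))"
      by (rule alg_tensor_expansion[OF T]) blast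
    then show ?thesis
      unfolding y_def by (rule someI_ex)
  qed
  have y: "y i j k \<in> T" "x i j = (\<Sum>k<n. tensor_op I J (e k) (y i j k))" if "i < m" "j < m" for i j k
    using y_props[OF that] by blast+
  have T': "T \<subseteq> bounded_ops J" "oper.subspace T"
    using T by (auto simp: operator_system_def)
  have y_pos: "(\<Sum>i<m. \<Sum>j<m. ell2_inner (\<eta> i) (y i j k (\<eta> j))) \<in> \<real>\<^sub>\<ge>\<^sub>0"
    if k: "k < n" and \<eta>: "\<And>i. i < m \<Longrightarrow> \<eta> i \<in> ell2 J" for k \<eta>
  proof -
    obtain v where v: "v \<in> ell2 I" "\<And>l. l < n \<Longrightarrow> e l v = (if l = k then v else 0)" "ell2_inner v v = 1"
      using unit_eigenvector[OF k] by metis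
    define \<xi> where "\<xi> i = (\<lambda>(a, b). v a * \<eta> i b)" for i
    have "ell2_inner (\<xi> i) (x i j (\<xi> j)) = ell2_inner (\<eta> i) (y i j k (\<eta> j))" if ij: "i < m" "j < m" for i j
    proof -
      have y_bdd: "y i j l \<in> bounded_ops J" for l
        using y(1)[OF ij] T'(1) by auto
      have "tensor_op I J (e l) (y i j l) (\<xi> j) = (if l = k then (\<lambda>(a, b). v a * y i j k (\<eta> j) b) else 0)"
        if "l < n" for l
        using tensor_op_product[OF bounded[OF that] y_bdd v(1) \<eta>[OF ij(2)], of l] v(2)[OF that]
        by (auto simp: \<xi>_def)
      then have "x i j (\<xi> j) = (\<Sum>l<n. if l = k then (\<lambda>(a, b). v a * y i j k (\<eta> j) b) else 0)"
        unfolding y(2)[OF ij] sum_fun_apply[where x = "\<xi> j"] by (intro sum.cong) auto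
      also have "\<dots> = (\<lambda>(a, b). v a * y i j k (\<eta> j) b)"
        using k by simp
      finally show ?thesis
        using ell2_inner_product[OF v(1) \<eta>[OF ij(1)] v(1) bounded_ops_in[OF y_bdd \<eta>[OF ij(2)]]] v(3)
        by (simp add: \<xi>_def)
    qed
    then have "(\<Sum>i<m. \<Sum>j<m. ell2_inner (\<xi> i) (x i j (\<xi> j))) = (\<Sum>i<m. \<Sum>j<m. ell2_inner (\<eta> i) (y i j k (\<eta> j)))"
      by simp
    moreover have "\<xi> i \<in> ell2 (I \<times> J)" if "i < m" for i
      unfolding \<xi>_def by (rule ell2_product[OF v(1) \<eta>[OF that]])
    then have "(\<Sum>i<m. \<Sum>j<m. ell2_inner (\<xi> i) (x i j (\<xi> j))) \<in> \<real>\<^sub>\<ge>\<^sub>0"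
      using x unfolding min_cone_def matrix_cone_def by blast
    ultimately show ?thesis
      by simp
  qed
  text \<open>\<open>Q\<close> is block diagonal with the blocks \<open>y\<^sub>k\<close>; position \<open>i\<close> of block \<open>k\<close> has index \<open>k * m + i\<close>.\<close>
  define P where "P a a' = (if a = a' then e a else 0)" for a a'
  define Q where "Q b b' = (if b div m = b' div m then y (b mod m) (b' mod m) (b div m) else 0)" for b b'
  \<comment> \<open>Pairs the a-th diagonal entry of \<open>P\<close> with position \<open>i\<close>
    in the a-th block of \<open>Q\<close>; mixed terms with different \<open>a\<close> and
    \<open>a'\<close> vanish because \<open>P\<close> is diagonal.\<close>
  define \<alpha> where "\<alpha> i = (\<lambda>(a, b). if b = a * m + i then 1 else 0 :: complex)" for i
  have P_in: "P \<in> matrix_cone I S n"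
    unfolding matrix_cone_def matrices_over_def
  proof (intro CollectI conjI allI impI)
    show "P a a' \<in> S" if "a < n" "a' < n" for a a'
      using that by (auto simp: P_def intro: oper.span_base oper.span_zero)
    fix \<xi> assume \<xi>: "\<forall>i<n. \<xi> i \<in> ell2 I"
    have "(\<Sum>a<n. \<Sum>a'<n. ell2_inner (\<xi> a) (P a a' (\<xi> a'))) = (\<Sum>a<n. ell2_inner (\<xi> a) (e a (\<xi> a)))"
    proof (intro sum.cong refl)
      fix a assume "a \<in> {..<n}"
      have "(\<Sum>a'<n. ell2_inner (\<xi> a) (P a a' (\<xi> a'))) = (\<Sum>a'<n. if a' = a then ell2_inner (\<xi> a) (e a (\<xi> a)) else 0)"
        by (intro sum.cong) (auto simp: P_def)
      then show "(\<Sum>a'<n. ell2_inner (\<xi> a) (P a a' (\<xi> a'))) = ell2_inner (\<xi> a) (e a (\<xi> a))"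
        using \<open>a \<in> {..<n}\<close> by simp
    qed
    also have "\<dots> \<in> \<real>\<^sub>\<ge>\<^sub>0"
      using \<xi> by (intro sum_nonneg_Reals) (simp add: selfadjoint ell2_inner_self del: of_real_power)
    finally show "(\<Sum>a<n. \<Sum>a'<n. ell2_inner (\<xi> a) (P a a' (\<xi> a'))) \<in> \<real>\<^sub>\<ge>\<^sub>0" .
  qed
  have block_sum: "(\<Sum>b<n*m. f b) = (\<Sum>k<n. \<Sum>i<m. f (k * m + i))" for f :: "nat \<Rightarrow> complex"
    by (simp add: sum.nat_group[symmetric] sum.atLeastLessThan_shift_0[of _ "_ * m"] atLeast0LessThan comp_def)
  have Q_in: "Q \<in> matrix_cone J T (n * m)"
    unfolding matrix_cone_def matrices_over_def
  proof (intro CollectI conjI allI impI)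
    have "b mod m < m" if "b < n * m" for b
      using that by (cases "m = 0") auto
    then show "Q b b' \<in> T" if "b < n * m" "b' < n * m" for b b'
      using that by (auto simp: Q_def y(1) oper.subspace_0[OF T'(2)])
    fix \<xi> assume \<xi>: "\<forall>i<n * m. \<xi> i \<in> ell2 J"
    have "(\<Sum>b<n*m. \<Sum>b'<n*m. ell2_inner (\<xi> b) (Q b b' (\<xi> b'))) =
        (\<Sum>k<n. \<Sum>i<m. \<Sum>k'<n. \<Sum>j<m. ell2_inner (\<xi> (k * m + i)) (Q (k * m + i) (k' * m + j) (\<xi> (k' * m + j))))"
      unfolding block_sum ..
    also have "\<dots> = (\<Sum>k<n. \<Sum>i<m. \<Sum>k'<n. if k' = k then (\<Sum>j<m. ell2_inner (\<xi> (k * m + i)) (y i j k (\<xi> (k * m + j)))) else 0)"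
      by (intro sum.cong refl) (auto simp: Q_def intro!: sum.neutral)
    also have "\<dots> = (\<Sum>k<n. \<Sum>i<m. \<Sum>j<m. ell2_inner (\<xi> (k * m + i)) (y i j k (\<xi> (k * m + j))))"
      by simp
    also have "\<dots> \<in> \<real>\<^sub>\<ge>\<^sub>0"
    proof (rule sum_nonneg_Reals)
      fix k assume "k \<in> {..<n}"
      moreover have "k * m + i < n * m" if "i < m" for i
        using mult_le_mono1[of "Suc k" n m] \<open>k \<in> {..<n}\<close> that by auto
      ultimately show "(\<Sum>i<m. \<Sum>j<m. ell2_inner (\<xi> (k * m + i)) (y i j k (\<xi> (k * m + j)))) \<in> \<real>\<^sub>\<ge>\<^sub>0"
        using \<xi> y_pos[of k "\<lambda>i. \<xi> (k * m + i)"] by auto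
    qed
    finally show "(\<Sum>b<n*m. \<Sum>b'<n*m. ell2_inner (\<xi> b) (Q b b' (\<xi> b'))) \<in> \<real>\<^sub>\<ge>\<^sub>0" .
  qed
  have "x i j = (\<Sum>(a, b)\<in>{..<n} \<times> {..<n * m}. \<Sum>(a', b')\<in>{..<n} \<times> {..<n * m}.
      oper_scale (\<alpha> i (a, b) * cnj (\<alpha> j (a', b'))) (tensor_op I J (P a a') (Q b b')))"
    if ij: "i < m" "j < m" for i j
  proof -
    have range: "k * m + i < n * m" if "k < n" "i < m" for k i
      using mult_le_mono1[of "Suc k" n m] that by auto
    have select: "(\<Sum>(a, b)\<in>{..<n} \<times> {..<n * m}. if b = a * m + i then g a b else 0) = (\<Sum>a<n. g a (a * m + i))"
      if "i < m" for i and g :: "nat \<Rightarrow> nat \<Rightarrow> ('i \<times> 'j) oper"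
      unfolding sum.cartesian_product' using range that by (intro sum.cong refl) simp
    have "(\<Sum>(a, b)\<in>{..<n} \<times> {..<n * m}. \<Sum>(a', b')\<in>{..<n} \<times> {..<n * m}.
        oper_scale (\<alpha> i (a, b) * cnj (\<alpha> j (a', b'))) (tensor_op I J (P a a') (Q b b'))) =
      (\<Sum>(a, b)\<in>{..<n} \<times> {..<n * m}. if b = a * m + i then
        (\<Sum>(a', b')\<in>{..<n} \<times> {..<n * m}. if b' = a' * m + j then tensor_op I J (P a a') (Q b b') else 0) else 0)"
      by (intro sum.cong refl) (auto simp: \<alpha>_def oper.scale_zero_left intro!: sum.cong sum.neutral)
    also have "\<dots> = (\<Sum>a<n. \<Sum>a'<n. tensor_op I J (P a a') (Q (a * m + i) (a' * m + j)))"
      unfolding select[OF ij(1)] select[OF ij(2)] ..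
    also have "\<dots> = (\<Sum>a<n. \<Sum>a'<n. if a' = a then tensor_op I J (e a) (y i j a) else 0)"
      using ij by (intro sum.cong refl) (auto simp: P_def Q_def)
    also have "\<dots> = x i j"
      unfolding y(2)[OF ij] by simp
    finally show ?thesis
      by (rule sym)
  qed
  then show ?thesis
    unfolding max_cone_pre_def using P_in Q_in by blast
qed


section \<open>From the maximal to the minimal cone\<close>

text \<open>Since every row of \<open>e\<^sub>k\<close> is finite, \<open>e\<^sub>k \<otimes> 1\<close> commutes with \<open>1 \<otimes> B\<close> by linearity alone.\<close>

lemma tensor_op_factor:
  assumes k: "k < n" and B: "B \<in> bounded_ops J" and h: "h \<in> ell2 (I \<times> J)"
  shows "tensor_op I J (e k) B h = tensor_op I J (e k) (id_op J) (tensor_op I J (id_op I) B h)"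
    and "tensor_op I J (e k) B h = tensor_op I J (id_op I) B (tensor_op I J (e k) (id_op J) h)"
proof -
  have id_B: "tensor_op I J (id_op I) B h = (\<lambda>(i, j). B (\<lambda>j'. h (i, j')) j)"
    using h apply_rowwise_column_in_ell2[OF B h] by (auto simp: tensor_op_def id_op_def)
  have e_id: "tensor_op I J (e k) (id_op J) h = (\<lambda>(i, j). e k (\<lambda>i'. h (i', j)) i)" if "h \<in> ell2 (I \<times> J)" for h
    using that ell2_slice_times[OF that] by (auto simp: tensor_op_def id_op_def)
  have e_B: "tensor_op I J (e k) B h = (\<lambda>(i, j). e k (\<lambda>i'. B (\<lambda>j'. h (i', j')) j) i)"
    using h by (simp add: tensor_op_def)
  have in_ell2: "tensor_op I J (id_op I) B h \<in> ell2 (I \<times> J)" "tensor_op I J (e k) (id_op J) h \<in> ell2 (I \<times> J)"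
    by (rule tensor_op_in_ell2[OF _ _ h]; simp add: id_op_in_bounded_ops B bounded k)+
  show "tensor_op I J (e k) B h = tensor_op I J (e k) (id_op J) (tensor_op I J (id_op I) B h)"
    unfolding e_id[OF in_ell2(1)] unfolding e_B id_B by simp
  have "e k (\<lambda>i'. B (\<lambda>j'. h (i', j')) j) i = B (\<lambda>j'. e k (\<lambda>i'. h (i', j')) i) j" for i j
  proof -
    obtain F M where F: "\<And>f. f \<in> ell2 I \<Longrightarrow> e k f i = (\<Sum>i'\<in>F. M i' * f i')"
      using finite_rows[OF k, of i] by blast
    have "e k (\<lambda>i'. B (\<lambda>j'. h (i', j')) j) i = (\<Sum>i'\<in>F. M i' * B (\<lambda>j'. h (i', j')) j)"
      by (rule F[OF apply_rowwise_column_in_ell2[OF B h]])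
    also have "\<dots> = (\<Sum>i'\<in>F. B (vec_scale (M i') (\<lambda>j'. h (i', j')))) j"
      by (simp add: sum_fun_apply bounded_ops_scale[OF B ell2_slice_times[OF h]])
    also have "(\<Sum>i'\<in>F. B (vec_scale (M i') (\<lambda>j'. h (i', j')))) = B (\<Sum>i'\<in>F. vec_scale (M i') (\<lambda>j'. h (i', j')))"
      by (rule bounded_ops_sum[OF B, symmetric]) (intro ell2_scale ell2_slice_times[OF h])
    also have "(\<Sum>i'\<in>F. vec_scale (M i') (\<lambda>j'. h (i', j'))) = (\<lambda>j'. e k (\<lambda>i'. h (i', j')) i)"
      by (simp add: fun_eq_iff sum_fun_apply F[OF ell2_column[OF h]])
    finally show ?thesis .
  qed
  moreover have "tensor_op I J (id_op I) B (tensor_op I J (e k) (id_op J) h)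
      = (\<lambda>(i, j). B (\<lambda>j'. e k (\<lambda>i'. h (i', j')) i) j)"
  proof -
    have "tensor_op I J (id_op I) B g = (\<lambda>(i, j). B (\<lambda>j'. g (i, j')) j)" if "g \<in> ell2 (I \<times> J)" for g
      using that apply_rowwise_column_in_ell2[OF B that] by (auto simp: tensor_op_def id_op_def)
    from this[OF in_ell2(2)] show ?thesis
      unfolding e_id[OF h] by simp
  qed
  ultimately show "tensor_op I J (e k) B h = tensor_op I J (id_op I) B (tensor_op I J (e k) (id_op J) h)"
    by (simp add: e_B)
qed

text \<open>The operator acts on each column by \<open>e k\<close>, so the identity in the locale,
  which joins selfadjointness and idempotence, is summed over the columns.\<close>

lemma projection_tensor_selfadjoint:
  assumes k: "k < n" and h: "h \<in> ell2 (I \<times> J)" "g \<in> ell2 (I \<times> J)"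
  shows "ell2_inner h (tensor_op I J (e k) (id_op J) g)
    = ell2_inner (tensor_op I J (e k) (id_op J) h) (tensor_op I J (e k) (id_op J) g)"
proof -
  have E: "(\<lambda>i. tensor_op I J (e k) (id_op J) g (i, j)) = e k (\<lambda>i. g (i, j))" if "g \<in> ell2 (I \<times> J)" for g j
    using that ell2_slice_times[OF that] by (simp add: tensor_op_def id_op_def)
  have in_ell2: "tensor_op I J (e k) (id_op J) g \<in> ell2 (I \<times> J)" if "g \<in> ell2 (I \<times> J)" for g
    by (rule tensor_op_in_ell2[OF bounded[OF k] id_op_in_bounded_ops that])
  have columns: "((\<lambda>j. ell2_inner (\<lambda>i. h (i, j)) (\<lambda>i. g (i, j))) has_sum ell2_inner h g) UNIV"
    if "h \<in> ell2 (I \<times> J)" "g \<in> ell2 (I \<times> J)" for h g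
    using ell2_inner_slices[OF ell2_swap[OF that(1)] ell2_swap[OF that(2)]] by (simp add: ell2_inner_swap)
  have "ell2_inner (\<lambda>i. h (i, j)) (e k (\<lambda>i. g (i, j))) = ell2_inner (e k (\<lambda>i. h (i, j))) (e k (\<lambda>i. g (i, j)))" for j
    by (rule selfadjoint[OF k ell2_column[OF h(1)] ell2_column[OF h(2)]])
  then show ?thesis
    using columns[OF h(1) in_ell2[OF h(2)]] columns[OF in_ell2[OF h(1)] in_ell2[OF h(2)]] has_sum_unique
    unfolding E[OF h(1)] E[OF h(2)] by fastforce
qed

text \<open>Replacing \<open>h\<close> by its image \<open>g\<close> under
  \<open>e k \<otimes> 1\<close> turns the form of \<open>e k \<otimes> Q\<close> into that of
  \<open>1 \<otimes> Q\<close>, which is a sum over the rows of values of the positive form of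
  \<open>Q\<close>.\<close>

lemma projection_tensor_positive:
  assumes T: "operator_system J T" and k: "k < n" and Q: "Q \<in> matrix_cone J T m"
    and h: "\<And>b. b < m \<Longrightarrow> h b \<in> ell2 (I \<times> J)"
  shows "(\<Sum>b<m. \<Sum>b'<m. ell2_inner (h b) (tensor_op I J (e k) (Q b b') (h b'))) \<in> \<real>\<^sub>\<ge>\<^sub>0"
proof -
  have Q_bdd: "Q b b' \<in> bounded_ops J" if "b < m" "b' < m" for b b'
    using Q T that by (auto simp: matrix_cone_def matrices_over_def operator_system_def)
  have Q_pos: "(\<Sum>b<m. \<Sum>b'<m. ell2_inner (\<xi> b) (Q b b' (\<xi> b'))) \<in> \<real>\<^sub>\<ge>\<^sub>0" if "\<forall>b<m. \<xi> b \<in> ell2 J" for \<xi>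
    using Q that by (simp add: matrix_cone_def)
  define g where "g b = tensor_op I J (e k) (id_op J) (h b)" for b
  have g: "g b \<in> ell2 (I \<times> J)" if "b < m" for b
    unfolding g_def by (rule tensor_op_in_ell2[OF bounded[OF k] id_op_in_bounded_ops h[OF that]])
  have row: "(\<lambda>j. tensor_op I J (id_op I) (Q b b') (g b') (i, j)) = Q b b' (\<lambda>j. g b' (i, j))"
    if "b < m" "b' < m" for b b' i
    using g[OF that(2)] apply_rowwise_column_in_ell2[OF Q_bdd[OF that] g[OF that(2)]]
    by (simp add: tensor_op_def id_op_def)
  have "ell2_inner (h b) (tensor_op I J (e k) (Q b b') (h b')) = ell2_inner (g b) (tensor_op I J (id_op I) (Q b b') (g b'))"
    if b: "b < m" "b' < m" for b b'
  proof -
    have "tensor_op I J (id_op I) (Q b b') (h b') \<in> ell2 (I \<times> J)"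
      by (rule tensor_op_in_ell2[OF id_op_in_bounded_ops Q_bdd[OF b] h[OF b(2)]])
    then have "ell2_inner (h b) (tensor_op I J (e k) (Q b b') (h b')) = ell2_inner (g b) (tensor_op I J (e k) (Q b b') (h b'))"
      unfolding tensor_op_factor(1)[OF k Q_bdd[OF b] h[OF b(2)]] g_def
      by (intro projection_tensor_selfadjoint[OF k h[OF b(1)]])
    then show ?thesis
      unfolding tensor_op_factor(2)[OF k Q_bdd[OF b] h[OF b(2)]] g_def .
  qed
  then have "(\<Sum>b<m. \<Sum>b'<m. ell2_inner (h b) (tensor_op I J (e k) (Q b b') (h b'))) =
      (\<Sum>b<m. \<Sum>b'<m. ell2_inner (g b) (tensor_op I J (id_op I) (Q b b') (g b')))"
    by simp
  moreover have hs: "((\<lambda>i. \<Sum>b<m. \<Sum>b'<m. ell2_inner (\<lambda>j. g b (i, j)) (Q b b' (\<lambda>j. g b' (i, j)))) has_sum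
      (\<Sum>b<m. \<Sum>b'<m. ell2_inner (g b) (tensor_op I J (id_op I) (Q b b') (g b')))) UNIV"
  proof (intro has_sum_sum)
    fix b b' assume "b \<in> {..<m}" "b' \<in> {..<m}"
    then have b: "b < m" "b' < m"
      by auto
    show "((\<lambda>i. ell2_inner (\<lambda>j. g b (i, j)) (Q b b' (\<lambda>j. g b' (i, j)))) has_sum
        ell2_inner (g b) (tensor_op I J (id_op I) (Q b b') (g b'))) UNIV"
      using ell2_inner_slices[OF g[OF b(1)] tensor_op_in_ell2[OF id_op_in_bounded_ops Q_bdd[OF b] g[OF b(2)]]]
      unfolding row[OF b] .
  qed
  moreover have "(\<Sum>b<m. \<Sum>b'<m. ell2_inner (\<lambda>j. g b (i, j)) (Q b b' (\<lambda>j. g b' (i, j)))) \<in> \<real>\<^sub>\<ge>\<^sub>0" for i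
  proof -
    have "\<forall>b<m. (\<lambda>j. g b (i, j)) \<in> ell2 J"
      using ell2_slice_times[OF g] by blast
    then show ?thesis
      by (rule Q_pos)
  qed
  ultimately show ?thesis
    using has_sum_nonneg_Reals[OF hs] by simp
qed

text \<open>On multiples of a unit vector in the range of \<open>e k\<close>, the form of
  \<open>P\<close> is the scalar form of its k-th coefficient matrix.\<close>

lemma coefficients_psd:
  assumes P: "P \<in> matrix_cone I S l" and \<mu>: "\<And>a a'. a < l \<Longrightarrow> a' < l \<Longrightarrow> P a a' = (\<Sum>k<n. oper_scale (\<mu> a a' k) (e k))"
    and k: "k < n"
  shows "psd {..<l} (\<lambda>a a'. \<mu> a a' k)"
  unfolding psd_def
proof
  fix z :: "nat \<Rightarrow> complex"
  obtain v where v: "v \<in> ell2 I" "\<And>l. l < n \<Longrightarrow> e l v = (if l = k then v else 0)" "ell2_inner v v = 1"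
    using unit_eigenvector[OF k] by metis
  have "ell2_inner (vec_scale (z a) v) (P a a' (vec_scale (z a') v)) = cnj (z a) * \<mu> a a' k * z a'"
    if a: "a < l" "a' < l" for a a'
  proof -
    have "P a a' v = (\<Sum>l<n. if l = k then vec_scale (\<mu> a a' k) v else 0)"
      unfolding \<mu>[OF a] sum_fun_apply[where x = v] using v(2)
      by (intro sum.cong) (auto simp: oper_scale_def vec_scale_def fun_eq_iff)
    also have "\<dots> = vec_scale (\<mu> a a' k) v"
      using k by simp
    finally have Pv: "P a a' v = vec_scale (\<mu> a a' k) v" .
    have "P a a' \<in> bounded_ops I"
      using P S_bounded a by (auto simp: matrix_cone_def matrices_over_def)
    then have "P a a' (vec_scale (z a') v) = vec_scale (z a') (vec_scale (\<mu> a a' k) v)"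
      using v(1) by (simp only: bounded_ops_scale Pv)
    then show ?thesis
      by (simp only: ell2_inner_scale_left ell2_inner_scale_right v(3)) simp
  qed
  moreover have "(\<Sum>a<l. \<Sum>a'<l. ell2_inner (vec_scale (z a) v) (P a a' (vec_scale (z a') v))) \<in> \<real>\<^sub>\<ge>\<^sub>0"
    using P ell2_scale[OF v(1)] unfolding matrix_cone_def by auto
  ultimately show "(\<Sum>a<l. \<Sum>a'<l. cnj (z a) * \<mu> a a' k * z a') \<in> \<real>\<^sub>\<ge>\<^sub>0"
    by simp
qed

text \<open>Each coefficient matrix of \<open>P\<close> is a Gram matrix. Its vectors are absorbed
  into the \<open>h a b\<close>, which reduces the form of \<open>P \<otimes> Q\<close> to a sum of
  forms of \<open>e k \<otimes> Q\<close>.\<close>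

lemma tensor_matrix_positive:
  assumes T: "operator_system J T" and P: "P \<in> matrix_cone I S l" and Q: "Q \<in> matrix_cone J T m"
    and h: "\<And>a b. a < l \<Longrightarrow> b < m \<Longrightarrow> h a b \<in> ell2 (I \<times> J)"
  shows "(\<Sum>a<l. \<Sum>b<m. \<Sum>a'<l. \<Sum>b'<m. ell2_inner (h a b) (tensor_op I J (P a a') (Q b b') (h a' b'))) \<in> \<real>\<^sub>\<ge>\<^sub>0"
proof -
  define \<mu> where "\<mu> a a' = (SOME \<mu>. P a a' = (\<Sum>k<n. oper_scale (\<mu> k) (e k)))" for a a'
  have \<mu>: "P a a' = (\<Sum>k<n. oper_scale (\<mu> a a' k) (e k))" if "a < l" "a' < l" for a a'
  proof -
    have "P a a' \<in> S"
      using P that by (auto simp: matrix_cone_def matrices_over_def)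
    then have "\<exists>\<mu>. P a a' = (\<Sum>k<n. oper_scale (\<mu> k) (e k))"
      by (rule span_finite_family) blast
    then show ?thesis
      unfolding \<mu>_def by (rule someI_ex)
  qed
  define w where "w k = (SOME w. \<forall>a\<in>{..<l}. \<forall>a'\<in>{..<l}. \<mu> a a' k = (\<Sum>c<l. w c a * cnj (w c a')))" for k
  have w: "\<mu> a a' k = (\<Sum>c<l. w k c a * cnj (w k c a'))" if "k < n" "a < l" "a' < l" for k a a'
  proof -
    have "\<exists>w. \<forall>a\<in>{..<l}. \<forall>a'\<in>{..<l}. \<mu> a a' k = (\<Sum>c<l. w c a * cnj (w c a'))"
      by (rule psd_gram[OF finite_lessThan coefficients_psd[OF P \<mu> that(1)]])
    then have "\<forall>a\<in>{..<l}. \<forall>a'\<in>{..<l}. \<mu> a a' k = (\<Sum>c<l. w k c a * cnj (w k c a'))"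
      unfolding w_def by (rule someI_ex)
    then show ?thesis
      using that by blast
  qed
  have Q_bdd: "Q b b' \<in> bounded_ops J" if "b < m" "b' < m" for b b'
    using Q T that by (auto simp: matrix_cone_def matrices_over_def operator_system_def)
  define g where "g k c b = (\<Sum>a<l. vec_scale (cnj (w k c a)) (h a b))" for k c b
  have g: "g k c b \<in> ell2 (I \<times> J)" if "b < m" for k c b
    unfolding g_def using h that by (intro ell2_sum ell2_scale) auto
  let ?t = "\<lambda>k a b a' b'. ell2_inner (h a b) (tensor_op I J (e k) (Q b b') (h a' b'))"
  have th: "tensor_op I J (e k) (Q b b') (h a' b') \<in> ell2 (I \<times> J)"
    if "k < n" "b < m" "b' < m" "a' < l" for k b b' a'
    by (rule tensor_op_in_ell2[OF bounded[OF that(1)] Q_bdd[OF that(2,3)] h[OF that(4,3)]])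
  have expand: "ell2_inner (g k c b) (tensor_op I J (e k) (Q b b') (g k c b')) =
      (\<Sum>a<l. \<Sum>a'<l. w k c a * cnj (w k c a') * ?t k a b a' b')"
    if k: "k < n" and b: "b < m" "b' < m" for k c b b'
  proof -
    have te: "tensor_op I J (e k) (Q b b') (g k c b') = (\<Sum>a'<l. vec_scale (cnj (w k c a')) (tensor_op I J (e k) (Q b b') (h a' b')))"
      unfolding g_def by (rule tensor_op_sum[OF bounded[OF k] Q_bdd[OF b]]) (use h b in auto)
    have "ell2_inner (g k c b) (tensor_op I J (e k) (Q b b') (g k c b')) =
        (\<Sum>a'<l. cnj (w k c a') * ell2_inner (g k c b) (tensor_op I J (e k) (Q b b') (h a' b')))"
      unfolding te
      by (subst ell2_inner_sum_right[OF g[OF b(1)]]) (auto intro!: ell2_scale th[OF k b] simp: ell2_inner_scale_right)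
    also have "\<dots> = (\<Sum>a'<l. cnj (w k c a') * (\<Sum>a<l. w k c a * ?t k a b a' b'))"
    proof (intro sum.cong refl arg_cong2[where f = times])
      fix a' assume "a' \<in> {..<l}"
      then show "ell2_inner (g k c b) (tensor_op I J (e k) (Q b b') (h a' b')) = (\<Sum>a<l. w k c a * ?t k a b a' b')"
        unfolding g_def using th[OF k b] h b
        by (subst ell2_inner_sum_left[of _ "I \<times> J"]) (auto intro: ell2_scale simp: ell2_inner_scale_left)
    qed
    also have "\<dots> = (\<Sum>a<l. \<Sum>a'<l. w k c a * cnj (w k c a') * ?t k a b a' b')"
      unfolding sum_distrib_left by (subst sum.swap) (simp add: mult_ac)
    finally show ?thesis .
  qed
  have "ell2_inner (h a b) (tensor_op I J (P a a') (Q b b') (h a' b')) =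
      (\<Sum>k<n. \<Sum>c<l. w k c a * cnj (w k c a') * ?t k a b a' b')"
    if a: "a < l" "a' < l" and b: "b < m" "b' < m" for a b a' b'
  proof -
    have "tensor_op I J (\<Sum>k\<in>X. oper_scale (\<mu> a a' k) (e k)) (Q b b')
        = (\<Sum>k\<in>X. oper_scale (\<mu> a a' k) (tensor_op I J (e k) (Q b b')))" for X
      by (induction X rule: infinite_finite_induct)
        (simp_all only: sum.infinite sum.empty sum.insert tensor_op_zero_left tensor_op_add_left
          tensor_op_scale_left simp_thms)
    then have te: "tensor_op I J (P a a') (Q b b') (h a' b')
        = (\<Sum>k<n. vec_scale (\<mu> a a' k) (tensor_op I J (e k) (Q b b') (h a' b')))"
      unfolding \<mu>[OF a] by (simp add: sum_fun_apply[where x = "h a' b'"] oper_scale_def)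
    have "ell2_inner (h a b) (tensor_op I J (P a a') (Q b b') (h a' b')) = (\<Sum>k<n. \<mu> a a' k * ?t k a b a' b')"
      unfolding te
      by (subst ell2_inner_sum_right[OF h[OF a(1) b(1)]])
        (auto intro!: ell2_scale th[OF _ b a(2)] simp: ell2_inner_scale_right)
    also have "\<dots> = (\<Sum>k<n. \<Sum>c<l. w k c a * cnj (w k c a') * ?t k a b a' b')"
      using w a by (simp add: sum_distrib_right)
    finally show ?thesis .
  qed
  then have "(\<Sum>a<l. \<Sum>b<m. \<Sum>a'<l. \<Sum>b'<m. ell2_inner (h a b) (tensor_op I J (P a a') (Q b b') (h a' b'))) =
      (\<Sum>a<l. \<Sum>b<m. \<Sum>a'<l. \<Sum>b'<m. \<Sum>k<n. \<Sum>c<l. w k c a * cnj (w k c a') * ?t k a b a' b')"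
    by simp
  also have "\<dots> = (\<Sum>k<n. \<Sum>c<l. \<Sum>b<m. \<Sum>b'<m. \<Sum>a<l. \<Sum>a'<l. w k c a * cnj (w k c a') * ?t k a b a' b')"
    by (rule sum_rearrange)
  also have "\<dots> = (\<Sum>k<n. \<Sum>c<l. \<Sum>b<m. \<Sum>b'<m. ell2_inner (g k c b) (tensor_op I J (e k) (Q b b') (g k c b')))"
    using expand by simp
  also have "\<dots> \<in> \<real>\<^sub>\<ge>\<^sub>0"
    using g by (intro sum_nonneg_Reals[where A = "{..<n}"] sum_nonneg_Reals[where A = "{..<l}"]
      projection_tensor_positive[OF T _ Q]) auto
  finally show ?thesis .
qed

lemma alg_tensor_in_ell2:
  assumes T: "operator_system J T" and x: "x \<in> alg_tensor I J S T" and h: "h \<in> ell2 (I \<times> J)"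
  shows "x h \<in> ell2 (I \<times> J)"
proof -
  have "\<exists>y. (\<forall>k. y k \<in> T) \<and> x = (\<Sum>k<n. tensor_op I J (e k) (y k))"
    by (rule alg_tensor_expansion[OF T x]) blast
  then obtain y where y: "\<And>k. y k \<in> T" "x = (\<Sum>k<n. tensor_op I J (e k) (y k))"
    by blast
  have "tensor_op I J (e k) (y k) h \<in> ell2 (I \<times> J)" if "k < n" for k
    by (rule tensor_op_in_ell2[OF bounded[OF that] _ h]) (use y(1) T in \<open>auto simp: operator_system_def\<close>)
  then show ?thesis
    unfolding y(2) sum_fun_apply[where x = h] by (intro ell2_sum) auto
qed

text \<open>Moving \<open>\<alpha>\<close> onto the vectors reduces to positivity of
  \<open>P \<otimes> Q\<close>. This gives the form of \<open>x\<close> plus \<open>r\<close> times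
  the total squared norm \<open>N\<close>, and \<open>r\<close> tends to 0.\<close>

lemma max_cone_subset_min_cone:
  assumes T: "operator_system J T" and x: "x \<in> max_cone I J S T m"
  shows "x \<in> min_cone I J S T m"
proof -
  have "(\<Sum>i<m. \<Sum>j<m. ell2_inner (\<xi> i) (x i j (\<xi> j))) \<in> \<real>\<^sub>\<ge>\<^sub>0"
    if \<xi>: "\<And>i. i < m \<Longrightarrow> \<xi> i \<in> ell2 (I \<times> J)" for \<xi>
  proof -
    define s where "s = (\<Sum>i<m. \<Sum>j<m. ell2_inner (\<xi> i) (x i j (\<xi> j)))"
    define N where "N = (\<Sum>i<m. (ell2_norm (\<xi> i))\<^sup>2)"
    have x_bdd: "x i j (\<xi> j) \<in> ell2 (I \<times> J)" if "i < m" "j < m" for i j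
      by (rule alg_tensor_in_ell2[OF T _ \<xi>[OF that(2)]])
        (use x that in \<open>auto simp: max_cone_def matrices_over_def\<close>)
    have pos: "s + complex_of_real (r * N) \<in> \<real>\<^sub>\<ge>\<^sub>0" if r: "r > 0" for r
    proof -
      define x' where "x' = (\<lambda>i j. (if i = j then oper_scale (complex_of_real r) (tensor_op I J (id_op I) (id_op J))
             else 0) + x i j)"
      have "x' \<in> max_cone_pre I J S T m"
        using x r by (simp add: x'_def max_cone_def)
      then obtain k l P Q \<alpha> where P: "P \<in> matrix_cone I S k" and Q: "Q \<in> matrix_cone J T l"
        and x'_eq: "\<And>i j. i < m \<Longrightarrow> j < m \<Longrightarrow> x' i j = (\<Sum>(a, b)\<in>{..<k} \<times> {..<l}. \<Sum>(a', b')\<in>{..<k} \<times> {..<l}.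
          oper_scale (\<alpha> i (a, b) * cnj (\<alpha> j (a', b'))) (tensor_op I J (P a a') (Q b b')))"
        unfolding max_cone_pre_def by blast
      have PQ: "P a a' \<in> bounded_ops I" "Q b b' \<in> bounded_ops J" if "a < k" "a' < k" "b < l" "b' < l" for a a' b b'
        using P Q T S_bounded that by (auto simp: matrix_cone_def matrices_over_def operator_system_def)
      define h where "h a b = (\<Sum>i<m. vec_scale (cnj (\<alpha> i (a, b))) (\<xi> i))" for a b
      have h: "h a b \<in> ell2 (I \<times> J)" for a b
        unfolding h_def using \<xi> by (intro ell2_sum ell2_scale) auto
      let ?t = "\<lambda>a b a' b' i j. ell2_inner (\<xi> i) (tensor_op I J (P a a') (Q b b') (\<xi> j))"
      have in_ell2: "tensor_op I J (P a a') (Q b b') (\<xi> j) \<in> ell2 (I \<times> J)"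
        if "a < k" "a' < k" "b < l" "b' < l" "j < m" for a a' b b' j
        by (rule tensor_op_in_ell2[OF PQ[OF that(1-4)] \<xi>[OF that(5)]])
      have "ell2_inner (h a b) (tensor_op I J (P a a') (Q b b') (h a' b')) =
          (\<Sum>i<m. \<Sum>j<m. \<alpha> i (a, b) * cnj (\<alpha> j (a', b')) * ?t a b a' b' i j)"
        if ab: "a < k" "a' < k" "b < l" "b' < l" for a a' b b'
      proof -
        have te: "tensor_op I J (P a a') (Q b b') (h a' b') = (\<Sum>j<m. vec_scale (cnj (\<alpha> j (a', b'))) (tensor_op I J (P a a') (Q b b') (\<xi> j)))"
          unfolding h_def by (rule tensor_op_sum[OF PQ[OF ab]]) (use \<xi> in auto)
        have "ell2_inner (h a b) (tensor_op I J (P a a') (Q b b') (h a' b')) =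
            (\<Sum>j<m. cnj (\<alpha> j (a', b')) * ell2_inner (h a b) (tensor_op I J (P a a') (Q b b') (\<xi> j)))"
          unfolding te
          by (subst ell2_inner_sum_right[OF h]) (auto intro!: ell2_scale in_ell2[OF ab] simp: ell2_inner_scale_right)
        also have "\<dots> = (\<Sum>j<m. cnj (\<alpha> j (a', b')) * (\<Sum>i<m. \<alpha> i (a, b) * ?t a b a' b' i j))"
        proof (intro sum.cong refl arg_cong2[where f = times])
          fix j assume "j \<in> {..<m}"
          then show "ell2_inner (h a b) (tensor_op I J (P a a') (Q b b') (\<xi> j)) = (\<Sum>i<m. \<alpha> i (a, b) * ?t a b a' b' i j)"
            unfolding h_def using in_ell2[OF ab] \<xi>
            by (subst ell2_inner_sum_left[of _ "I \<times> J"]) (auto intro: ell2_scale simp: ell2_inner_scale_left)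
        qed
        also have "\<dots> = (\<Sum>i<m. \<Sum>j<m. \<alpha> i (a, b) * cnj (\<alpha> j (a', b')) * ?t a b a' b' i j)"
          unfolding sum_distrib_left by (subst sum.swap) (simp add: mult_ac)
        finally show ?thesis .
      qed
      then have "(\<Sum>a<k. \<Sum>b<l. \<Sum>a'<k. \<Sum>b'<l. ell2_inner (h a b) (tensor_op I J (P a a') (Q b b') (h a' b'))) =
          (\<Sum>a<k. \<Sum>b<l. \<Sum>a'<k. \<Sum>b'<l. \<Sum>i<m. \<Sum>j<m. \<alpha> i (a, b) * cnj (\<alpha> j (a', b')) * ?t a b a' b' i j)"
        by simp
      also have "\<dots> = (\<Sum>i<m. \<Sum>j<m. \<Sum>a<k. \<Sum>b<l. \<Sum>a'<k. \<Sum>b'<l. \<alpha> i (a, b) * cnj (\<alpha> j (a', b')) * ?t a b a' b' i j)"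
        by (rule sum_rearrange')
      also have "\<dots> = (\<Sum>i<m. \<Sum>j<m. ell2_inner (\<xi> i) (x' i j (\<xi> j)))"
      proof (intro sum.cong refl)
        fix i j assume "i \<in> {..<m}" "j \<in> {..<m}"
        then have ij: "i < m" "j < m"
          by auto
        have x'_vec: "x' i j (\<xi> j) = (\<Sum>(a, b)\<in>{..<k} \<times> {..<l}. \<Sum>(a', b')\<in>{..<k} \<times> {..<l}.
            vec_scale (\<alpha> i (a, b) * cnj (\<alpha> j (a', b'))) (tensor_op I J (P a a') (Q b b') (\<xi> j)))"
          unfolding x'_eq[OF ij] by (simp add: sum_fun_apply[where x = "\<xi> j"] case_prod_unfold oper_scale_def)
        have "ell2_inner (\<xi> i) (x' i j (\<xi> j)) = (\<Sum>(a, b)\<in>{..<k} \<times> {..<l}. \<Sum>(a', b')\<in>{..<k} \<times> {..<l}.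
            ell2_inner (\<xi> i) (vec_scale (\<alpha> i (a, b) * cnj (\<alpha> j (a', b'))) (tensor_op I J (P a a') (Q b b') (\<xi> j))))"
          unfolding x'_vec case_prod_unfold using in_ell2[OF _ _ _ _ ij(2)]
          by (subst ell2_inner_sum_right[OF \<xi>[OF ij(1)]]; (intro sum.cong refl)?)
            (auto intro!: ell2_sum ell2_scale ell2_inner_sum_right[OF \<xi>[OF ij(1)]])
        then show "(\<Sum>a<k. \<Sum>b<l. \<Sum>a'<k. \<Sum>b'<l. \<alpha> i (a, b) * cnj (\<alpha> j (a', b')) * ?t a b a' b' i j) =
            ell2_inner (\<xi> i) (x' i j (\<xi> j))"
          by (simp add: sum.cartesian_product' ell2_inner_scale_right)
      qed
      also have "\<dots> = (\<Sum>i<m. \<Sum>j<m. (if j = i then complex_of_real (r * (ell2_norm (\<xi> i))\<^sup>2) else 0) + ell2_inner (\<xi> i) (x i j (\<xi> j)))"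
      proof (intro sum.cong refl)
        fix i j assume "i \<in> {..<m}" "j \<in> {..<m}"
        then have ij: "i < m" "j < m"
          by auto
        have "x' i j (\<xi> j) = (if j = i then vec_scale (complex_of_real r) (\<xi> j) else 0) + x i j (\<xi> j)"
          using tensor_op_id[OF \<xi>[OF ij(2)]] by (auto simp: x'_def oper_scale_def)
        then show "ell2_inner (\<xi> i) (x' i j (\<xi> j)) = (if j = i then complex_of_real (r * (ell2_norm (\<xi> i))\<^sup>2) else 0) + ell2_inner (\<xi> i) (x i j (\<xi> j))"
          using ell2_inner_add_right[OF \<xi>[OF ij(1)] ell2_scale[OF \<xi>[OF ij(2)]] x_bdd[OF ij]]
          by (auto simp: ell2_inner_scale_right ell2_inner_self)
      qed
      also have "\<dots> = s + complex_of_real (r * N)"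
        by (simp add: sum.distrib s_def N_def sum_distrib_left add.commute)
      finally show ?thesis
        using tensor_matrix_positive[OF T P Q, of h] h by simp
    qed
    have "Im s = 0"
      using pos[OF zero_less_one] by (simp add: complex_nonneg_Reals_iff)
    have Re: "Re s + r * N \<ge> 0" if "r > 0" for r
      using pos[OF that] by (simp add: complex_nonneg_Reals_iff)
    have "Re s \<ge> 0"
    proof (rule field_le_epsilon)
      fix \<epsilon> :: real assume "\<epsilon> > 0"
      have N: "N \<ge> 0"
        unfolding N_def by (simp add: sum_nonneg)
      \<comment> \<open>The denominator \<open>N + 1\<close> covers the case
        \<open>N = 0\<close>.\<close>
      have "\<epsilon> / (N + 1) * N \<le> \<epsilon>"
        using N \<open>\<epsilon> > 0\<close> by (simp add: field_simps)
      moreover have "Re s + \<epsilon> / (N + 1) * N \<ge> 0"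
        by (rule Re) (use N \<open>\<epsilon> > 0\<close> in simp)
      ultimately show "0 \<le> Re s + \<epsilon>"
        by linarith
    qed
    with \<open>Im s = 0\<close> show ?thesis
      unfolding s_def[symmetric] by (simp add: complex_nonneg_Reals_iff)
  qed
  then show ?thesis
    using x by (simp add: min_cone_def matrix_cone_def max_cone_def)
qed

text \<open>The minimal cone is stable under adding positive multiples of the unit, so the exact
  representation applies to \<open>x\<close> plus \<open>r\<close> for every
  \<open>r\<close>.\<close>

lemma min_cone_subset_max_cone:
  assumes T: "operator_system J T" and x: "x \<in> min_cone I J S T m"
  shows "x \<in> max_cone I J S T m"
proof -
  have x_in: "x \<in> matrices_over m (alg_tensor I J S T)"
    and x_pos: "\<And>\<xi>. (\<forall>i<m. \<xi> i \<in> ell2 (I \<times> J)) \<Longrightarrow> (\<Sum>i<m. \<Sum>j<m. ell2_inner (\<xi> i) (x i j (\<xi> j))) \<in> \<real>\<^sub>\<ge>\<^sub>0"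
    using x by (auto simp: min_cone_def matrix_cone_def)
  have "(\<lambda>i j. (if i = j then oper_scale (complex_of_real r) (tensor_op I J (id_op I) (id_op J)) else 0) + x i j)
      \<in> min_cone I J S T m" (is "?x \<in> _") if r: "r > 0" for r
    unfolding min_cone_def matrix_cone_def
  proof (intro CollectI conjI allI impI)
    have "tensor_op I J (id_op I) (id_op J) \<in> alg_tensor I J S T"
      using T id_in_span by (intro tensor_op_in_alg_tensor) (auto simp: operator_system_def)
    then show "?x \<in> matrices_over m (alg_tensor I J S T)"
      using x_in unfolding matrices_over_def alg_tensor_def
      by (auto intro!: oper.span_add oper.span_scale oper.span_zero)
    fix \<xi> assume \<xi>: "\<forall>i<m. \<xi> i \<in> ell2 (I \<times> J)"
    have "ell2_inner (\<xi> i) (?x i j (\<xi> j)) = (if j = i then complex_of_real (r * (ell2_norm (\<xi> i))\<^sup>2) else 0) + ell2_inner (\<xi> i) (x i j (\<xi> j))"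
      if ij: "i < m" "j < m" for i j
    proof -
      have "x i j (\<xi> j) \<in> ell2 (I \<times> J)"
        by (rule alg_tensor_in_ell2[OF T]) (use x_in \<xi> that in \<open>auto simp: matrices_over_def\<close>)
      moreover have "?x i j (\<xi> j) = (if j = i then vec_scale (complex_of_real r) (\<xi> j) else 0) + x i j (\<xi> j)"
        using tensor_op_id[of "\<xi> j" I J] \<xi> ij by (auto simp: oper_scale_def)
      ultimately show ?thesis
        using ell2_inner_add_right[of "\<xi> i" "I \<times> J" "vec_scale (complex_of_real r) (\<xi> j)" "x i j (\<xi> j)"] \<xi> ij
        by (auto simp: ell2_scale ell2_inner_scale_right ell2_inner_self)
    qed
    then have "(\<Sum>i<m. \<Sum>j<m. ell2_inner (\<xi> i) (?x i j (\<xi> j))) =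
        (\<Sum>i<m. complex_of_real (r * (ell2_norm (\<xi> i))\<^sup>2)) + (\<Sum>i<m. \<Sum>j<m. ell2_inner (\<xi> i) (x i j (\<xi> j)))"
      by (simp add: sum.distrib)
    also have "\<dots> \<in> \<real>\<^sub>\<ge>\<^sub>0"
      using r by (intro nonneg_Reals_add_I x_pos \<xi> sum_nonneg_Reals) (simp del: of_real_mult of_real_power)
    finally show "(\<Sum>i<m. \<Sum>j<m. ell2_inner (\<xi> i) (?x i j (\<xi> j))) \<in> \<real>\<^sub>\<ge>\<^sub>0" .
  qed
  then show ?thesis
    using x_in min_cone_subset_max_cone_pre[OF T] unfolding max_cone_def by blast
qed

theorem nuclear: "min_max_nuclear TYPE('b::infinite) I S"
  unfolding min_max_nuclear_def complete_order_isomorphism_def completely_positive_def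
proof (intro allI impI conjI ballI)
  fix J :: "'b set" and T assume T: "operator_system J T"
  fix m x
  show "(\<lambda>i j. id (x i j)) \<in> max_cone I J S T m" if "x \<in> min_cone I J S T m"
    using min_cone_subset_max_cone[OF T that] by simp
  assume x: "x \<in> max_cone I J S T m"
  \<comment> \<open>Off the tensor product \<open>inv_into\<close> of \<open>id\<close> is
    unspecified, but the cone constrains only entries with indices below \<open>m\<close>, and those
    lie in the tensor product.\<close>
  have "x i j \<in> alg_tensor I J S T" if "i < m" "j < m" for i j
    using x that by (auto simp: max_cone_def matrices_over_def)
  then have "inv_into (alg_tensor I J S T) id (x i j) = x i j" if "i < m" "j < m" for i j
    using inv_into_f_f[of id "alg_tensor I J S T" "x i j"] that by simp
  then show "(\<lambda>i j. inv_into (alg_tensor I J S T) id (x i j)) \<in> min_cone I J S T m"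
    using max_cone_subset_min_cone[OF T x] by (auto simp: min_cone_def matrix_cone_def matrices_over_def)
qed auto

end

section \<open>Nuclearity forces the spanning set to be a group\<close>

lemma (in group) span_id_in:
  assumes "W \<subseteq> carrier G" "\<one> \<in> W"
  shows "id_op (univ_index G) \<in> oper.span (univ_rep G ` W)"
  using assms by (simp flip: univ_rep_one add: oper.span_base)

text \<open>Averaging the expression times \<open>cnj \<zeta>\<close> over the four fourth roots of
  unity cancels \<open>A\<close> and \<open>C\<close> and leaves \<open>B\<close>.\<close>

lemma sesquilinear_polarization_bound:
  assumes "\<And>\<zeta>. cmod \<zeta> = 1 \<Longrightarrow> cmod (A + \<zeta> * B + cnj \<zeta> * C) \<le> K"
  shows "cmod B \<le> K"
proof -
  have "cmod (x - y - \<i> * z + \<i> * w) \<le> 4 * K"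
    if "cmod x \<le> K" "cmod y \<le> K" "cmod z \<le> K" "cmod w \<le> K" for x y z w
    using norm_triangle_ineq[of "x - y - \<i> * z" "\<i> * w"] norm_triangle_ineq4[of "x - y" "\<i> * z"]
      norm_triangle_ineq4[of x y] that
    by (simp add: norm_mult)
  from this[OF assms[of 1] assms[of "-1"] assms[of \<i>] assms[of "- \<i>"]]
  have "cmod ((A + 1 * B + cnj 1 * C) - (A + - 1 * B + cnj (- 1) * C) - \<i> * (A + \<i> * B + cnj \<i> * C)
      + \<i> * (A + - \<i> * B + cnj (- \<i>) * C)) \<le> 4 * K"
    by simp
  also have "(A + 1 * B + cnj 1 * C) - (A + - 1 * B + cnj (- 1) * C) - \<i> * (A + \<i> * B + cnj \<i> * C)
      + \<i> * (A + - \<i> * B + cnj (- \<i>) * C) = 4 * B"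
    by (simp add: algebra_simps)
  finally show ?thesis
    by (simp add: norm_mult)
qed

lemma (in group) nuclear_imp_mult_closed:
  assumes nuc: "min_max_nuclear TYPE('c::infinite) (univ_index G) (oper.span (univ_rep G ` W))"
    and W: "W \<subseteq> carrier G" "\<one> \<in> W" "\<And>w. w \<in> W \<Longrightarrow> inv w \<in> W"
    and kg: "k \<in> W" "g \<in> W"
  shows "k \<otimes> g \<in> W"
proof (rule ccontr)
  assume notin: "k \<otimes> g \<notin> W"
  let ?I = "univ_index G" and ?S = "oper.span (univ_rep G ` W)" and ?U = "univ_rep G"
  define h where "h = k \<otimes> g"
  have G: "k \<in> carrier G" "g \<in> carrier G" "inv k \<in> carrier G" "inv g \<in> carrier G" "h \<in> carrier G"
    using kg W(1) by (auto simp: h_def)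
  have h: "h \<notin> W" "h \<noteq> \<one>"
    using notin W(2) by (auto simp: h_def)
  define b where "b = ?U g + ?U (inv k)"
  define b' where "b' = ?U (inv g) + ?U k"
  define d where "d = ?U g - ?U (inv k)"
  define d' where "d' = ?U (inv g) - ?U k"
  define c where "c = oper_scale 4 (id_op ?I)"
  have U_in: "?U w \<in> ?S" if "w \<in> W" for w
    using that by (auto intro: oper.span_base)
  have S: "?S \<subseteq> bounded_ops ?I" "oper.subspace ?S" "id_op ?I \<in> ?S"
    using W by (auto simp: span_id_in oper.subspace_span dest: subsetD[OF span_univ_rep_bounded])
  have U_ell2: "?U w f \<in> ell2 ?I" if "w \<in> carrier G" "f \<in> ell2 ?I" for w f
    by (rule univ_rep_in_ell2[OF that])
  \<comment> \<open>The polarised parallelogram law for two unitaries: the cross terms of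
    \<open>b\<close> and \<open>d\<close> have opposite signs.\<close>
  have inner_b: "ell2_inner (b f) (b f') + ell2_inner (d f) (d f') = 4 * ell2_inner f f'"
    if "f \<in> ell2 ?I" "f' \<in> ell2 ?I" for f f'
    using that G by (simp add: b_def d_def ell2_inner_add_left[of _ ?I] ell2_inner_add_right[of _ ?I]
      ell2_inner_diff_left[of _ ?I] ell2_inner_diff_right[of _ ?I] U_ell2 ell2_add ell2_diff univ_rep_inner)
  have b_ell2: "b f \<in> ell2 ?I" and d_ell2: "d f \<in> ell2 ?I" if "f \<in> ell2 ?I" for f
    using that G by (simp_all add: b_def d_def U_ell2 ell2_add ell2_diff)
  obtain c1 where c1: "c1 \<in> ?S" and approx: "\<And>f. f \<in> ell2 ?I \<Longrightarrow>
    cmod (ell2_inner f (c1 f) - ell2_inner (b f) (b f)) \<le>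
      1 / 20 * ((ell2_norm f)\<^sup>2 + (ell2_norm (b f))\<^sup>2 + (ell2_norm (d f))\<^sup>2)"
  \<comment> \<open>The test vectors below have squared norm 2, and their images under
    \<open>b\<close> and \<open>d\<close> have squared norms adding up to 4 * 2 = 8. Hence
    \<open>r = 1 / 20\<close> bounds the error by (2 + 8) / 20 = 1/2, which is less than the
    coefficient 1 to be detected.\<close>
  proof (rule nuclear_imp_square_approx[where b = b and b' = b' and c = c and d = d and d' = d'
        and r = "1 / 20", OF nuc S])
    show "b \<in> ?S" "b' \<in> ?S" "d \<in> ?S" "d' \<in> ?S"
      unfolding b_def b'_def d_def d'_def using kg W(3) by (auto intro!: oper.span_add oper.span_diff U_in)
    show "c \<in> ?S"
      unfolding c_def using S(3) by (rule oper.span_scale)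
    show "ell2_inner f (b' f') = ell2_inner (b f) f'" "ell2_inner f (d' f') = ell2_inner (d f) f'"
      if "f \<in> ell2 ?I" "f' \<in> ell2 ?I" for f f'
      using that G univ_rep_adjoint[of g f f'] univ_rep_adjoint[of "inv k" f f']
      by (simp_all add: b_def b'_def d_def d'_def ell2_inner_add_left[of _ ?I] ell2_inner_add_right[of _ ?I]
        ell2_inner_diff_left[of _ ?I] ell2_inner_diff_right[of _ ?I] U_ell2)
    show "ell2_inner f (c f) = ell2_inner (b f) (b f) + ell2_inner (d f) (d f)" if "f \<in> ell2 ?I" for f
      using inner_b[OF that that] that by (simp add: c_def oper_scale_def ell2_inner_scale_right id_op_def)
  qed auto
  have c1_bdd: "c1 \<in> bounded_ops ?I"
    using c1 S(1) by auto
  define u where "u = reg_vec \<one>"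
  define v where "v = reg_vec h"
  have uv: "u \<in> ell2 ?I" "v \<in> ell2 ?I"
    using G by (auto simp: u_def v_def reg_vec_in_ell2)
  have uv_inner: "ell2_inner u u = 1" "ell2_inner v v = 1" "ell2_inner u v = 0" "ell2_inner v u = 0"
    using h by (auto simp: u_def v_def reg_vec_inner)
  \<comment> \<open>The defect form is controlled only on the diagonal; combinations of
    \<open>u\<close> and \<open>v\<close> with unimodular \<open>\<zeta>\<close> transfer the bound
    to the entry \<open>F v u\<close>.\<close>
  define F where "F f f' = ell2_inner f (c1 f') - ell2_inner (b f) (b f')" for f f'
  have b_bdd: "b \<in> bounded_ops ?I"
    unfolding b_def using G by (intro oper.subspace_add[OF subspace_bounded_ops] univ_rep_bounded)
  have bound: "cmod (F v v + F u u + \<zeta> * F v u + cnj \<zeta> * F u v) \<le> 1 / 2" if \<zeta>: "cmod \<zeta> = 1" for \<zeta>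
  proof -
    define f where "f = v + vec_scale \<zeta> u"
    have f: "f \<in> ell2 ?I"
      unfolding f_def using uv by (intro ell2_add ell2_scale)
    have \<zeta>': "cnj \<zeta> * \<zeta> = 1" "\<zeta> * cnj \<zeta> = 1"
      using \<zeta> complex_norm_square[of \<zeta>] by (simp_all add: mult.commute)
    have "ell2_inner f f = 2"
      unfolding f_def using uv uv_inner \<zeta>' ell2_scale[OF uv(1), of \<zeta>]
      by (simp add: ell2_inner_add_left[of _ ?I] ell2_inner_add_right[of _ ?I] ell2_add
        ell2_inner_scale_left ell2_inner_scale_right)
    then have norm_f: "(ell2_norm f)\<^sup>2 = 2"
      unfolding ell2_inner_self by (metis of_real_eq_iff of_real_numeral)
    have "complex_of_real ((ell2_norm (b f))\<^sup>2 + (ell2_norm (d f))\<^sup>2) = complex_of_real (4 * (ell2_norm f)\<^sup>2)"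
      using inner_b[OF f f] by (simp add: ell2_inner_self)
    then have norm_bd: "(ell2_norm (b f))\<^sup>2 + (ell2_norm (d f))\<^sup>2 = 8"
      unfolding of_real_eq_iff norm_f by simp
    have c1_f: "c1 f = c1 v + vec_scale \<zeta> (c1 u)"
      unfolding f_def bounded_ops_add[OF c1_bdd uv(2) ell2_scale[OF uv(1)]] bounded_ops_scale[OF c1_bdd uv(1)] ..
    have b_f: "b f = b v + vec_scale \<zeta> (b u)"
      unfolding f_def bounded_ops_add[OF b_bdd uv(2) ell2_scale[OF uv(1)]] bounded_ops_scale[OF b_bdd uv(1)] ..
    have expand: "ell2_inner (x + vec_scale \<zeta> y) (x' + vec_scale \<zeta> y') =
        ell2_inner x x' + cnj \<zeta> * \<zeta> * ell2_inner y y' + \<zeta> * ell2_inner x y' + cnj \<zeta> * ell2_inner y x'"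
      if "x \<in> ell2 ?I" "y \<in> ell2 ?I" "x' \<in> ell2 ?I" "y' \<in> ell2 ?I" for x y x' y'
      using that ell2_scale[OF that(2), of \<zeta>] ell2_scale[OF that(4), of \<zeta>]
      by (simp add: ell2_inner_add_left[of _ ?I] ell2_inner_add_right[of _ ?I] ell2_add
        ell2_inner_scale_left ell2_inner_scale_right algebra_simps)
    have "F f f = F v v + cnj \<zeta> * \<zeta> * F u u + \<zeta> * F v u + cnj \<zeta> * F u v"
      unfolding F_def c1_f b_f unfolding f_def
      using expand[OF uv(2,1) bounded_ops_in[OF c1_bdd uv(2)] bounded_ops_in[OF c1_bdd uv(1)]]
        expand[OF b_ell2[OF uv(2)] b_ell2[OF uv(1)] b_ell2[OF uv(2)] b_ell2[OF uv(1)]]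
      by (simp add: algebra_simps)
    moreover have "cmod (F f f) \<le> 1 / 2"
      using approx[OF f] norm_f norm_bd unfolding F_def by (simp add: add.assoc)
    ultimately show ?thesis
      using \<zeta>' by (simp add: add.assoc)
  qed
  then have "cmod (F v u) \<le> 1 / 2"
    by (rule sesquilinear_polarization_bound)
  moreover have "ell2_inner v (c1 u) = 0"
    unfolding u_def v_def by (rule reg_vec_coefficient_eq_0[OF W(1) c1 h(1)])
  ultimately have "cmod (ell2_inner (b v) (b u)) \<le> 1 / 2"
    by (simp add: F_def)
  moreover have "Re (ell2_inner (b v) (b u)) \<ge> 1"
  proof -
    \<comment> \<open>The vectors \<open>b v\<close> and \<open>b u\<close> share the basis vector
      at \<open>g\<close>, which contributes 1. All other inner products of basis vectors are 0 or
      1, so nothing cancels it.\<close>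
    have "inv k \<otimes> h = g"
      using G by (simp add: h_def m_assoc[symmetric])
    then have "b v = reg_vec (g \<otimes> h) + reg_vec g" "b u = reg_vec g + reg_vec (inv k)"
      using G by (simp_all add: b_def u_def v_def univ_rep_reg_vec)
    then show ?thesis
      using G by (simp add: ell2_inner_add_left[of _ ?I] ell2_inner_add_right[of _ ?I] ell2_add
        reg_vec_in_ell2 reg_vec_inner)
  qed
  ultimately show False
    using complex_Re_le_cmod[of "ell2_inner (b v) (b u)"] by simp
qed

section \<open>Generating sets and their symmetric closure\<close>

definition symmetric_closure :: "('g, 'm) monoid_scheme \<Rightarrow> 'g set \<Rightarrow> 'g set" where
  "symmetric_closure G \<uu> = {\<one>\<^bsub>G\<^esub>} \<union> \<uu> \<union> (\<lambda>g. inv\<^bsub>G\<^esub> g) ` \<uu>"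

lemma (in group) nuclear_imp_carrier_eq:
  assumes "min_max_nuclear TYPE('c::infinite) (univ_index G) (group_opsys G \<uu>)"
    and gen: "generating_set G \<uu>"
  shows "carrier G = symmetric_closure G \<uu>"
proof
  have u: "\<uu> \<subseteq> carrier G"
    using gen by (simp add: generating_set_def)
  then show W: "symmetric_closure G \<uu> \<subseteq> carrier G"
    by (auto simp: symmetric_closure_def)
  have nuc: "min_max_nuclear TYPE('c) (univ_index G) (oper.span (univ_rep G ` symmetric_closure G \<uu>))"
    using assms(1) unfolding group_opsys_eq_span[OF u] symmetric_closure_def .
  have one: "\<one> \<in> symmetric_closure G \<uu>"
    by (simp add: symmetric_closure_def)
  have inv: "inv w \<in> symmetric_closure G \<uu>" if "w \<in> symmetric_closure G \<uu>" for w
    using that u by (auto simp: symmetric_closure_def subsetD)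
  have "x \<in> symmetric_closure G \<uu>" if "x \<in> generate G \<uu>" for x
    using that
  proof induction
    case (eng x y)
    then show ?case
      by (intro nuclear_imp_mult_closed[OF nuc W one inv])
  qed (auto simp: symmetric_closure_def)
  then show "carrier G \<subseteq> symmetric_closure G \<uu>"
    using gen by (auto simp: generating_set_def)
qed

lemma (in group) minimal_generating_set_not_redundant:
  assumes min: "minimal_generating_set G \<uu>" and x: "x \<in> \<uu>"
  shows "x \<notin> generate G (\<uu> - {x})"
proof
  assume red: "x \<in> generate G (\<uu> - {x})"
  have u: "\<uu> \<subseteq> carrier G" and gen: "generate G \<uu> = carrier G"
    using min by (auto simp: minimal_generating_set_def generating_set_def)
  have u': "\<uu> - {x} \<subseteq> carrier G"
    using u by auto
  have "\<uu> \<subseteq> generate G (\<uu> - {x})"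
    using red generate.incl[of _ "\<uu> - {x}" G] by auto
  then have "generate G \<uu> \<subseteq> generate G (\<uu> - {x})"
    by (rule generate_subgroup_incl[OF _ generate_is_subgroup[OF u']])
  then have "generating_set G (\<uu> - {x})"
    using gen generate_incl[OF u'] u' by (auto simp: generating_set_def)
  moreover have "\<uu> - {x} \<subset> \<uu>"
    using x by auto
  ultimately show False
    using min unfolding minimal_generating_set_def by blast
qed

lemma (in group) minimal_generating_set_unique:
  assumes min: "minimal_generating_set G \<uu>" and W: "carrier G = symmetric_closure G \<uu>"
    and st: "s \<in> \<uu>" "t \<in> \<uu>"
  shows "s = t"
proof (rule ccontr)
  assume ne: "s \<noteq> t"
  have u: "\<uu> \<subseteq> carrier G"
    using min by (auto simp: minimal_generating_set_def generating_set_def)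
  have G: "s \<in> carrier G" "t \<in> carrier G"
    using st u by auto
  note red = minimal_generating_set_not_redundant[OF min]
  have other: "x \<in> generate G (\<uu> - {y})" if "x \<in> \<uu>" "x \<noteq> y" for x y
    using that by (intro generate.incl) auto
  have inv_other: "inv x \<in> generate G (\<uu> - {y})" if "x \<in> \<uu>" "x \<noteq> y" for x y
    using that by (intro generate.inv) auto
  have one: "\<one> \<notin> \<uu>"
    using red[of \<one>] generate.one by blast
  have "s \<otimes> t \<in> symmetric_closure G \<uu>"
    using G W by auto
  then consider "s \<otimes> t = \<one>" | w where "w \<in> \<uu>" "s \<otimes> t = w" | w where "w \<in> \<uu>" "s \<otimes> t = inv w"
    by (auto simp: symmetric_closure_def)
  then show False
  proof cases
    case 1
    then have "t = inv s"
      using G inv_equality inv_inv by metis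
    then show False
      using red[OF st(2)] inv_other[OF st(1) ne] by simp
  next
    case (2 w)
    \<comment> \<open>Otherwise cancellation would make one of \<open>s\<close>, \<open>t\<close>
      the identity, which is redundant in any generating set.\<close>
    then have "w \<noteq> s" "w \<noteq> t"
      using G one st r_cancel_one' l_cancel_one' by metis+
    then have "s \<otimes> t \<in> generate G (\<uu> - {w})"
      using other st by (intro generate.eng) auto
    then show False
      using red 2 by auto
  next
    \<comment> \<open>Unlike in the previous case \<open>w\<close> may be \<open>s\<close> or
      \<open>t\<close>: then the other one is the square of the inverse of \<open>w\<close>. If it
      is neither, inverting expresses \<open>w\<close> through \<open>s\<close> and
      \<open>t\<close>.\<close>
    case (3 w)
    show False
    proof (cases "w = s")
      case True
      have "t = inv s \<otimes> inv s"
        using 3(2) True G by (metis inv_closed inv_solve_left)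
      moreover have "inv s \<otimes> inv s \<in> generate G (\<uu> - {t})"
        using inv_other[OF st(1) ne] by (intro generate.eng)
      ultimately show False
        using red[OF st(2)] by simp
    next
      case ws: False
      show False
      proof (cases "w = t")
        case True
        have "s = inv t \<otimes> inv t"
          using 3(2) True G by (metis inv_closed inv_solve_right)
        moreover have "inv t \<otimes> inv t \<in> generate G (\<uu> - {s})"
          using inv_other[OF st(2)] ne by (intro generate.eng) auto
        ultimately show False
          using red[OF st(1)] by simp
      next
        case False
        have "s \<otimes> t \<in> generate G (\<uu> - {w})"
          using other[OF st(1), of w] other[OF st(2), of w] ws False by (intro generate.eng) auto
        then have "inv w \<in> generate G (\<uu> - {w})"
          using 3 by simp
        with u have "inv (inv w) \<in> generate G (\<uu> - {w})"
          by (intro generate_m_inv_closed[of "\<uu> - {w}" "inv w"]) auto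
        then show False
          using red[OF 3(1)] 3(1) u by auto
      qed
    qed
  qed
qed

lemma (in group) symmetric_closure_card_le_3:
  assumes "minimal_generating_set G \<uu>" "carrier G = symmetric_closure G \<uu>"
  shows "finite (carrier G) \<and> order G \<le> 3"
proof (cases "\<uu> = {}")
  case True
  then show ?thesis
    using assms(2) by (simp add: symmetric_closure_def order_def)
next
  case False
  then obtain s where "s \<in> \<uu>"
    by auto
  then have "\<uu> = {s}"
    using minimal_generating_set_unique[OF assms] by auto
  then have "carrier G = {\<one>, s, inv s}"
    using assms(2) by (auto simp: symmetric_closure_def)
  moreover have "card {\<one>, s, inv s} \<le> 3"
    using card_insert_le_m1[of 3 "{s, inv s}" \<one>] by (simp add: card_insert_if)
  ultimately show ?thesis
    by (simp add: order_def)
qed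


section \<open>Groups of order at most three\<close>

text \<open>Every summand is indexed by a subset of the finite group, so the operator has a finite
  matrix there, and a coordinate of the image depends only on the coordinates in the same
  summand.\<close>

lemma (in group) univ_rep_row_finite:
  assumes "g \<in> carrier G" "finite (carrier G)"
  shows "\<exists>M. \<forall>f\<in>ell2 (univ_index G). univ_rep G g f x = (\<Sum>y\<in>univ_index G \<inter> ({fst x} \<times> carrier G). M y * f y)"
proof -
  obtain r i where x: "x = (r, i)"
    by fastforce
  show ?thesis
  proof (cases "r \<in> unitary_reps G")
    case True
    have sub: "fst r \<subseteq> carrier G"
      using True by (auto simp: unitary_reps_def)
    then have fin: "finite (fst r)"
      using assms(2) finite_subset by blast
    have set_eq: "univ_index G \<inter> ({fst x} \<times> carrier G) = Pair r ` fst r"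
      using True sub by (auto simp: x univ_index_def)
    have bdd: "snd r g \<in> bounded_ops (fst r)"
      by (rule unitary_ops_bounded[OF unitary_reps_unitary[OF True assms(1)]])
    have "univ_rep G g f x = (\<Sum>y\<in>Pair r ` fst r. snd r g (unit_vec (snd y)) i * f y)"
      if f: "f \<in> ell2 (univ_index G)" for f
    proof -
      have "(\<Sum>j\<in>fst r. vec_scale (f (r, j)) (unit_vec j)) = (\<lambda>i. f (r, i))"
        using fin ell2_outside[OF univ_slice[OF f True]]
        by (auto simp: fun_eq_iff sum_fun_apply unit_vec_def if_distrib[of "\<lambda>x. _ * x"] cong: if_cong)
      then have "univ_rep G g f x = snd r g (\<Sum>j\<in>fst r. vec_scale (f (r, j)) (unit_vec j)) i"
        using f True by (simp add: univ_rep_def x)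
      also have "snd r g (\<Sum>j\<in>fst r. vec_scale (f (r, j)) (unit_vec j))
          = (\<Sum>j\<in>fst r. snd r g (vec_scale (f (r, j)) (unit_vec j)))"
        by (rule bounded_ops_sum[OF bdd]) (intro ell2_scale unit_vec_in_ell2)
      also have "\<dots> i = (\<Sum>j\<in>fst r. snd r g (unit_vec j) i * f (r, j))"
        unfolding sum_fun_apply
        by (intro sum.cong refl) (simp add: bounded_ops_scale[OF bdd unit_vec_in_ell2] mult.commute)
      also have "\<dots> = (\<Sum>y\<in>Pair r ` fst r. snd r g (unit_vec (snd y)) i * f y)"
        by (subst sum.reindex) (auto simp: inj_on_def)
      finally show ?thesis .
    qed
    then show ?thesis
      unfolding set_eq by (intro exI[of _ "\<lambda>y. snd r g (unit_vec (snd y)) i"] ballI)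
  next
    case False
    then have "univ_index G \<inter> ({fst x} \<times> carrier G) = {}"
      by (auto simp: x univ_index_def)
    then show ?thesis
      using False by (simp add: x univ_rep_def)
  qed
qed

section \<open>Spectral projections of a finite cyclic group\<close>

lemma sum_powers_root_of_unity:
  assumes "z ^ n = 1" "z \<noteq> (1::complex)"
  shows "(\<Sum>j<n. z ^ j) = 0"
  using geometric_sum[OF assms(2), of n] assms(1) by simp

text \<open>\<open>inj\<close> makes \<open>n\<close> the exact order of \<open>t\<close>; through
  it the identity occurs only once in each Fourier sum, which keeps the projections nonzero.\<close>

locale finite_cyclic_group = group +
  fixes t n
  assumes t: "t \<in> carrier G" and n: "n > 0" and t_pow_n: "t [^] n = \<one>"
    and carrier_eq: "carrier G = (\<lambda>j::nat. t [^] j) ` {..<n}"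
    and inj: "inj_on (\<lambda>j::nat. t [^] j) {..<n}"
begin

definition root :: "nat \<Rightarrow> complex" where
  "root k = cis (2 * pi * real k / real n)"

definition rot :: "nat \<Rightarrow> ('a rep \<times> 'a) oper" where
  "rot j = univ_rep G (t [^] j)"

text \<open>The projection onto the eigenspace of \<open>rot 1\<close> for the eigenvalue \<open>root k\<close>.\<close>

definition proj :: "nat \<Rightarrow> ('a rep \<times> 'a) oper" where
  "proj k = (\<Sum>j<n. oper_scale (cnj (root k ^ j) / of_nat n) (rot j))"

lemma root_pow: "root k ^ n = 1"
proof -
  have "real n * (2 * pi * real k / real n) = 2 * pi * real k"
    using n by simp
  then show ?thesis
    unfolding root_def Complex.DeMoivre by (simp add: cis_multiple_2pi)
qed

lemma root_cnj: "cnj (root k) * root k = 1" "root k * cnj (root k) = 1"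
  by (simp_all add: root_def cis_cnj cis_mult)

lemma root_power_commute: "root k ^ j = root j ^ k"
  by (simp add: root_def Complex.DeMoivre mult_ac)

lemma root_inj: "k < n \<Longrightarrow> l < n \<Longrightarrow> root k = root l \<Longrightarrow> k = l"
  using Complex.bij_betw_roots_unity[OF n] unfolding root_def bij_betw_def inj_on_def by auto

text \<open>Orthogonality of the characters of Z/n, as a geometric sum.\<close>

lemma root_orthogonal:
  assumes "k < n" "l < n"
  shows "(\<Sum>j<n. (cnj (root l) * root k) ^ j) = (if k = l then of_nat n else 0)"
proof (cases "k = l")
  case False
  have "cnj (root l) * root k \<noteq> 1"
  proof
    assume "cnj (root l) * root k = 1"
    then have "root l * (cnj (root l) * root k) = root l"
      by simp
    then have "root k = root l"
      by (simp add: mult.assoc[symmetric] root_cnj)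
    then show False
      using root_inj assms False by blast
  qed
  moreover have "(cnj (root l) * root k) ^ n = 1"
    by (simp add: power_mult_distrib root_pow flip: complex_cnj_power)
  ultimately show ?thesis
    using False sum_powers_root_of_unity by simp
qed (simp add: root_cnj)

lemma rot_bounded: "rot j \<in> bounded_ops (univ_index G)"
  unfolding rot_def using t by (intro univ_rep_bounded) simp

lemma rot_rot: "rot i (rot j f) = rot (i + j) f"
  unfolding rot_def using t by (simp add: univ_rep_mult[symmetric] nat_pow_mult)

lemma rot_0: "f \<in> ell2 (univ_index G) \<Longrightarrow> rot 0 f = f"
  by (simp add: rot_def univ_rep_one id_op_def)

lemma rot_n: "rot n = rot 0"
  by (simp add: rot_def t_pow_n)

lemma proj_bounded: "proj k \<in> bounded_ops (univ_index G)"
  unfolding proj_def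
  by (intro oper.subspace_sum oper.subspace_scale subspace_bounded_ops rot_bounded)

lemma proj_apply: "proj k f = (\<Sum>j<n. vec_scale (cnj (root k ^ j) / of_nat n) (rot j f))"
  by (simp add: proj_def sum_fun_apply[where x = f] oper_scale_def)

lemma rot_1_proj:
  assumes f: "f \<in> ell2 (univ_index G)"
  shows "rot 1 (proj k f) = vec_scale (root k) (proj k f)"
proof -
  let ?a = "\<lambda>j. vec_scale (cnj (root k ^ j) / of_nat n) (rot j f)"
  have in_ell2: "rot j f \<in> ell2 (univ_index G)" for j
    by (rule bounded_ops_in[OF rot_bounded f])
  have "rot 1 (?a j) = vec_scale (root k) (?a (Suc j))" for j
  proof -
    have "root k * cnj (root k ^ Suc j) = cnj (root k ^ j)"
      by (simp add: root_cnj mult.assoc[symmetric])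
    then have "root k * (cnj (root k ^ Suc j) / of_nat n) = cnj (root k ^ j) / of_nat n"
      by (simp only: times_divide_eq_right)
    then show ?thesis
      unfolding bounded_ops_scale[OF rot_bounded in_ell2] rot_rot
      by (auto simp: fun_eq_iff mult.assoc[symmetric])
  qed
  moreover have "rot 1 (proj k f) = (\<Sum>j<n. rot 1 (?a j))"
    unfolding proj_apply by (rule bounded_ops_sum[OF rot_bounded]) (intro ell2_scale in_ell2)
  ultimately have "rot 1 (proj k f) = (\<Sum>j<n. vec_scale (root k) (?a (Suc j)))"
    by simp
  also have "\<dots> = vec_scale (root k) (\<Sum>j<n. ?a (Suc j))"
    by (simp add: fun_eq_iff sum_fun_apply sum_distrib_left)
  \<comment> \<open>The shifted sum differs only by its end terms, and these agree because
    \<open>root k\<close> and \<open>t\<close> both have n-th power 1.\<close>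
  also have "(\<Sum>j<n. ?a (Suc j)) = (\<Sum>j<n. ?a j) + ?a n - ?a 0"
    using sum.lessThan_Suc_shift[of ?a n] by (simp add: algebra_simps)
  also have "?a n = ?a 0"
    by (simp add: root_pow rot_n del: complex_cnj_power)
  finally show ?thesis
    by (simp only: proj_apply add_diff_cancel_right')
qed

lemma rot_proj:
  assumes f: "f \<in> ell2 (univ_index G)"
  shows "rot j (proj k f) = vec_scale (root k ^ j) (proj k f)"
proof (induction j)
  case 0
  then show ?case
    using rot_0[OF bounded_ops_in[OF proj_bounded f]] by (simp add: vec_scale_def)
next
  case (Suc j)
  have "rot (Suc j) (proj k f) = rot j (rot 1 (proj k f))"
    by (simp add: rot_rot)
  also have "\<dots> = vec_scale (root k) (rot j (proj k f))"
    unfolding rot_1_proj[OF f] by (rule bounded_ops_scale[OF rot_bounded bounded_ops_in[OF proj_bounded f]])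
  finally show ?case
    unfolding Suc by (simp add: fun_eq_iff)
qed

lemma proj_orthogonal:
  assumes "k < n" "l < n" "f \<in> ell2 (univ_index G)"
  shows "proj k (proj l f) = (if k = l then proj k f else 0)"
proof -
  have "proj k (proj l f) i = (\<Sum>j<n. (cnj (root k) * root l) ^ j) / of_nat n * proj l f i" for i
    unfolding proj_apply[of k "proj l f"] rot_proj[OF assms(3)]
    by (simp add: sum_fun_apply sum_distrib_right sum_divide_distrib power_mult_distrib mult.assoc)
  then have "proj k (proj l f) i = (if k = l then proj k f else 0) i" for i
    using n unfolding root_orthogonal[OF assms(2,1)] by simp
  then show ?thesis
    by blast
qed

lemma sum_proj: "f \<in> ell2 (univ_index G) \<Longrightarrow> (\<Sum>k<n. proj k f) = f"
proof
  fix i assume f: "f \<in> ell2 (univ_index G)"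
  have delta: "(\<Sum>k<n. cnj (root k) ^ j) = (if j = 0 then of_nat n else 0)" if "j < n" for j
  proof -
    \<comment> \<open>The exponents \<open>k\<close> and \<open>j\<close> enter symmetrically, so
      \<open>root_orthogonal\<close> also sums over \<open>k\<close>; the factor
      \<open>root 0\<close> is 1 and only matches its form.\<close>
    have "cnj (root k) ^ j = (cnj (root j) * root 0) ^ k" for k
      using root_power_commute[of k j] by (simp add: root_def[of 0] flip: complex_cnj_power)
    then have "(\<Sum>k<n. cnj (root k) ^ j) = (\<Sum>k<n. (cnj (root j) * root 0) ^ k)"
      by simp
    then show ?thesis
      using root_orthogonal[OF n that] by auto
  qed
  have "(\<Sum>k<n. proj k f) i = (\<Sum>j<n. (\<Sum>k<n. cnj (root k ^ j)) / of_nat n * rot j f i)"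
    unfolding proj_apply sum_fun_apply
    by (subst sum.swap) (simp add: sum_distrib_right sum_divide_distrib)
  also have "\<dots> = (\<Sum>j<n. if j = 0 then rot 0 f i else 0)"
    using n by (intro sum.cong refl) (simp add: delta)
  also have "\<dots> = f i"
    using n by (simp add: rot_0[OF f])
  finally show "(\<Sum>k<n. proj k f) i = f i" .
qed

text \<open>Eigenvectors of the unitary \<open>rot 1\<close> for distinct eigenvalues are
  orthogonal.\<close>

lemma proj_inner_orthogonal:
  assumes "k < n" "l < n" "k \<noteq> l" "f \<in> ell2 (univ_index G)" "g \<in> ell2 (univ_index G)"
  shows "ell2_inner (proj l f) (proj k g) = 0"
proof -
  have "ell2_inner (rot 1 (proj l f)) (rot 1 (proj k g)) = ell2_inner (proj l f) (proj k g)"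
    unfolding rot_def using t assms by (intro univ_rep_inner bounded_ops_in[OF proj_bounded]) auto
  then have "cnj (root l) * root k * ell2_inner (proj l f) (proj k g) = ell2_inner (proj l f) (proj k g)"
    unfolding rot_1_proj[OF assms(4)] rot_1_proj[OF assms(5)]
    by (simp only: ell2_inner_scale_left ell2_inner_scale_right mult_ac)
  moreover have "cnj (root l) * root k \<noteq> 1"
    using root_orthogonal[OF assms(1,2)] assms(3) n by auto
  ultimately show ?thesis
    by (metis mult_cancel_right1)
qed

text \<open>Decompose \<open>f\<close> by \<open>sum_proj\<close>: all components but the k-th are
  orthogonal to the range of \<open>proj k\<close>.\<close>

lemma proj_selfadjoint:
  assumes "k < n" "f \<in> ell2 (univ_index G)" "g \<in> ell2 (univ_index G)"
  shows "ell2_inner f (proj k g) = ell2_inner (proj k f) (proj k g)"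
proof -
  have in_ell2: "proj l f \<in> ell2 (univ_index G)" "proj l g \<in> ell2 (univ_index G)" for l
    using assms by (auto intro: bounded_ops_in[OF proj_bounded])
  have "ell2_inner f (proj k g) = ell2_inner (\<Sum>l<n. proj l f) (proj k g)"
    by (simp add: sum_proj assms(2))
  also have "\<dots> = (\<Sum>l<n. ell2_inner (proj l f) (proj k g))"
    by (rule ell2_inner_sum_left[OF in_ell2(2) in_ell2(1)])
  also have "\<dots> = (\<Sum>l<n. if l = k then ell2_inner (proj k f) (proj k g) else 0)"
    using assms by (intro sum.cong refl) (auto simp: proj_inner_orthogonal)
  also have "\<dots> = ell2_inner (proj k f) (proj k g)"
    using assms(1) by simp
  finally show ?thesis .
qed

text \<open>In the regular representation the diagonal entry of \<open>proj k\<close> at the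
  identity is its coefficient there, namely 1/n.\<close>

lemma proj_nonzero: "proj k (reg_vec \<one>) \<noteq> 0"
proof
  assume 0: "proj k (reg_vec \<one>) = 0"
  have "ell2_inner (reg_vec \<one>) (proj k (reg_vec \<one>)) =
      (\<Sum>j<n. cnj (root k ^ j) / of_nat n * ell2_inner (reg_vec \<one>) (rot j (reg_vec \<one>)))"
    by (simp add: reg_vec_def ell2_inner_unit_vec proj_apply sum_fun_apply)
  also have "\<dots> = (\<Sum>j<n. if j = 0 then 1 / of_nat n else 0)"
  proof (intro sum.cong refl)
    fix j assume "j \<in> {..<n}"
    then have "t [^] j = \<one> \<longleftrightarrow> j = 0"
      using inj_onD[OF inj, of j 0] n by auto
    then show "cnj (root k ^ j) / of_nat n * ell2_inner (reg_vec \<one>) (rot j (reg_vec \<one>)) = (if j = 0 then 1 / of_nat n else 0)"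
      using t by (auto simp: rot_def univ_rep_reg_vec reg_vec_inner)
  qed
  also have "\<dots> = 1 / of_nat n"
    using n by simp
  finally show False
    using 0 n by simp
qed

lemma proj_finite_rows:
  assumes "finite (carrier G)"
  shows "\<exists>F M. finite F \<and> (\<forall>f\<in>ell2 (univ_index G). proj k f x = (\<Sum>y\<in>F. M y * f y))"
proof -
  define F where "F = univ_index G \<inter> ({fst x} \<times> carrier G)"
  have "\<forall>j. \<exists>M. \<forall>f\<in>ell2 (univ_index G). rot j f x = (\<Sum>y\<in>F. M y * f y)"
    unfolding rot_def F_def using t assms by (intro allI univ_rep_row_finite) auto
  then obtain M where M: "\<forall>j. \<forall>f\<in>ell2 (univ_index G). rot j f x = (\<Sum>y\<in>F. M j y * f y)"
    using choice[of "\<lambda>j M. \<forall>f\<in>ell2 (univ_index G). rot j f x = (\<Sum>y\<in>F. M y * f y)"] by blast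
  have "proj k f x = (\<Sum>y\<in>F. (\<Sum>j<n. cnj (root k ^ j) / of_nat n * M j y) * f y)" if "f \<in> ell2 (univ_index G)" for f
    unfolding proj_apply sum_fun_apply sum_distrib_right
    by (subst sum.swap) (simp add: M[rule_format, OF that] sum_distrib_left mult.assoc)
  then have "\<forall>f\<in>ell2 (univ_index G). proj k f x = (\<Sum>y\<in>F. (\<Sum>j<n. cnj (root k ^ j) / of_nat n * M j y) * f y)"
    by (rule ballI)
  moreover have "finite F"
    unfolding F_def using assms by auto
  ultimately show ?thesis
    by (intro exI[of _ F] exI[of _ "\<lambda>y. \<Sum>j<n. cnj (root k ^ j) / of_nat n * M j y"] conjI)
qed

text \<open>Fourier inversion, which puts the group elements into the span of the
  projections.\<close>

lemma rot_eq_sum_proj: "rot j = (\<Sum>k<n. oper_scale (root k ^ j) (proj k))"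
proof
  fix f
  show "rot j f = (\<Sum>k<n. oper_scale (root k ^ j) (proj k)) f"
  proof (cases "f \<in> ell2 (univ_index G)")
    case True
    have "rot j f = rot j (\<Sum>k<n. proj k f)"
      by (simp add: sum_proj[OF True])
    also have "\<dots> = (\<Sum>k<n. rot j (proj k f))"
      by (rule bounded_ops_sum[OF rot_bounded bounded_ops_in[OF proj_bounded True]])
    also have "\<dots> = (\<Sum>k<n. oper_scale (root k ^ j) (proj k)) f"
      by (simp add: rot_proj[OF True] sum_fun_apply[where x = f] oper_scale_def)
    finally show ?thesis .
  next
    case False
    then have "rot j f = 0" "proj k f = 0" for k
      by (auto intro: bounded_ops_outside rot_bounded proj_bounded)
    then show ?thesis
      by (simp add: sum_fun_apply[where x = f] oper_scale_def vec_scale_def fun_eq_iff sum_fun_apply)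
  qed
qed

lemma span_univ_rep_eq: "oper.span (univ_rep G ` carrier G) = oper.span (proj ` {..<n})"
proof
  have "rot j \<in> oper.span (proj ` {..<n})" for j
    unfolding rot_eq_sum_proj by (intro oper.span_sum oper.span_scale oper.span_base) auto
  then show "oper.span (univ_rep G ` carrier G) \<subseteq> oper.span (proj ` {..<n})"
    unfolding carrier_eq by (intro oper.span_minimal oper.subspace_span) (auto simp: rot_def)
  have "proj k \<in> oper.span (univ_rep G ` carrier G)" for k
    unfolding proj_def rot_def using t by (intro oper.span_sum oper.span_scale oper.span_base) auto
  then show "oper.span (proj ` {..<n}) \<subseteq> oper.span (univ_rep G ` carrier G)"
    by (intro oper.span_minimal oper.subspace_span) auto
qed

lemma group_algebra_nuclear:
  "min_max_nuclear TYPE('c::infinite) (univ_index G) (oper.span (univ_rep G ` carrier G))"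
proof -
  have fin: "finite (carrier G)"
    unfolding carrier_eq by simp
  interpret orthogonal_projections "univ_index G" proj n
  proof
    show "\<exists>f\<in>ell2 (univ_index G). proj k f \<noteq> 0" for k
      using proj_nonzero reg_vec_in_ell2[OF one_closed] by blast
    show "\<exists>F M. finite F \<and> (\<forall>f\<in>ell2 (univ_index G). proj k f x = (\<Sum>y\<in>F. M y * f y))" for k x
      by (rule proj_finite_rows[OF fin])
    show "id_op (univ_index G) \<in> oper.span (proj ` {..<n})"
      using span_id_in[OF order_refl one_closed] by (simp add: span_univ_rep_eq)
  qed (auto simp: proj_bounded proj_orthogonal proj_selfadjoint)
  show ?thesis
    unfolding span_univ_rep_eq by (rule nuclear)
qed

end

text \<open>A generator \<open>s\<close> other than the identity determines everything. If it is an
  involution, a further element \<open>x\<close> would bring the fourth element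
  \<open>s \<otimes> x\<close>; otherwise the identity, \<open>s\<close> and its inverse already
  exhaust the group. Either way the symmetric closure is the whole group for every generating set,
  minimal or not.\<close>

lemma (in group) order_le_3_cases:
  assumes fin: "finite (carrier G)" and ord: "order G \<le> 3" and gen: "generating_set G \<uu>"
  obtains t where "t \<in> carrier G" "carrier G = (\<lambda>j::nat. t [^] j) ` {..<order G}"
    "carrier G = symmetric_closure G \<uu>"
proof (cases "\<uu> \<subseteq> {\<one>}")
  case True
  have "x = \<one>" if "x \<in> generate G \<uu>" for x
    using that by induction (use True in auto)
  then have "carrier G = {\<one>}"
    using gen one_closed unfolding generating_set_def by blast
  moreover from this have "order G = 1"
    by (simp add: order_def)
  ultimately show ?thesis
    using True by (intro that[of \<one>]) (auto simp: symmetric_closure_def lessThan_Suc)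
next
  case False
  then obtain s where s: "s \<in> \<uu>" "s \<noteq> \<one>"
    by auto
  have u: "\<uu> \<subseteq> carrier G"
    using gen by (simp add: generating_set_def)
  with s have sG: "s \<in> carrier G"
    by auto
  have inv_ne: "inv s \<noteq> \<one>"
    using s(2) sG by (metis inv_inv inv_one)
  have closure: "{\<one>, s, inv s} \<subseteq> symmetric_closure G \<uu>" "symmetric_closure G \<uu> \<subseteq> carrier G"
    using s u by (auto simp: symmetric_closure_def)
  have ss: "s \<otimes> s = \<one> \<longleftrightarrow> inv s = s"
    using sG by (metis inv_equality r_inv)
  have ss_ne: "s \<otimes> s \<noteq> s"
    using sG s(2) by (simp add: l_cancel_one')
  show ?thesis
  proof (cases "inv s = s")
    case True
    have carrier: "carrier G = {\<one>, s}"
    proof (rule ccontr)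
      assume "carrier G \<noteq> {\<one>, s}"
      then obtain x where x: "x \<in> carrier G" "x \<noteq> \<one>" "x \<noteq> s"
        using sG by auto
      have "s \<otimes> x \<noteq> \<one>"
        using x sG True inv_equality[of s x] by (metis inv_inv inv_unique r_inv)
      moreover have "s \<otimes> x \<noteq> s" "s \<otimes> x \<noteq> x"
        using x sG s(2) by (simp_all add: l_cancel_one' r_cancel_one')
      ultimately have "card {\<one>, s, x, s \<otimes> x} = 4"
        using x s(2) by auto
      moreover have "card {\<one>, s, x, s \<otimes> x} \<le> card (carrier G)"
        using x sG by (intro card_mono[OF fin]) auto
      ultimately show False
        using ord by (simp add: order_def)
    qed
    then have "order G = 2"
      using s(2) by (simp add: order_def)
    then show ?thesis
      using carrier closure sG by (intro that[of s]) (auto simp: lessThan_Suc numeral_2_eq_2)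
  next
    case False
    then have card3: "card {\<one>, s, inv s} = 3"
      using s(2) inv_ne by auto
    have carrier: "carrier G = {\<one>, s, inv s}"
      by (rule sym, rule card_seteq[OF fin]) (use sG ord card3 in \<open>auto simp: order_def\<close>)
    then have "order G = 3"
      using card3 by (simp add: order_def)
    moreover have "s \<otimes> s = inv s"
      using carrier False ss ss_ne sG by (metis insertE m_closed singletonD)
    ultimately show ?thesis
      using carrier closure sG by (intro that[of s]) (auto simp: lessThan_Suc numeral_3_eq_3)
  qed
qed

lemma (in group) order_le_3_imp_nuclear:
  assumes fin: "finite (carrier G)" and ord: "order G \<le> 3" and gen: "generating_set G \<uu>"
  shows "min_max_nuclear TYPE('c::infinite) (univ_index G) (group_opsys G \<uu>)"
proof -
  have u: "\<uu> \<subseteq> carrier G"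
    using gen by (simp add: generating_set_def)
  obtain t where t: "t \<in> carrier G" "carrier G = (\<lambda>j::nat. t [^] j) ` {..<order G}"
    and closure: "carrier G = symmetric_closure G \<uu>"
    using order_le_3_cases[OF assms] by blast
  interpret finite_cyclic_group G t "order G"
  proof
    show "order G > 0"
      using fin by (simp add: order_gt_0_iff_finite)
    have "card ((\<lambda>j::nat. t [^] j) ` {..<order G}) = card {..<order G}"
      unfolding t(2)[symmetric] by (simp add: order_def)
    then show "inj_on (\<lambda>j::nat. t [^] j) {..<order G}"
      by (rule eq_card_imp_inj_on[OF finite_lessThan])
  qed (use t pow_order_eq_1 in auto)
  show ?thesis
    using group_algebra_nuclear[where 'c = 'c] closure
    unfolding group_opsys_eq_span[OF u] symmetric_closure_def by simp
qed

text \<open>\<open>order\<close> is a cardinality and is 0 for an infinite group, so finiteness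
  accompanies the bound on the order.\<close>

theorem theorem5p4:
  fixes G :: "('g, 'm) monoid_scheme" and \<uu> :: "'g set"
  assumes "group G" and "finitely_generated G" and "generating_set G \<uu>"
  shows "(finite \<uu> \<and> min_max_nuclear TYPE('b::infinite) (univ_index G) (group_opsys G \<uu>)
            \<longrightarrow> finite (carrier G)) \<and>
         (minimal_generating_set G \<uu> \<longrightarrow>
            (min_max_nuclear TYPE('b) (univ_index G) (group_opsys G \<uu>)
              \<longleftrightarrow> finite (carrier G) \<and> order G \<le> 3))"
proof -
  interpret group G
    by (rule assms(1))
  have closure: "carrier G = symmetric_closure G \<uu>"
    if "min_max_nuclear TYPE('b) (univ_index G) (group_opsys G \<uu>)"
    by (rule nuclear_imp_carrier_eq[OF that assms(3)])
  have "finite (carrier G)" if "finite \<uu>" "min_max_nuclear TYPE('b) (univ_index G) (group_opsys G \<uu>)"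
    unfolding closure[OF that(2)] using that(1) by (simp add: symmetric_closure_def)
  moreover have "finite (carrier G) \<and> order G \<le> 3"
    if "minimal_generating_set G \<uu>" "min_max_nuclear TYPE('b) (univ_index G) (group_opsys G \<uu>)"
    by (rule symmetric_closure_card_le_3[OF that(1) closure[OF that(2)]])
  moreover have "min_max_nuclear TYPE('b) (univ_index G) (group_opsys G \<uu>)"
    if "finite (carrier G) \<and> order G \<le> 3"
    using that order_le_3_imp_nuclear[OF _ _ assms(3)] by blast
  ultimately show ?thesis
    by blast
qed

end
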